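(* Let $d=1$ and $$w(\xi)=\sum_{n=-\infty}^{\infty}\frac{\mathbf{1}_{[-1/2+n,\,1/2+n)}(\xi)}{|n|!},\qquad \xi\in\mathbb{R},$$ and let $k(x,y)=\widehat{w}(x-y)$. Then: (1) if $U\subset\mathbb{R}$ is open and $f:U\to\mathbb{R}$ is a map with $\mathcal{D}(C_f)=H_k$ (so that $C_f:H_k\to H_{k|_{U^2}}$ is bounded), then $f$ is (the restriction of) an affine map; (2) $H_k$ contains (restrictions to $\mathbb{R}$ of) entire functions of infinite order.
   Context: $\mathbf{1}_A$ is the characteristic function of $A$. Fourier transform: $\widehat{h}(\xi)=\int_{\mathbb{R}}h(x)e^{-2\pi i x\xi}\,dx$. For a positive definite kernel $k$ on a set $E$, $H_k\subset\mathbb{C}^E$ is the reproducing kernel Hilbert space (RKHS) of $k$: $k_x:=k(x,\cdot)\in H_k$ and $\langle h,k_x\rangle_{H_k}=h(x)$. $H_{k|_{U^2}}\subset\mathbb{C}^U$ is the RKHS of the restriction of $k$ to $U\times U$. The composition operator $C_f:H_k\to H_{k|_{U^2}}$ is $C_fh=h\circ f$ with domain $\mathcal{D}(C_f)=\{h\in H_k:h\circ f\in H_{k|_{U^2}}\}$. Every element of this $H_k$ extends to an entire function on $\mathbb{C}$. *)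

theory Defs
  imports "HOL-Complex_Analysis.Complex_Analysis"
begin

(* An element of \<complex>^E is encoded as a total function that is 0 outside E, so that equality
   of functions is equality on E. *)

definition zero_outside :: "'a set \<Rightarrow> ('a \<Rightarrow> complex) \<Rightarrow> 'a \<Rightarrow> complex" where
  "zero_outside E h = (\<lambda>x. if x \<in> E then h x else 0)"

definition ip_norm :: "('v \<Rightarrow> 'v \<Rightarrow> complex) \<Rightarrow> 'v \<Rightarrow> real" where
  "ip_norm ip h = sqrt (Re (ip h h))"

(* Inner products are linear in the first argument.
   Nothing is required of ip outside H \<times> H. *)

definition function_hilbert_space ::
    "('a \<Rightarrow> complex) set \<Rightarrow> (('a \<Rightarrow> complex) \<Rightarrow> ('a \<Rightarrow> complex) \<Rightarrow> complex) \<Rightarrow> bool" where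
  "function_hilbert_space H ip \<longleftrightarrow>
     (\<lambda>x. 0) \<in> H \<and>
     (\<forall>g\<in>H. \<forall>h\<in>H. (\<lambda>x. g x + h x) \<in> H) \<and>
     (\<forall>c. \<forall>h\<in>H. (\<lambda>x. c * h x) \<in> H) \<and>
     (\<forall>f\<in>H. \<forall>g\<in>H. \<forall>h\<in>H. ip (\<lambda>x. f x + g x) h = ip f h + ip g h) \<and>
     (\<forall>c. \<forall>g\<in>H. \<forall>h\<in>H. ip (\<lambda>x. c * g x) h = c * ip g h) \<and>
     (\<forall>g\<in>H. \<forall>h\<in>H. ip h g = cnj (ip g h)) \<and>
     (\<forall>h\<in>H. h \<noteq> (\<lambda>x. 0) \<longrightarrow> 0 < Re (ip h h)) \<and>
     (\<forall>s :: nat \<Rightarrow> 'a \<Rightarrow> complex.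
        (\<forall>n. s n \<in> H) \<and>
        (\<forall>e>0. \<exists>N. \<forall>m\<ge>N. \<forall>n\<ge>N. ip_norm ip (\<lambda>x. s m x - s n x) < e) \<longrightarrow>
        (\<exists>h\<in>H. (\<lambda>n. ip_norm ip (\<lambda>x. s n x - h x)) \<longlonglongrightarrow> 0))"

definition is_rkhs ::
    "'a set \<Rightarrow> ('a \<Rightarrow> 'a \<Rightarrow> complex) \<Rightarrow> ('a \<Rightarrow> complex) set \<Rightarrow>
     (('a \<Rightarrow> complex) \<Rightarrow> ('a \<Rightarrow> complex) \<Rightarrow> complex) \<Rightarrow> bool" where
  "is_rkhs E k H ip \<longleftrightarrow>
     function_hilbert_space H ip \<and>
     (\<forall>h\<in>H. \<forall>x. x \<notin> E \<longrightarrow> h x = 0) \<and>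
     (\<forall>x\<in>E. zero_outside E (k x) \<in> H) \<and>
     (\<forall>x\<in>E. \<forall>h\<in>H. ip h (zero_outside E (k x)) = h x)"

(* For a positive definite kernel k on E, the Moore-Aronszajn theorem says that exactly one H
   satisfies is_rkhs, and that ip is determined on H \<times> H.  Only the values of k on E \<times> E
   matter, so rkhs U k is the space of the restriction of k to U \<times> U. *)

definition rkhs :: "'a set \<Rightarrow> ('a \<Rightarrow> 'a \<Rightarrow> complex) \<Rightarrow> ('a \<Rightarrow> complex) set" where
  "rkhs E k = (THE H. \<exists>ip. is_rkhs E k H ip)"

definition rkhs_inner ::
    "'a set \<Rightarrow> ('a \<Rightarrow> 'a \<Rightarrow> complex) \<Rightarrow> ('a \<Rightarrow> complex) \<Rightarrow> ('a \<Rightarrow> complex) \<Rightarrow> complex" where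
  "rkhs_inner E k = (SOME ip. is_rkhs E k (rkhs E k) ip)"

definition rkhs_norm :: "'a set \<Rightarrow> ('a \<Rightarrow> 'a \<Rightarrow> complex) \<Rightarrow> ('a \<Rightarrow> complex) \<Rightarrow> real" where
  "rkhs_norm E k = ip_norm (rkhs_inner E k)"

(* For f : U \<rightarrow> E; only the values of f on U matter. *)

definition comp_op :: "'a set \<Rightarrow> ('a \<Rightarrow> 'a) \<Rightarrow> ('a \<Rightarrow> complex) \<Rightarrow> 'a \<Rightarrow> complex" where
  "comp_op U f h = zero_outside U (h \<circ> f)"

definition comp_op_domain ::
    "'a set \<Rightarrow> ('a \<Rightarrow> 'a \<Rightarrow> complex) \<Rightarrow> 'a set \<Rightarrow> ('a \<Rightarrow> 'a) \<Rightarrow> ('a \<Rightarrow> complex) set" where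
  "comp_op_domain E k U f = {h \<in> rkhs E k. comp_op U f h \<in> rkhs U k}"

definition comp_op_bounded ::
    "'a set \<Rightarrow> ('a \<Rightarrow> 'a \<Rightarrow> complex) \<Rightarrow> 'a set \<Rightarrow> ('a \<Rightarrow> 'a) \<Rightarrow> bool" where
  "comp_op_bounded E k U f \<longleftrightarrow>
     (\<exists>B. \<forall>h\<in>comp_op_domain E k U f. rkhs_norm U k (comp_op U f h) \<le> B * rkhs_norm E k h)"

definition fourier :: "(real \<Rightarrow> complex) \<Rightarrow> real \<Rightarrow> complex" where
  "fourier h \<xi> = (LINT x|lborel. h x * exp (- 2 * of_real pi * \<i> * of_real x * of_real \<xi>))"

(* For every argument exactly one summand is nonzero. *)

definition weight :: "real \<Rightarrow> real" where
  "weight \<xi> = (\<Sum>\<^sub>\<infinity>n\<in>(UNIV :: int set).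
     indicat_real {- 1/2 + real_of_int n ..< 1/2 + real_of_int n} \<xi> / fact (nat \<bar>n\<bar>))"

definition weight_kernel :: "real \<Rightarrow> real \<Rightarrow> complex" where
  "weight_kernel x y = fourier (\<lambda>\<xi>. complex_of_real (weight \<xi>)) (x - y)"

definition max_modulus :: "(complex \<Rightarrow> complex) \<Rightarrow> real \<Rightarrow> real" where
  "max_modulus F r = (SUP z\<in>sphere 0 r. norm (F z))"

definition entire_order :: "(complex \<Rightarrow> complex) \<Rightarrow> ereal" where
  "entire_order F = Limsup at_top (\<lambda>r. ereal (ln (ln (max_modulus F r)) / ln r))"

end

theory Submission
  imports Defs "HOL-Probability.Probability" "HOL-Real_Asymp.Real_Asymp"
begin

text \<open>
  The Fourier transform identifies \<open>H_k\<close> with the space \<open>L\<^sup>2\<close> of the measure with density \<open>w\<close>: its elements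
  are the functions \<open>g z = \<integral> \<phi> \<xi> exp (2 pi \<i> \<xi> z) w \<xi> d\<xi>\<close> (\<open>is_rkhs_weight_kernel\<close>). Completeness of
  the \<open>L\<^sup>2\<close> space and the uniqueness of Fourier transforms make this a reproducing kernel Hilbert space, and
  a density argument shows that there is only one such space (\<open>rkhs_eqI\<close>). Because \<open>w\<close> decays like
  \<open>1 / n!\<close>, all these functions are entire, and \<open>\<bar>g z\<bar>\<close> is bounded by \<open>exp (C exp (4 pi \<bar>Im z\<bar>))\<close> up
  to constants. The space for a nonempty open set \<open>U\<close> consists of the restrictions of the same functions.

  The growth of the elements is really doubly exponential. The function \<open>k 0\<close>, the transform
  of \<open>\<phi> = 1\<close>, exceeds \<open>exp (exp r)\<close> at \<open>- \<i> r\<close> for large \<open>r\<close> and hence has infinite order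
  (\<open>entire_order_synthesis_one\<close>). Band by band, the modulated sinc functions
  \<open>exp (2 pi \<i> n (x - t)) sinc (x - t)\<close> have squared norm \<open>\<bar>n\<bar>!\<close>.

  Let the composition operator of \<open>f\<close> be defined on all of \<open>H_k\<close>. By uniform boundedness it is bounded
  (\<open>composition_bounded\<close>). Composing the modulated sinc functions with \<open>f\<close> gives functions that extend
  to entire functions \<open>S n t\<close>. Their quotients extend \<open>exp (2 pi \<i> (f - t))\<close> to an entire function without zeros,
  whose logarithm provides an entire extension \<open>F\<close> of \<open>f\<close> (\<open>symbol_entire_extension\<close>). Choosing
  \<open>t = Re (F z)\<close>, boundedness implies
  \<open>exp (2 pi m \<bar>Im (F z)\<bar>) \<le> B m! + K (Im z)\<close> for all natural numbers \<open>m\<close>,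
  where \<open>K\<close> is the doubly exponential bound. With \<open>m\<close> about \<open>exp (4 pi \<bar>Im z\<bar>)\<close> this says that \<open>\<bar>Im (F z)\<bar>\<close> is
  at most linear in \<open>\<bar>z\<bar>\<close>, so \<open>F\<close> is affine (\<open>entire_Im_linear_bound_imp_affine\<close>). Finally, the values
  of the sinc functions determine \<open>f x = F x\<close> at every point of \<open>U\<close>, also when \<open>U\<close> is disconnected.
\<close>

section \<open>Hilbert spaces of functions\<close>

context
  fixes H :: "('a \<Rightarrow> complex) set" and ip :: "('a \<Rightarrow> complex) \<Rightarrow> ('a \<Rightarrow> complex) \<Rightarrow> complex"
  assumes hilbert: "function_hilbert_space H ip"
begin

lemma
  shows fhs_zero: "(\<lambda>x. 0) \<in> H"
    and fhs_add: "g \<in> H \<Longrightarrow> h \<in> H \<Longrightarrow> (\<lambda>x. g x + h x) \<in> H"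
    and fhs_scale: "h \<in> H \<Longrightarrow> (\<lambda>x. c * h x) \<in> H"
    and fhs_ip_add_left: "u \<in> H \<Longrightarrow> g \<in> H \<Longrightarrow> h \<in> H \<Longrightarrow> ip (\<lambda>x. u x + g x) h = ip u h + ip g h"
    and fhs_ip_scale_left: "g \<in> H \<Longrightarrow> h \<in> H \<Longrightarrow> ip (\<lambda>x. c * g x) h = c * ip g h"
    and fhs_ip_commute: "g \<in> H \<Longrightarrow> h \<in> H \<Longrightarrow> ip h g = cnj (ip g h)"
    and fhs_ip_pos: "h \<in> H \<Longrightarrow> h \<noteq> (\<lambda>x. 0) \<Longrightarrow> 0 < Re (ip h h)"
  using hilbert unfolding function_hilbert_space_def by metis+

lemma fhs_complete:
  assumes "\<And>n. s n \<in> H"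
    and "\<And>e. e > 0 \<Longrightarrow> \<exists>N::nat. \<forall>m\<ge>N. \<forall>n\<ge>N. ip_norm ip (\<lambda>x. s m x - s n x) < e"
  obtains h where "h \<in> H" "(\<lambda>n. ip_norm ip (\<lambda>x. s n x - h x)) \<longlonglongrightarrow> 0"
proof -
  have "\<exists>h\<in>H. (\<lambda>n. ip_norm ip (\<lambda>x. s n x - h x)) \<longlonglongrightarrow> 0"
    by (rule hilbert[unfolded function_hilbert_space_def, THEN conjunct2, THEN conjunct2, THEN conjunct2,
        THEN conjunct2, THEN conjunct2, THEN conjunct2, THEN conjunct2, THEN spec, THEN mp])
      (use assms in simp)
  then show ?thesis using that by blast
qed

lemma fhs_diff: "g \<in> H \<Longrightarrow> h \<in> H \<Longrightarrow> (\<lambda>x. g x - h x) \<in> H"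
  using fhs_add[of g "\<lambda>x. -1 * h x"] fhs_scale[of h "-1"] by simp

lemma fhs_ip_diff_left:
  assumes "u \<in> H" "g \<in> H" "h \<in> H" shows "ip (\<lambda>x. u x - g x) h = ip u h - ip g h"
proof -
  have "ip (\<lambda>x. u x + -1 * g x) h = ip u h + ip (\<lambda>x. -1 * g x) h"
    by (rule fhs_ip_add_left[OF assms(1) fhs_scale[OF assms(2)] assms(3)])
  also have "ip (\<lambda>x. -1 * g x) h = -1 * ip g h"
    by (rule fhs_ip_scale_left[OF assms(2,3)])
  finally show ?thesis by simp
qed

lemma fhs_ip_add_right:
  assumes "u \<in> H" "g \<in> H" "h \<in> H" shows "ip h (\<lambda>x. u x + g x) = ip h u + ip h g"
  unfolding fhs_ip_commute[OF fhs_add[OF assms(1,2)] assms(3)] fhs_ip_add_left[OF assms]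
  by (simp add: fhs_ip_commute[OF assms(1,3), symmetric] fhs_ip_commute[OF assms(2,3), symmetric])

lemma fhs_ip_diff_right:
  assumes "u \<in> H" "g \<in> H" "h \<in> H" shows "ip h (\<lambda>x. u x - g x) = ip h u - ip h g"
  unfolding fhs_ip_commute[OF fhs_diff[OF assms(1,2)] assms(3)] fhs_ip_diff_left[OF assms]
  by (simp add: fhs_ip_commute[OF assms(1,3), symmetric] fhs_ip_commute[OF assms(2,3), symmetric])

lemma fhs_ip_scale_right:
  assumes "g \<in> H" "h \<in> H" shows "ip h (\<lambda>x. c * g x) = cnj c * ip h g"
  unfolding fhs_ip_commute[OF fhs_scale[OF assms(1)] assms(2)] fhs_ip_scale_left[OF assms]
  by (simp add: fhs_ip_commute[OF assms, symmetric])

lemma fhs_ip_zero_left: "h \<in> H \<Longrightarrow> ip (\<lambda>x. 0) h = 0"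
  using fhs_ip_scale_left[of h h 0] by simp

lemma fhs_ip_zero_right: "h \<in> H \<Longrightarrow> ip h (\<lambda>x. 0) = 0"
  using fhs_ip_scale_right[of h h 0] by simp

lemma fhs_ip_self_nonneg: "h \<in> H \<Longrightarrow> 0 \<le> Re (ip h h)"
  using fhs_ip_pos[of h] fhs_ip_zero_left[of h] by fastforce

lemma fhs_norm_square: "h \<in> H \<Longrightarrow> (ip_norm ip h)\<^sup>2 = Re (ip h h)"
  by (simp add: ip_norm_def fhs_ip_self_nonneg)

lemma fhs_ip_self: "h \<in> H \<Longrightarrow> ip h h = of_real ((ip_norm ip h)\<^sup>2)"
  using fhs_ip_commute[of h h] by (simp add: fhs_norm_square complex_eq_iff)

lemma fhs_norm_nonneg: "h \<in> H \<Longrightarrow> 0 \<le> ip_norm ip h"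
  by (simp add: ip_norm_def fhs_ip_self_nonneg)

lemma fhs_norm_zero: "ip_norm ip (\<lambda>x. 0) = 0"
  using fhs_ip_zero_left[OF fhs_zero] by (simp add: ip_norm_def)

lemma fhs_norm_eq_0: "h \<in> H \<Longrightarrow> ip_norm ip h = 0 \<Longrightarrow> h = (\<lambda>x. 0)"
  using fhs_ip_pos[of h] by (fastforce simp: ip_norm_def)

lemma fhs_norm_scale:
  assumes "h \<in> H" shows "ip_norm ip (\<lambda>x. c * h x) = cmod c * ip_norm ip h"
proof -
  have "ip (\<lambda>x. c * h x) (\<lambda>x. c * h x) = (c * cnj c) * ip h h"
    using assms fhs_scale[of h c] by (simp add: fhs_ip_scale_left fhs_ip_scale_right)
  also have "c * cnj c = of_real ((cmod c)\<^sup>2)" by (metis complex_norm_square)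
  finally have "Re (ip (\<lambda>x. c * h x) (\<lambda>x. c * h x)) = (cmod c)\<^sup>2 * Re (ip h h)" by simp
  then show ?thesis by (simp add: ip_norm_def real_sqrt_mult)
qed

lemma fhs_norm_minus: "h \<in> H \<Longrightarrow> ip_norm ip (\<lambda>x. - h x) = ip_norm ip h"
  using fhs_norm_scale[of h "-1"] by simp

lemma fhs_norm_diff_commute:
  "g \<in> H \<Longrightarrow> h \<in> H \<Longrightarrow> ip_norm ip (\<lambda>x. g x - h x) = ip_norm ip (\<lambda>x. h x - g x)"
  using fhs_norm_minus[OF fhs_diff[of h g]] by simp

lemma fhs_norm_diff_square:
  assumes "g \<in> H" "h \<in> H"
  shows "(ip_norm ip (\<lambda>x. g x - h x))\<^sup>2 = (ip_norm ip g)\<^sup>2 - 2 * Re (ip g h) + (ip_norm ip h)\<^sup>2"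
proof -
  have "Re (ip h g) = Re (ip g h)" using fhs_ip_commute[of g h] assms by simp
  then show ?thesis
    using assms by (simp add: fhs_norm_square fhs_diff fhs_ip_diff_left fhs_ip_diff_right)
qed

lemma fhs_norm_add_square:
  assumes "g \<in> H" "h \<in> H"
  shows "(ip_norm ip (\<lambda>x. g x + h x))\<^sup>2 = (ip_norm ip g)\<^sup>2 + 2 * Re (ip g h) + (ip_norm ip h)\<^sup>2"
proof -
  have "Re (ip h g) = Re (ip g h)" using fhs_ip_commute[of g h] assms by simp
  then show ?thesis
    using assms by (simp add: fhs_norm_square fhs_add fhs_ip_add_left fhs_ip_add_right)
qed

text \<open>If \<open>g\<close> is nearly as short as any \<open>g - c h\<close>, then \<open>g\<close> is nearly orthogonal to \<open>h\<close>. With \<open>D = 0\<close>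
  and \<open>e\<close> the squared norm of \<open>g\<close> this becomes the Cauchy-Schwarz inequality; with \<open>D\<close> a squared
  distance to a subspace it provides the orthogonality of minimizing sequences.\<close>

lemma fhs_ip_le:
  assumes "g \<in> H" "h \<in> H"
    and "\<And>c. D \<le> (ip_norm ip (\<lambda>x. g x - c * h x))\<^sup>2" "(ip_norm ip g)\<^sup>2 \<le> D + e"
  shows "(cmod (ip g h))\<^sup>2 \<le> e * (ip_norm ip h)\<^sup>2"
proof (cases "ip_norm ip h = 0")
  case True
  then show ?thesis
    using assms fhs_norm_eq_0[of h] fhs_ip_commute[of h g] fhs_ip_zero_left[of g] by auto
next
  case False
  define q where "q = (ip_norm ip h)\<^sup>2"
  define c where "c = ip g h / of_real q"
  have q: "q > 0" using False by (simp add: q_def)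
  \<comment> \<open>This \<open>c\<close> makes \<open>c h\<close> the orthogonal projection of \<open>g\<close> to the line through \<open>h\<close>.\<close>
  have "D \<le> (ip_norm ip g)\<^sup>2 - 2 * Re (ip g (\<lambda>x. c * h x)) + (ip_norm ip (\<lambda>x. c * h x))\<^sup>2"
    using assms(3)[of c] fhs_norm_diff_square[of g "\<lambda>x. c * h x"] fhs_scale[of h c] assms by simp
  also have "ip g (\<lambda>x. c * h x) = of_real ((cmod (ip g h))\<^sup>2 / q)"
  proof -
    have "cnj c * ip g h = ip g h * cnj (ip g h) / of_real q" by (simp add: c_def)
    then show ?thesis
      unfolding fhs_ip_scale_right[OF assms(2,1)] of_real_divide complex_norm_square[symmetric] .
  qed
  also have "(ip_norm ip (\<lambda>x. c * h x))\<^sup>2 = (cmod (ip g h))\<^sup>2 / q"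
    unfolding fhs_norm_scale[OF assms(2)] power_mult_distrib q_def[symmetric]
    using q by (simp add: c_def norm_divide power_divide) (simp add: power2_eq_square)
  finally have "(cmod (ip g h))\<^sup>2 / q \<le> e" using assms(4) by simp
  then have "(cmod (ip g h))\<^sup>2 \<le> e * q" using q by (simp only: pos_divide_le_eq)
  then show ?thesis unfolding q_def .
qed

lemma fhs_Cauchy_Schwarz:
  assumes "g \<in> H" "h \<in> H"
  shows "cmod (ip g h) \<le> ip_norm ip g * ip_norm ip h"
proof -
  have "(cmod (ip g h))\<^sup>2 \<le> (ip_norm ip g)\<^sup>2 * (ip_norm ip h)\<^sup>2"
    by (rule fhs_ip_le[OF assms, where D = 0]) auto
  then have "(cmod (ip g h))\<^sup>2 \<le> (ip_norm ip g * ip_norm ip h)\<^sup>2" by (simp only: power_mult_distrib)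
  then show ?thesis
    by (rule power2_le_imp_le) (intro mult_nonneg_nonneg fhs_norm_nonneg assms)
qed

lemma fhs_norm_triangle:
  assumes "g \<in> H" "h \<in> H"
  shows "ip_norm ip (\<lambda>x. g x + h x) \<le> ip_norm ip g + ip_norm ip h"
proof (rule power2_le_imp_le)
  have "Re (ip g h) \<le> ip_norm ip g * ip_norm ip h"
    using fhs_Cauchy_Schwarz[OF assms] complex_Re_le_cmod order_trans by blast
  then show "(ip_norm ip (\<lambda>x. g x + h x))\<^sup>2 \<le> (ip_norm ip g + ip_norm ip h)\<^sup>2"
    using assms by (simp add: fhs_norm_add_square power2_sum)
qed (use assms in \<open>simp add: fhs_norm_nonneg\<close>)

lemma fhs_norm_triangle_diff:
  assumes "f \<in> H" "g \<in> H" "h \<in> H"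
  shows "ip_norm ip (\<lambda>x. f x - h x) \<le> ip_norm ip (\<lambda>x. f x - g x) + ip_norm ip (\<lambda>x. g x - h x)"
  using fhs_norm_triangle[OF fhs_diff[OF assms(1,2)] fhs_diff[OF assms(2,3)]] by simp

lemma fhs_norm_le_add_diff:
  assumes "g \<in> H" "h \<in> H"
  shows "ip_norm ip g \<le> ip_norm ip h + ip_norm ip (\<lambda>x. g x - h x)"
  using fhs_norm_triangle[OF assms(2) fhs_diff[OF assms]] by simp

lemma fhs_Cauchy_of_tendsto:
  assumes "\<And>n. s n \<in> H" "h \<in> H" "(\<lambda>n. ip_norm ip (\<lambda>x. s n x - h x)) \<longlonglongrightarrow> 0" "e > 0"
  shows "\<exists>N::nat. \<forall>m\<ge>N. \<forall>n\<ge>N. ip_norm ip (\<lambda>x. s m x - s n x) < e"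
proof -
  have "\<forall>\<^sub>F n in sequentially. ip_norm ip (\<lambda>x. s n x - h x) < e / 2"
    using assms by (intro order_tendstoD) auto
  then obtain N where N: "\<And>n. n \<ge> N \<Longrightarrow> ip_norm ip (\<lambda>x. s n x - h x) < e / 2"
    by (auto simp: eventually_sequentially)
  have "ip_norm ip (\<lambda>x. s m x - s n x) < e" if "m \<ge> N" "n \<ge> N" for m n
    using fhs_norm_triangle_diff[OF assms(1)[of m] assms(2) assms(1)[of n]] N[OF that(1)] N[OF that(2)]
      fhs_norm_diff_commute[OF assms(1)[of n] assms(2)] by linarith
  then show ?thesis by blast
qed

lemma fhs_ip_tendsto:
  assumes "\<And>n. s n \<in> H" "h \<in> H" "g \<in> H" "(\<lambda>n. ip_norm ip (\<lambda>x. s n x - h x)) \<longlonglongrightarrow> 0"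
  shows "(\<lambda>n. ip (s n) g) \<longlonglongrightarrow> ip h g"
proof (rule LIM_zero_cancel)
  have "cmod (ip (s n) g - ip h g) \<le> ip_norm ip (\<lambda>x. s n x - h x) * ip_norm ip g" for n
    using fhs_Cauchy_Schwarz[OF fhs_diff[OF assms(1)[of n] assms(2)] assms(3)]
    by (simp only: fhs_ip_diff_left[OF assms(1)[of n] assms(2,3)])
  then show "(\<lambda>n. ip (s n) g - ip h g) \<longlonglongrightarrow> 0"
    by (intro Lim_null_comparison[OF always_eventually tendsto_mult_left_zero[OF assms(4)]]) blast
qed

lemma fhs_norm_tendsto:
  assumes "\<And>n. s n \<in> H" "h \<in> H" "(\<lambda>n. ip_norm ip (\<lambda>x. s n x - h x)) \<longlonglongrightarrow> 0"
  shows "(\<lambda>n. ip_norm ip (s n)) \<longlonglongrightarrow> ip_norm ip h"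
proof (rule LIM_zero_cancel)
  have "norm (ip_norm ip (s n) - ip_norm ip h) \<le> ip_norm ip (\<lambda>x. s n x - h x)" for n
    using fhs_norm_le_add_diff[OF assms(1)[of n] assms(2)] fhs_norm_le_add_diff[OF assms(2) assms(1)[of n]]
      fhs_norm_diff_commute[OF assms(2) assms(1)[of n]] by simp
  then show "(\<lambda>n. ip_norm ip (s n) - ip_norm ip h) \<longlonglongrightarrow> 0"
    by (intro Lim_null_comparison[OF always_eventually assms(3)]) blast
qed

text \<open>The argument is Sokal's. If the operator norms \<open>s n\<close> of suitable \<open>l n\<close> grow faster than \<open>4 ^ n\<close>,
  then steps of length \<open>3 ^ (- n)\<close>, each taken in the direction that makes \<open>l n\<close> large, lead to a limit
  at which all \<open>l n\<close> remain large: the steps after the \<open>n\<close>-th have total length half of the \<open>n\<close>-th,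
  so they cannot undo what it gained.\<close>

lemma fhs_uniform_boundedness:
  fixes L :: "(('a \<Rightarrow> complex) \<Rightarrow> complex) set"
  assumes lin: "\<And>l g h. l \<in> L \<Longrightarrow> g \<in> H \<Longrightarrow> h \<in> H \<Longrightarrow> l (\<lambda>x. g x + h x) = l g + l h"
    and hom: "\<And>l c h. l \<in> L \<Longrightarrow> h \<in> H \<Longrightarrow> l (\<lambda>x. c * h x) = c * l h"
    and bdd: "\<And>l. l \<in> L \<Longrightarrow> \<exists>C. \<forall>h\<in>H. cmod (l h) \<le> C * ip_norm ip h"
    and pointwise: "\<And>h. h \<in> H \<Longrightarrow> \<exists>C. \<forall>l\<in>L. cmod (l h) \<le> C"
  shows "\<exists>C\<ge>0. \<forall>l\<in>L. \<forall>h\<in>H. cmod (l h) \<le> C * ip_norm ip h"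
proof (rule ccontr)
  assume unbounded: "\<not> ?thesis"
  have pos: "ip_norm ip h > 0" if "l \<in> L" "h \<in> H" "cmod (l h) > c * ip_norm ip h" for l h c
  proof (rule ccontr)
    assume "\<not> ip_norm ip h > 0"
    then have "ip_norm ip h = 0" using fhs_norm_nonneg[OF that(2)] by simp
    then have "h = (\<lambda>x. 0)" "cmod (l h) > 0" using fhs_norm_eq_0[OF that(2)] that(3) by auto
    then show False using hom[OF that(1,2), of 0] by simp
  qed
  have "\<exists>l s w. l \<in> L \<and> s > 4 ^ n \<and> (\<forall>h\<in>H. cmod (l h) \<le> s * ip_norm ip h) \<and>
      w \<in> H \<and> ip_norm ip w = (1/3) ^ n \<and> cmod (l w) > 9/10 * s * (1/3) ^ n" for n
  proof -
    obtain l h0 where l: "l \<in> L" "h0 \<in> H" "cmod (l h0) > 4 ^ n * ip_norm ip h0"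
      using unbounded zero_le_power[of "4::real" n] by (fastforce simp: not_le)
    \<comment> \<open>The infimum \<open>s\<close> of the bounds \<open>S\<close> is the operator norm of \<open>l\<close>.\<close>
    define S where "S = {C. \<forall>h\<in>H. cmod (l h) \<le> C * ip_norm ip h}"
    define s where "s = Inf S"
    have h0: "ip_norm ip h0 > 0"
      using pos l by blast
    have S_lower: "cmod (l h) / ip_norm ip h \<le> C" if "C \<in> S" "h \<in> H" "ip_norm ip h > 0" for C h
      using that by (auto simp: S_def field_simps)
    have "S \<noteq> {}" using bdd[OF l(1)] by (auto simp: S_def)
    have s_ge: "cmod (l h) / ip_norm ip h \<le> s" if "h \<in> H" "ip_norm ip h > 0" for h
      unfolding s_def by (rule cInf_greatest) (use S_lower that \<open>S \<noteq> {}\<close> in auto)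
    have s4: "s > 4 ^ n"
    proof -
      have "4 ^ n < cmod (l h0) / ip_norm ip h0" using l(3) h0 by (simp only: pos_less_divide_eq)
      then show ?thesis using s_ge[OF l(2) h0] by linarith
    qed
    have "bdd_below S" using S_lower l(2) h0 by (meson bdd_belowI)
    moreover have "9/10 * s < s" using s4 zero_less_power[of "4::real" n] by linarith
    ultimately have "9/10 * s \<notin> S" unfolding s_def by (meson cInf_lower not_le)
    then obtain u where u: "u \<in> H" "cmod (l u) > 9/10 * s * ip_norm ip u"
      by (auto simp: S_def not_le)
    have u0: "ip_norm ip u > 0"
      using pos l(1) u by blast
    define c where "c = complex_of_real ((1/3) ^ n / ip_norm ip u)"
    have c: "cmod c = (1/3) ^ n / ip_norm ip u" using u0 unfolding c_def norm_of_real by simp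
    have "cmod (l h) \<le> s * ip_norm ip h" if "h \<in> H" for h
    proof (cases "ip_norm ip h > 0")
      case True
      then show ?thesis using s_ge[OF that True] by (simp add: field_simps)
    next
      case False
      then have "h = (\<lambda>x. 0)"
        using fhs_norm_nonneg[OF that] by (intro fhs_norm_eq_0[OF that]) linarith
      then show ?thesis using hom[OF l(1) that, of 0] by (simp add: fhs_norm_zero)
    qed
    moreover have "ip_norm ip (\<lambda>x. c * u x) = (1/3) ^ n" using u0 u(1) c by (simp add: fhs_norm_scale)
    moreover have "cmod (l (\<lambda>x. c * u x)) > 9/10 * s * (1/3) ^ n"
    proof -
      have "cmod (l (\<lambda>x. c * u x)) = (1/3) ^ n / ip_norm ip u * cmod (l u)"
        using hom[OF l(1) u(1)] c by (simp add: norm_mult)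
      also have "\<dots> > (1/3) ^ n / ip_norm ip u * (9/10 * s * ip_norm ip u)"
        using u0 u(2) by (intro mult_strict_left_mono) auto
      finally show ?thesis using u0 by (simp add: field_simps)
    qed
    ultimately show ?thesis using l(1) s4 fhs_scale[OF u(1)] by blast
  qed
  then obtain l s w where l: "\<And>n. l n \<in> L" and s: "\<And>n. s n > 4 ^ n"
    and ls: "\<And>n h. h \<in> H \<Longrightarrow> cmod (l n h) \<le> s n * ip_norm ip h"
    and w: "\<And>n. w n \<in> H" "\<And>n. ip_norm ip (w n) = (1/3) ^ n"
    and lw: "\<And>n. cmod (l n (w n)) > 9/10 * s n * (1/3) ^ n"
    by metis
  define x where "x = rec_nat (\<lambda>_. 0) (\<lambda>n y. if cmod (l n (\<lambda>t. y t + w n t)) \<ge> cmod (l n (w n))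
      then (\<lambda>t. y t + w n t) else (\<lambda>t. y t - w n t))"
  have x0: "x 0 = (\<lambda>_. 0)" by (simp add: x_def)
  have xS: "x (Suc n) = (if cmod (l n (\<lambda>t. x n t + w n t)) \<ge> cmod (l n (w n))
      then (\<lambda>t. x n t + w n t) else (\<lambda>t. x n t - w n t))" for n
    by (simp add: x_def)
  have xH: "x n \<in> H" for n
    by (induction n) (auto simp: x0 xS fhs_zero w fhs_add fhs_diff)
  have lx: "cmod (l n (x (Suc n))) \<ge> cmod (l n (w n))" for n
  proof -
    \<comment> \<open>Of two functions \<open>x \<plusminus> w\<close> whose difference is \<open>2 w\<close>, one has an image at least as large as that of \<open>w\<close>.\<close>
    have "l n (\<lambda>t. x n t - w n t) = l n (x n) - l n (w n)"
      using lin[OF l[of n] xH[of n] fhs_scale[OF w(1)[of n], of "-1"]] hom[OF l[of n] w(1)[of n], of "-1"] by simp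
    moreover have "l n (\<lambda>t. x n t + w n t) = l n (x n) + l n (w n)" using lin[OF l[of n] xH[of n] w(1)[of n]] .
    moreover have "2 * cmod (l n (w n)) \<le> cmod (l n (x n) + l n (w n)) + cmod (l n (x n) - l n (w n))"
      using norm_triangle_ineq4[of "l n (x n) + l n (w n)" "l n (x n) - l n (w n)"]
      by (simp add: norm_mult flip: mult_2)
    ultimately show ?thesis unfolding xS by simp
  qed
  have step: "ip_norm ip (\<lambda>t. x (Suc n) t - x n t) = (1/3) ^ n" for n
    using w fhs_norm_minus[OF w(1)[of n]] by (simp add: xS)
  have tail: "ip_norm ip (\<lambda>t. x (n + k) t - x n t) \<le> 3/2 * (1/3) ^ n * (1 - (1/3) ^ k)" for n k
  proof (induction k)
    case (Suc k)
    have "ip_norm ip (\<lambda>t. x (n + Suc k) t - x n t) \<le> (1/3) ^ (n + k) + 3/2 * (1/3) ^ n * (1 - (1/3) ^ k)"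
      using fhs_norm_triangle_diff[OF xH[of "n + Suc k"] xH[of "n + k"] xH[of n]] Suc step[of "n + k"] by simp
    then show ?case by (simp add: power_add field_simps)
  qed (simp add: fhs_norm_zero)
  have tail': "ip_norm ip (\<lambda>t. x m t - x n t) \<le> 3/2 * (1/3) ^ n" if "n \<le> m" for m n
  proof -
    have "3/2 * (1/3::real) ^ n * (1 - (1/3) ^ (m - n)) \<le> 3/2 * (1/3) ^ n * 1"
      by (intro mult_left_mono) auto
    from order_trans[OF tail[of n "m - n"] this] show ?thesis using that by simp
  qed
  obtain h where h: "h \<in> H" "(\<lambda>n. ip_norm ip (\<lambda>t. x n t - h t)) \<longlonglongrightarrow> 0"
  proof (rule fhs_complete[of x])
    fix e :: real assume "e > 0"
    have "(\<lambda>n. 3/2 * (1/3::real) ^ n) \<longlonglongrightarrow> 0" by real_asymp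
    then have "\<forall>\<^sub>F n in sequentially. 3/2 * (1/3::real) ^ n < e / 2"
      by (rule order_tendstoD(2)) (use \<open>e > 0\<close> in simp)
    then obtain N where N: "3/2 * (1/3::real) ^ N < e / 2" by (auto simp: eventually_sequentially)
    have "ip_norm ip (\<lambda>t. x m t - x n t) < e" if "m \<ge> N" "n \<ge> N" for m n
      using fhs_norm_triangle_diff[OF xH[of m] xH[of N] xH[of n]] tail'[OF that(1)] tail'[OF that(2)] N
        fhs_norm_diff_commute[OF xH[of N] xH[of n]] by linarith
    then show "\<exists>N. \<forall>m\<ge>N. \<forall>n\<ge>N. ip_norm ip (\<lambda>t. x m t - x n t) < e" by blast
  qed (use xH in auto)
  have tail_h: "ip_norm ip (\<lambda>t. h t - x n t) \<le> 3/2 * (1/3) ^ n" for n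
  proof (rule LIMSEQ_le_const2)
    have "(\<lambda>m. ip_norm ip (\<lambda>t. (x m t - x n t) - (h t - x n t))) \<longlonglongrightarrow> 0" using h(2) by simp
    then show "(\<lambda>m. ip_norm ip (\<lambda>t. x m t - x n t)) \<longlonglongrightarrow> ip_norm ip (\<lambda>t. h t - x n t)"
      by (intro fhs_norm_tendsto fhs_diff xH h)
  qed (use tail' in blast)
  obtain C where C: "\<And>n. cmod (l n h) \<le> C" using pointwise[OF h(1)] l by meson
  have "2/5 * (4/3) ^ n \<le> C" for n
  proof -
    have "cmod (l n (\<lambda>t. h t - x (Suc n) t)) \<le> s n * (3/2 * (1/3) ^ Suc n)"
      using ls[OF fhs_diff[OF h(1) xH], of n "Suc n"] mult_left_mono[OF tail_h[of "Suc n"], of "s n"] s[of n]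
        zero_less_power[of "4::real" n] by linarith
    moreover have "l n (x (Suc n)) = l n h - l n (\<lambda>t. h t - x (Suc n) t)"
      using lin[OF l[of n] fhs_diff[OF h(1) xH[of "Suc n"]] xH[of "Suc n"]] by simp
    ultimately have "cmod (l n h) \<ge> 9/10 * s n * (1/3) ^ n - s n * (3/2 * (1/3) ^ Suc n)"
      using lw[of n] lx[of n] norm_triangle_ineq4[of "l n h" "l n (\<lambda>t. h t - x (Suc n) t)"] by simp
    then have "2/5 * (s n * (1/3) ^ n) \<le> C" using C[of n] by simp
    moreover have "4 ^ n * (1/3) ^ n \<le> s n * (1/3) ^ n" using s[of n] by (intro mult_right_mono) auto
    ultimately show ?thesis by (simp add: power_divide)
  qed
  moreover have "\<exists>n. 2/5 * (4/3) ^ n > C"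
  proof -
    have "filterlim (\<lambda>n. 2/5 * (4/3::real) ^ n) at_top sequentially" by real_asymp
    then have "\<forall>\<^sub>F n in sequentially. 2/5 * (4/3::real) ^ n > C" by (simp add: filterlim_at_top_dense)
    then show ?thesis by (auto simp: eventually_sequentially)
  qed
  ultimately show False by (meson not_le)
qed

end

section \<open>Reproducing kernel Hilbert spaces\<close>

lemma
  assumes "is_rkhs E k H ip"
  shows rkhs_hilbert: "function_hilbert_space H ip"
    and rkhs_outside: "h \<in> H \<Longrightarrow> x \<notin> E \<Longrightarrow> h x = 0"
    and rkhs_kernel_in: "x \<in> E \<Longrightarrow> zero_outside E (k x) \<in> H"
    and rkhs_reproducing: "x \<in> E \<Longrightarrow> h \<in> H \<Longrightarrow> ip h (zero_outside E (k x)) = h x"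
  using assms unfolding is_rkhs_def by auto

text \<open>A sequence in \<open>V\<close> that minimizes the distance to \<open>h\<close> is a Cauchy sequence by the parallelogram law,
  and its differences to \<open>h\<close> become orthogonal to \<open>V\<close>. As the kernel functions lie in \<open>V\<close>, the differences
  tend to 0 pointwise, so the limit of the sequence is \<open>h\<close>. The subspace \<open>V\<close> is left abstract, which
  allows it to be defined by any linear property of its elements instead of as a span.\<close>

lemma rkhs_subspace_dense:
  assumes rk: "is_rkhs E k H ip" and V: "V \<subseteq> H" "(\<lambda>x. 0) \<in> V"
    and V_add: "\<And>g h. g \<in> V \<Longrightarrow> h \<in> V \<Longrightarrow> (\<lambda>x. g x + h x) \<in> V"
    and V_scale: "\<And>c h. h \<in> V \<Longrightarrow> (\<lambda>x. c * h x) \<in> V"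
    and V_kernel: "\<And>x. x \<in> E \<Longrightarrow> zero_outside E (k x) \<in> V"
    and h: "h \<in> H"
  shows "\<exists>v. (\<forall>n. v n \<in> V) \<and> (\<lambda>n::nat. ip_norm ip (\<lambda>x. v n x - h x)) \<longlonglongrightarrow> 0"
proof -
  note hil = rkhs_hilbert[OF rk]
  define Q where "Q v = (ip_norm ip (\<lambda>x. h x - v x))\<^sup>2" for v
  define D where "D = Inf (Q ` V)"
  have bdd: "bdd_below (Q ` V)" by (auto simp: Q_def intro!: bdd_belowI[of _ 0])
  have D_le: "D \<le> Q v" if "v \<in> V" for v unfolding D_def by (rule cInf_lower) (use bdd that in auto)
  have "\<exists>v\<in>V. Q v < D + 1 / real (Suc n)" for n
  proof -
    have "\<exists>q\<in>Q ` V. q < D + 1 / real (Suc n)"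
      unfolding D_def using V(2) by (intro cInf_lessD) auto
    then show ?thesis by auto
  qed
  then obtain v where vV: "\<And>n. v n \<in> V" and vQ: "\<And>n. Q (v n) < D + 1 / real (Suc n)" by metis
  have vH: "v n \<in> H" for n using vV V(1) by auto
  have cauchy_sq: "(ip_norm ip (\<lambda>x. v m x - v n x))\<^sup>2 \<le> 2 / real (Suc m) + 2 / real (Suc n)" for m n
  proof -
    define a where "a = (\<lambda>x. h x - v m x)"
    define b where "b = (\<lambda>x. h x - v n x)"
    have ab: "a \<in> H" "b \<in> H" unfolding a_def b_def using fhs_diff[OF hil h vH] by auto
    have "(\<lambda>x. (1/2) * (v m x + v n x)) \<in> V" by (intro V_scale V_add vV)
    then have "D \<le> (ip_norm ip (\<lambda>x. h x - (1/2) * (v m x + v n x)))\<^sup>2"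
      using D_le unfolding Q_def by blast
    also have "(\<lambda>x. h x - (1/2) * (v m x + v n x)) = (\<lambda>x. (1/2) * (a x + b x))"
      by (auto simp: a_def b_def field_simps)
    also have "ip_norm ip \<dots> = 1/2 * ip_norm ip (\<lambda>x. a x + b x)"
      using fhs_norm_scale[OF hil fhs_add[OF hil ab], of "1/2"] by simp
    finally have "4 * D \<le> (ip_norm ip (\<lambda>x. a x + b x))\<^sup>2" by (simp add: power_divide)
    then have "(ip_norm ip (\<lambda>x. b x - a x))\<^sup>2 \<le> 2 * Q (v m) + 2 * Q (v n) - 4 * D"
      using fhs_norm_add_square[OF hil ab] fhs_norm_diff_square[OF hil ab]
        fhs_norm_diff_commute[OF hil ab] by (simp add: Q_def a_def b_def)
    moreover have "(\<lambda>x. b x - a x) = (\<lambda>x. v m x - v n x)" by (auto simp: a_def b_def)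
    ultimately show ?thesis using vQ[of m] vQ[of n] by simp
  qed
  have inv0: "(\<lambda>n. c / real (Suc n)) \<longlonglongrightarrow> 0" for c by real_asymp
  obtain p where p: "p \<in> H" "(\<lambda>n. ip_norm ip (\<lambda>x. v n x - p x)) \<longlonglongrightarrow> 0"
  proof (rule fhs_complete[OF hil, of v])
    fix e :: real assume e: "e > 0"
    have "\<forall>\<^sub>F n in sequentially. 2 / real (Suc n) < e\<^sup>2 / 2"
      by (rule order_tendstoD(2)[OF inv0]) (use e in simp)
    then obtain N where N: "\<And>n. n \<ge> N \<Longrightarrow> 2 / real (Suc n) < e\<^sup>2 / 2" by (auto simp: eventually_sequentially)
    have "ip_norm ip (\<lambda>x. v m x - v n x) < e" if "m \<ge> N" "n \<ge> N" for m n
      using cauchy_sq[of m n] N[OF that(1)] N[OF that(2)] e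
      by (intro power2_less_imp_less[of _ e]) auto
    then show "\<exists>N. \<forall>m\<ge>N. \<forall>n\<ge>N. ip_norm ip (\<lambda>x. v m x - v n x) < e" by blast
  qed (use vH in auto)
  have "p = h"
  proof
    fix y
    show "p y = h y"
    proof (cases "y \<in> E")
      case False
      then show ?thesis using rkhs_outside[OF rk h] rkhs_outside[OF rk p(1)] by simp
    next
      case True
      define u where "u = zero_outside E (k y)"
      have u: "u \<in> V" "u \<in> H" using V_kernel[OF True] V(1) by (auto simp: u_def)
      have repr: "ip g u = g y" if "g \<in> H" for g
        using rkhs_reproducing[OF rk True that] by (simp add: u_def)
      have bound: "(cmod (h y - v n y))\<^sup>2 \<le> 1 / real (Suc n) * (ip_norm ip u)\<^sup>2" for n
      proof -
        have "(cmod (ip (\<lambda>x. h x - v n x) u))\<^sup>2 \<le> 1 / real (Suc n) * (ip_norm ip u)\<^sup>2"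
        proof (rule fhs_ip_le[OF hil fhs_diff[OF hil h vH] u(2), where D = D])
          fix c
          show "D \<le> (ip_norm ip (\<lambda>x. (h x - v n x) - c * u x))\<^sup>2"
            using D_le[OF V_add[OF vV[of n] V_scale[OF u(1), of c]]] by (simp add: Q_def algebra_simps)
        qed (use vQ[of n] in \<open>simp add: Q_def\<close>)
        then show ?thesis using repr[OF fhs_diff[OF hil h vH]] by simp
      qed
      have "(\<lambda>n. (cmod (h y - v n y))\<^sup>2) \<longlonglongrightarrow> 0"
        by (rule Lim_null_comparison[OF always_eventually tendsto_mult_left_zero[OF inv0[of 1]]])
          (use bound in auto)
      then have "(\<lambda>n. cmod (h y - v n y)) \<longlonglongrightarrow> 0" by simp
      then have "(\<lambda>n. h y - v n y) \<longlonglongrightarrow> 0" by (rule tendsto_norm_zero_cancel)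
      then have "(\<lambda>n. h y - (h y - v n y)) \<longlonglongrightarrow> h y - 0" by (intro tendsto_intros)
      then have "(\<lambda>n. v n y) \<longlonglongrightarrow> h y" by simp
      moreover have "(\<lambda>n. v n y) \<longlonglongrightarrow> p y"
        using fhs_ip_tendsto[OF hil vH p(1) u(2) p(2)] repr vH p(1) by simp
      ultimately show ?thesis using LIMSEQ_unique by blast
    qed
  qed
  then show ?thesis using p(2) vV by blast
qed

text \<open>The functions that lie in both spaces and pair with the common functions in the same way form a
  subspace that contains the kernel functions, so it is dense in the first space. A sequence in it that
  converges in the first space is a Cauchy sequence in the second one, and convergence in either space
  implies pointwise convergence.\<close>

lemma rkhs_subset:
  assumes rk1: "is_rkhs E k H1 ip1" and rk2: "is_rkhs E k H2 ip2"
  shows "H1 \<subseteq> H2"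
proof
  note hil1 = rkhs_hilbert[OF rk1] and hil2 = rkhs_hilbert[OF rk2]
  define V where "V = {v \<in> H1 \<inter> H2. \<forall>u\<in>H1 \<inter> H2. ip1 u v = ip2 u v}"
  have VI: "v \<in> V" if "v \<in> H1" "v \<in> H2" "\<And>u. u \<in> H1 \<Longrightarrow> u \<in> H2 \<Longrightarrow> ip1 u v = ip2 u v" for v
    using that by (simp add: V_def)
  have VD: "v \<in> H1" "v \<in> H2" "\<And>u. u \<in> H1 \<Longrightarrow> u \<in> H2 \<Longrightarrow> ip1 u v = ip2 u v" if "v \<in> V" for v
    using that by (simp_all add: V_def)
  fix h assume h: "h \<in> H1"
  have "\<exists>v. (\<forall>n. v n \<in> V) \<and> (\<lambda>n::nat. ip_norm ip1 (\<lambda>x. v n x - h x)) \<longlonglongrightarrow> 0"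
  proof (rule rkhs_subspace_dense[OF rk1 _ _ _ _ _ h])
    show "V \<subseteq> H1" by (auto simp: V_def)
    show "(\<lambda>x. 0) \<in> V"
      by (intro VI) (simp_all only: fhs_zero[OF hil1] fhs_zero[OF hil2] fhs_ip_zero_right[OF hil1]
          fhs_ip_zero_right[OF hil2])
    show "(\<lambda>x. g x + h x) \<in> V" if "g \<in> V" "h \<in> V" for g h
    proof (rule VI)
      note g = VD[OF that(1)] and h = VD[OF that(2)]
      show "(\<lambda>x. g x + h x) \<in> H1" by (rule fhs_add[OF hil1 g(1) h(1)])
      show "(\<lambda>x. g x + h x) \<in> H2" by (rule fhs_add[OF hil2 g(2) h(2)])
      show "ip1 u (\<lambda>x. g x + h x) = ip2 u (\<lambda>x. g x + h x)" if "u \<in> H1" "u \<in> H2" for u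
        unfolding fhs_ip_add_right[OF hil1 g(1) h(1) that(1)] fhs_ip_add_right[OF hil2 g(2) h(2) that(2)]
        using g(3)[OF that] h(3)[OF that] by simp
    qed
    show "(\<lambda>x. c * h x) \<in> V" if "h \<in> V" for c h
    proof (rule VI)
      note h = VD[OF that]
      show "(\<lambda>x. c * h x) \<in> H1" by (rule fhs_scale[OF hil1 h(1)])
      show "(\<lambda>x. c * h x) \<in> H2" by (rule fhs_scale[OF hil2 h(2)])
      show "ip1 u (\<lambda>x. c * h x) = ip2 u (\<lambda>x. c * h x)" if "u \<in> H1" "u \<in> H2" for u
        unfolding fhs_ip_scale_right[OF hil1 h(1) that(1)] fhs_ip_scale_right[OF hil2 h(2) that(2)]
        using h(3)[OF that] by simp
    qed
    show "zero_outside E (k x) \<in> V" if x: "x \<in> E" for x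
      by (rule VI) (simp_all only: rkhs_kernel_in[OF rk1 x] rkhs_kernel_in[OF rk2 x]
          rkhs_reproducing[OF rk1 x] rkhs_reproducing[OF rk2 x])
  qed
  then obtain v where v: "\<And>n. v n \<in> V" "(\<lambda>n. ip_norm ip1 (\<lambda>x. v n x - h x)) \<longlonglongrightarrow> 0" by blast
  note vH1 = VD(1)[OF v(1)] and vH2 = VD(2)[OF v(1)]
  have norm_eq: "ip_norm ip1 (\<lambda>x. v m x - v n x) = ip_norm ip2 (\<lambda>x. v m x - v n x)" for m n
  proof -
    note d1 = fhs_diff[OF hil1 vH1[of m] vH1[of n]] and d2 = fhs_diff[OF hil2 vH2[of m] vH2[of n]]
    have "ip1 (\<lambda>x. v m x - v n x) (\<lambda>x. v m x - v n x) = ip2 (\<lambda>x. v m x - v n x) (\<lambda>x. v m x - v n x)"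
      unfolding fhs_ip_diff_right[OF hil1 vH1[of m] vH1[of n] d1] fhs_ip_diff_right[OF hil2 vH2[of m] vH2[of n] d2]
      using VD(3)[OF v(1)[of m] d1 d2] VD(3)[OF v(1)[of n] d1 d2] by simp
    then show ?thesis by (simp add: ip_norm_def)
  qed
  obtain g where g: "g \<in> H2" "(\<lambda>n. ip_norm ip2 (\<lambda>x. v n x - g x)) \<longlonglongrightarrow> 0"
    using fhs_complete[OF hil2 vH2 fhs_Cauchy_of_tendsto[OF hil1 vH1 h v(2), unfolded norm_eq]] by blast
  have "h x = g x" for x
  proof (cases "x \<in> E")
    case True
    have "(\<lambda>n. v n x) \<longlonglongrightarrow> h x" 
      using fhs_ip_tendsto[OF hil1 vH1 h rkhs_kernel_in[OF rk1 True] v(2)]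
      by (simp only: rkhs_reproducing[OF rk1 True vH1] rkhs_reproducing[OF rk1 True h])
    moreover have "(\<lambda>n. v n x) \<longlonglongrightarrow> g x"
      using fhs_ip_tendsto[OF hil2 vH2 g(1) rkhs_kernel_in[OF rk2 True] g(2)]
      by (simp only: rkhs_reproducing[OF rk2 True vH2] rkhs_reproducing[OF rk2 True g(1)])
    ultimately show ?thesis using LIMSEQ_unique by blast
  next
    case False
    show ?thesis using rkhs_outside[OF rk1 h False] rkhs_outside[OF rk2 g(1) False] by simp
  qed
  then have "h = g" by blast
  then show "h \<in> H2" using g(1) by simp
qed

text \<open>Since \<^const>\<open>rkhs\<close> is a definite description, it is accessible only through the uniqueness
  of the reproducing kernel Hilbert space.\<close>

lemma rkhs_eqI:
  assumes "is_rkhs E k H ip" shows "rkhs E k = H"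
  unfolding rkhs_def using assms rkhs_subset by (intro the_equality) blast+

lemma is_rkhs_rkhs_inner:
  assumes "is_rkhs E k H ip" shows "is_rkhs E k H (rkhs_inner E k)"
  using assms unfolding rkhs_inner_def rkhs_eqI[OF assms] by (rule someI[of "is_rkhs E k H" ip])

text \<open>An everywhere defined composition operator \<open>C\<close> is bounded. The vectors \<open>v\<close> for which
  \<open>\<lambda>h. ip' (C h) v\<close> is a bounded functional include the kernel functions, whose functionals are point
  evaluations of \<open>h\<close> at values of \<open>f\<close>; hence they are dense. On those of norm at most 1 the functionals
  are pointwise bounded by the norm of \<open>C h\<close>, so uniform boundedness applies.\<close>

lemma composition_bounded:
  assumes rk: "is_rkhs E k H ip" and rk': "is_rkhs U k' H' ip'"
    and f: "\<And>x. x \<in> U \<Longrightarrow> f x \<in> E"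
    and comp: "\<And>h. h \<in> H \<Longrightarrow> zero_outside U (h \<circ> f) \<in> H'"
  shows "\<exists>B\<ge>0. \<forall>h\<in>H. ip_norm ip' (zero_outside U (h \<circ> f)) \<le> B * ip_norm ip h"
proof -
  note hil = rkhs_hilbert[OF rk] and hil' = rkhs_hilbert[OF rk']
  define C where "C h = zero_outside U (h \<circ> f)" for h
  have CH: "C h \<in> H'" if "h \<in> H" for h using comp[OF that] by (simp add: C_def)
  have C_add: "C (\<lambda>x. g x + h x) = (\<lambda>x. C g x + C h x)" for g h
    by (auto simp: C_def zero_outside_def)
  have C_scale: "C (\<lambda>x. c * h x) = (\<lambda>x. c * C h x)" for c h
    by (auto simp: C_def zero_outside_def)
  define V where "V = {v \<in> H'. \<exists>b. \<forall>h\<in>H. cmod (ip' (C h) v) \<le> b * ip_norm ip h}"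
  have VI: "v \<in> V" if "v \<in> H'" "\<And>h. h \<in> H \<Longrightarrow> cmod (ip' (C h) v) \<le> b * ip_norm ip h" for v b
    using that unfolding V_def by blast
  have VH': "v \<in> H'" if "v \<in> V" for v using that by (simp add: V_def)
  have V_dense: "\<exists>v. (\<forall>n. v n \<in> V) \<and> (\<lambda>n::nat. ip_norm ip' (\<lambda>x. v n x - h x)) \<longlonglongrightarrow> 0"
    if "h \<in> H'" for h
  proof (rule rkhs_subspace_dense[OF rk' _ _ _ _ _ that])
    have "ip' (C g) (\<lambda>x. 0) = 0" if "g \<in> H" for g
      by (rule fhs_ip_zero_right[OF hil' CH[OF that]])
    then show "(\<lambda>x. 0) \<in> V"
      by (intro VI[where b = 0]) (simp_all add: fhs_zero[OF hil'])
    show "(\<lambda>x. g x + h x) \<in> V" if gh: "g \<in> V" "h \<in> V" for g h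
    proof -
      obtain a b where ab: "\<And>u. u \<in> H \<Longrightarrow> cmod (ip' (C u) g) \<le> a * ip_norm ip u"
        "\<And>u. u \<in> H \<Longrightarrow> cmod (ip' (C u) h) \<le> b * ip_norm ip u"
        using gh unfolding V_def by blast
      have "cmod (ip' (C u) (\<lambda>x. g x + h x)) \<le> (a + b) * ip_norm ip u" if "u \<in> H" for u
        unfolding fhs_ip_add_right[OF hil' VH'[OF gh(1)] VH'[OF gh(2)] CH[OF that]]
        using ab[OF that] norm_triangle_ineq[of "ip' (C u) g" "ip' (C u) h"] by (simp add: distrib_right)
      then show ?thesis by (rule VI[OF fhs_add[OF hil' VH'[OF gh(1)] VH'[OF gh(2)]]])
    qed
    show "(\<lambda>x. c * h x) \<in> V" if hV: "h \<in> V" for c h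
    proof -
      obtain b where b: "\<And>u. u \<in> H \<Longrightarrow> cmod (ip' (C u) h) \<le> b * ip_norm ip u"
        using hV unfolding V_def by blast
      have "cmod (ip' (C u) (\<lambda>x. c * h x)) \<le> (cmod c * b) * ip_norm ip u" if "u \<in> H" for u
        unfolding fhs_ip_scale_right[OF hil' VH'[OF hV] CH[OF that]]
        using mult_left_mono[OF b[OF that], of "cmod c"] by (simp add: norm_mult mult.assoc)
      then show ?thesis by (rule VI[OF fhs_scale[OF hil' VH'[OF hV]]])
    qed
    show "zero_outside U (k' x) \<in> V" if x: "x \<in> U" for x
    proof -
      have "cmod (ip' (C u) (zero_outside U (k' x))) \<le> ip_norm ip (zero_outside E (k (f x))) * ip_norm ip u"
        if u: "u \<in> H" for u
      proof -
        have "ip' (C u) (zero_outside U (k' x)) = ip u (zero_outside E (k (f x)))"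
          using rkhs_reproducing[OF rk' x CH[OF u]] rkhs_reproducing[OF rk f[OF x] u] x
          by (simp add: C_def zero_outside_def)
        then show ?thesis
          using fhs_Cauchy_Schwarz[OF hil u rkhs_kernel_in[OF rk f[OF x]]] by (simp add: mult.commute)
      qed
      then show ?thesis by (rule VI[OF rkhs_kernel_in[OF rk' x]])
    qed
    show "V \<subseteq> H'" by (auto simp: V_def)
  qed
  define L where "L = {\<lambda>h. ip' (C h) v | v. v \<in> V \<and> ip_norm ip' v \<le> 1}"
  have "\<exists>B\<ge>0. \<forall>l\<in>L. \<forall>h\<in>H. cmod (l h) \<le> B * ip_norm ip h"
  proof (rule fhs_uniform_boundedness[OF hil])
    fix l assume l: "l \<in> L"
    then obtain v where v: "l = (\<lambda>h. ip' (C h) v)" "v \<in> V" unfolding L_def by blast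
    then have vH: "v \<in> H'" by (intro VH')
    show "l (\<lambda>x. g x + h x) = l g + l h" if "g \<in> H" "h \<in> H" for g h
      using fhs_ip_add_left[OF hil' CH[OF that(1)] CH[OF that(2)] vH] by (simp add: v C_add)
    show "l (\<lambda>x. c * h x) = c * l h" if "h \<in> H" for c h
      using fhs_ip_scale_left[OF hil' CH[OF that] vH] by (simp add: v C_scale)
    show "\<exists>b. \<forall>h\<in>H. cmod (l h) \<le> b * ip_norm ip h" using v unfolding V_def by blast
  next
    fix h assume h: "h \<in> H"
    have "cmod (l h) \<le> ip_norm ip' (C h)" if l: "l \<in> L" for l
    proof -
      obtain v where v: "l = (\<lambda>h. ip' (C h) v)" "v \<in> V" "ip_norm ip' v \<le> 1"
        using l unfolding L_def by blast
      then have vH: "v \<in> H'" by (intro VH')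
      show ?thesis using fhs_Cauchy_Schwarz[OF hil' CH[OF h] vH]
          mult_left_mono[OF v(3) fhs_norm_nonneg[OF hil' CH[OF h]]] by (simp add: v)
    qed
    then show "\<exists>b. \<forall>l\<in>L. cmod (l h) \<le> b" by blast
  qed
  then obtain B where B0: "B \<ge> 0" and BL: "\<forall>l\<in>L. \<forall>h\<in>H. cmod (l h) \<le> B * ip_norm ip h" by blast
  have B: "cmod (ip' (C h) v) \<le> B * ip_norm ip h" if "v \<in> V" "ip_norm ip' v \<le> 1" "h \<in> H" for v h
  proof -
    have "(\<lambda>h. ip' (C h) v) \<in> L" unfolding L_def using that by blast
    from bspec[OF bspec[OF BL this] that(3)] show ?thesis .
  qed
  have "ip_norm ip' (C h) \<le> B * ip_norm ip h" if h: "h \<in> H" for h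
  proof -
    have hom: "cmod (ip' (C h) v) \<le> B * ip_norm ip h * ip_norm ip' v" if v: "v \<in> V" for v
    proof (cases "ip_norm ip' v = 0")
      case True
      have vH: "v \<in> H'" by (rule VH'[OF v])
      then show ?thesis using fhs_Cauchy_Schwarz[OF hil' CH[OF h] vH] True by simp
    next
      case False
      have vH: "v \<in> H'" by (rule VH'[OF v])
      then have pos: "ip_norm ip' v > 0" using False fhs_norm_nonneg[OF hil' vH] by simp
      define c where "c = complex_of_real (inverse (ip_norm ip' v))"
      have c: "cmod c = inverse (ip_norm ip' v)" using pos unfolding c_def norm_of_real by simp
      obtain b where b: "\<And>u. u \<in> H \<Longrightarrow> cmod (ip' (C u) v) \<le> b * ip_norm ip u"
        using v unfolding V_def by blast
      have scale: "cmod (ip' (C u) (\<lambda>x. c * v x)) = cmod c * cmod (ip' (C u) v)" if "u \<in> H" for u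
        by (simp add: fhs_ip_scale_right[OF hil' vH CH[OF that]] norm_mult)
      have "cmod (ip' (C u) (\<lambda>x. c * v x)) \<le> cmod c * b * ip_norm ip u" if "u \<in> H" for u
        using mult_left_mono[OF b[OF that], of "cmod c"] by (simp add: scale[OF that] mult.assoc)
      then have "(\<lambda>x. c * v x) \<in> V" by (rule VI[OF fhs_scale[OF hil' vH]])
      moreover have "ip_norm ip' (\<lambda>x. c * v x) \<le> 1"
        unfolding fhs_norm_scale[OF hil' vH] c using pos by simp
      ultimately have "cmod (ip' (C h) (\<lambda>x. c * v x)) \<le> B * ip_norm ip h" using h by (intro B)
      then show ?thesis using pos by (simp add: scale[OF h] c field_simps)
    qed
    obtain v where v: "\<And>n. v n \<in> V" "(\<lambda>n. ip_norm ip' (\<lambda>x. v n x - C h x)) \<longlonglongrightarrow> 0"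
      using V_dense[OF CH[OF h]] by blast
    note vH = VH'[OF v(1)]
    have "(\<lambda>n. cmod (ip' (v n) (C h))) \<longlonglongrightarrow> cmod (ip' (C h) (C h))"
      by (intro tendsto_norm fhs_ip_tendsto[OF hil' vH CH[OF h] CH[OF h] v(2)])
    moreover have "(\<lambda>n. B * ip_norm ip h * ip_norm ip' (v n)) \<longlonglongrightarrow> B * ip_norm ip h * ip_norm ip' (C h)"
      by (intro tendsto_intros fhs_norm_tendsto[OF hil' vH CH[OF h] v(2)])
    moreover have "cmod (ip' (v n) (C h)) \<le> B * ip_norm ip h * ip_norm ip' (v n)" for n
      using hom[OF v(1)[of n]] fhs_ip_commute[OF hil' CH[OF h] vH[of n]] by simp
    ultimately have "cmod (ip' (C h) (C h)) \<le> B * ip_norm ip h * ip_norm ip' (C h)"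
      by (intro LIMSEQ_le) auto
    then have "ip_norm ip' (C h) * ip_norm ip' (C h) \<le> B * ip_norm ip h * ip_norm ip' (C h)"
      by (subst (asm) fhs_ip_self[OF hil' CH[OF h]])
        (simp add: power2_eq_square fhs_norm_nonneg[OF hil' CH[OF h]] norm_mult)
    then show ?thesis
      using fhs_norm_nonneg[OF hil' CH[OF h]] mult_nonneg_nonneg[OF B0 fhs_norm_nonneg[OF hil h]]
      by (cases "ip_norm ip' (C h) = 0") auto
  qed
  then show ?thesis using B0 unfolding C_def by blast
qed

section \<open>The weight\<close>

lemma weight_eq: "weight \<xi> = 1 / fact (nat \<bar>\<lfloor>\<xi> + 1/2\<rfloor>\<bar>)"
proof -
  define m where "m = \<lfloor>\<xi> + 1/2\<rfloor>"
  have m: "real_of_int m \<le> \<xi> + 1/2" "\<xi> + 1/2 < real_of_int m + 1"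
    unfolding m_def by linarith+
  have "weight \<xi> = (\<Sum>\<^sub>\<infinity>n\<in>{m}.
      indicat_real {- 1/2 + real_of_int n ..< 1/2 + real_of_int n} \<xi> / fact (nat \<bar>n\<bar>))"
    unfolding weight_def
  proof (rule infsum_cong_neutral)
    fix n assume "n \<in> UNIV - {m}"
    then have "\<xi> \<notin> {- 1/2 + real_of_int n ..< 1/2 + real_of_int n}"
      using floor_unique[of n "\<xi> + 1/2"] by (auto simp: m_def)
    then show "indicat_real {- 1/2 + real_of_int n ..< 1/2 + real_of_int n} \<xi> / fact (nat \<bar>n\<bar>) = 0"
      by simp
  qed auto
  also have "\<dots> = 1 / fact (nat \<bar>m\<bar>)"
    using m by (simp add: indicator_def)
  finally show ?thesis by (simp add: m_def)
qed

lemma weight_pos: "0 < weight \<xi>"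
  by (simp add: weight_eq)

lemma weight_measurable [measurable]: "weight \<in> borel_measurable borel"
proof -
  have "(\<lambda>\<xi>. (\<lambda>n. 1 / fact (nat \<bar>n\<bar>)) \<lfloor>\<xi> + 1/2\<rfloor>) \<in> borel_measurable (borel :: real measure)"
    by (rule measurable_compose[of _ _ "count_space UNIV"]) measurable
  then show ?thesis by (simp add: weight_eq[abs_def])
qed

lemma power_div_fact_le_exp: "x ^ n / fact n \<le> exp x" if "0 \<le> x" for x :: real
proof -
  have "(\<Sum>i\<in>{n}. x ^ i /\<^sub>R fact i) \<le> (\<Sum>i. x ^ i /\<^sub>R fact i)"
    by (rule sum_le_suminf) (use that summable_exp_generic[of x] in auto)
  then show ?thesis by (simp add: exp_def field_simps)
qed

text \<open>The weight decays faster than every exponential function, which makes all transforms below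
  entire. The bound keeps track of the rate: a factor \<open>exp (c \<bar>\<xi>\<bar>)\<close> costs a constant that is doubly
  exponential in \<open>c\<close>, because the sum of \<open>exp (c n) / fact n\<close> is \<open>exp (exp c)\<close>.\<close>

lemma exp_weight_le:
  assumes "0 \<le> c"
  shows "exp (c * \<bar>\<xi>\<bar>) * weight \<xi> \<le> exp ((c + 1) / 2 + exp (c + 1)) * exp (- \<bar>\<xi>\<bar>)"
proof -
  define n where "n = nat \<bar>\<lfloor>\<xi> + 1/2\<rfloor>\<bar>"
  have "\<bar>\<xi>\<bar> \<le> real n + 1/2" unfolding n_def by linarith
  then have "exp ((c + 1) * \<bar>\<xi>\<bar>) \<le> exp ((c + 1) * (real n + 1/2))"
    using assms by (intro exp_le_cancel_iff[THEN iffD2] mult_left_mono) auto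
  also have "\<dots> = exp ((c + 1) / 2) * exp (c + 1) ^ n"
    by (simp add: distrib_left exp_add exp_of_nat2_mult)
  finally have "exp ((c + 1) * \<bar>\<xi>\<bar>) * weight \<xi> \<le> (exp ((c + 1) / 2) * exp (c + 1) ^ n) * weight \<xi>"
    by (rule mult_right_mono) (use weight_pos[of \<xi>] in simp)
  also have "\<dots> = exp ((c + 1) / 2) * (exp (c + 1) ^ n / fact n)"
    by (simp add: weight_eq n_def)
  also have "\<dots> \<le> exp ((c + 1) / 2) * exp (exp (c + 1))"
    by (intro mult_left_mono power_div_fact_le_exp) auto
  finally have "exp ((c + 1) * \<bar>\<xi>\<bar>) * weight \<xi> * exp (- \<bar>\<xi>\<bar>) \<le> exp ((c + 1) / 2 + exp (c + 1)) * exp (- \<bar>\<xi>\<bar>)"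
    unfolding exp_add by (rule mult_right_mono) simp
  moreover have "exp ((c + 1) * \<bar>\<xi>\<bar>) * weight \<xi> * exp (- \<bar>\<xi>\<bar>) = exp (c * \<bar>\<xi>\<bar>) * weight \<xi>"
    by (simp add: distrib_right exp_add exp_minus)
  ultimately show ?thesis by simp
qed

lemma integrable_exp_minus_abs: "integrable lborel (\<lambda>x::real. exp (- \<bar>x\<bar>))"
proof (rule Bochner_Integration.integrable_bound)
  have "integrable lborel (exponential_density 1)"
    using prob_space_exponential_density[of 1]
    by (intro integrableI_nonneg)
      (auto simp: exponential_density_def prob_space.emeasure_space_1 emeasure_density
        dest!: prob_space.emeasure_space_1 cong: nn_integral_cong)
  moreover from lborel_integrable_real_affine[OF this, of "-1" 0]
  have "integrable lborel (\<lambda>x. exponential_density 1 (- x))" by simp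
  ultimately show "integrable lborel (\<lambda>x. exponential_density 1 x + exponential_density 1 (- x))"
    by (rule Bochner_Integration.integrable_add)
qed (auto simp: exponential_density_def)

definition weight_measure :: "real measure" where
  "weight_measure = density lborel (\<lambda>\<xi>. ennreal (weight \<xi>))"

lemma sets_weight_measure [simp, measurable_cong]: "sets weight_measure = sets borel"
  by (simp add: weight_measure_def)

lemma space_weight_measure [simp]: "space weight_measure = UNIV"
  by (simp add: weight_measure_def)

lemma integrable_weight_measure:
  fixes f :: "real \<Rightarrow> 'b::{banach, second_countable_topology}"
  assumes "f \<in> borel_measurable borel"
  shows "integrable weight_measure f \<longleftrightarrow> integrable lborel (\<lambda>\<xi>. weight \<xi> *\<^sub>R f \<xi>)"
  unfolding weight_measure_def using assms weight_pos
  by (intro integrable_density) (auto simp: less_imp_le)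

lemma integral_weight_measure:
  fixes f :: "real \<Rightarrow> 'b::{banach, second_countable_topology}"
  assumes "f \<in> borel_measurable borel"
  shows "(LINT \<xi>|weight_measure. f \<xi>) = (LINT \<xi>|lborel. weight \<xi> *\<^sub>R f \<xi>)"
  unfolding weight_measure_def using assms weight_pos
  by (intro integral_density) (auto simp: less_imp_le)

lemma
  assumes "0 \<le> c"
  shows integrable_exp_weight_measure: "integrable weight_measure (\<lambda>\<xi>. exp (c * \<bar>\<xi>\<bar>))"
    and integral_exp_weight_measure_le: "(LINT \<xi>|weight_measure. exp (c * \<bar>\<xi>\<bar>)) \<le>
      exp ((c + 1) / 2 + exp (c + 1)) * (LINT x|lborel. exp (- \<bar>x\<bar>))"
proof -
  have dom: "integrable lborel (\<lambda>x::real. exp ((c + 1) / 2 + exp (c + 1)) * exp (- \<bar>x\<bar>))"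
    using integrable_exp_minus_abs by simp
  have le: "exp (c * \<bar>\<xi>\<bar>) * weight \<xi> \<le> exp ((c + 1) / 2 + exp (c + 1)) * exp (- \<bar>\<xi>\<bar>)" for \<xi>
    by (rule exp_weight_le[OF assms])
  have int: "integrable lborel (\<lambda>\<xi>. exp (c * \<bar>\<xi>\<bar>) * weight \<xi>)"
    by (rule Bochner_Integration.integrable_bound[OF dom])
      (use le weight_pos in \<open>auto simp: abs_mult less_imp_le\<close>)
  then show "integrable weight_measure (\<lambda>\<xi>. exp (c * \<bar>\<xi>\<bar>))"
    by (subst integrable_weight_measure) (simp_all add: mult.commute)
  have "(LINT \<xi>|weight_measure. exp (c * \<bar>\<xi>\<bar>)) = (LINT \<xi>|lborel. exp (c * \<bar>\<xi>\<bar>) * weight \<xi>)"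
    by (subst integral_weight_measure) (simp_all add: mult.commute)
  also have "\<dots> \<le> (LINT \<xi>|lborel. exp ((c + 1) / 2 + exp (c + 1)) * exp (- \<bar>\<xi>\<bar>))"
    by (rule integral_mono[OF int dom le])
  finally show "(LINT \<xi>|weight_measure. exp (c * \<bar>\<xi>\<bar>)) \<le>
      exp ((c + 1) / 2 + exp (c + 1)) * (LINT x|lborel. exp (- \<bar>x\<bar>))" by simp
qed

lemma finite_weight_measure: "finite_measure weight_measure"
proof (rule finite_measureI)
  have "integrable weight_measure (\<lambda>\<xi>. 1 :: real)"
    using integrable_exp_weight_measure[of 0] by simp
  then have "emeasure weight_measure (space weight_measure) < \<infinity>"
    by (simp add: integrable_iff_bounded)
  then show "emeasure weight_measure (space weight_measure) \<noteq> \<infinity>" by simp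
qed

lemma AE_weight_measure: "(AE \<xi> in weight_measure. P \<xi>) \<longleftrightarrow> (AE \<xi> in lborel. P \<xi>)"
  unfolding weight_measure_def by (subst AE_density) (auto simp: weight_pos)

section \<open>Square integrable functions and their transforms\<close>

definition weight_L2 :: "(real \<Rightarrow> complex) set" where
  "weight_L2 = {\<phi> \<in> borel_measurable borel. integrable weight_measure (\<lambda>\<xi>. (cmod (\<phi> \<xi>))\<^sup>2)}"

lemma weight_L2_measurable [measurable_dest]: "\<phi> \<in> weight_L2 \<Longrightarrow> \<phi> \<in> borel_measurable borel"
  by (simp add: weight_L2_def)

lemma weight_L2_square: "\<phi> \<in> weight_L2 \<Longrightarrow> integrable weight_measure (\<lambda>\<xi>. (cmod (\<phi> \<xi>))\<^sup>2)"
  by (simp add: weight_L2_def)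

lemma weight_L2_zero: "(\<lambda>_. 0) \<in> weight_L2"
  by (simp add: weight_L2_def)

lemma weight_L2_scale:
  assumes "\<phi> \<in> weight_L2" shows "(\<lambda>\<xi>. c * \<phi> \<xi>) \<in> weight_L2"
  using assms by (auto simp: weight_L2_def norm_mult power_mult_distrib)

lemma weight_L2_add:
  assumes "\<phi> \<in> weight_L2" "\<psi> \<in> weight_L2" shows "(\<lambda>\<xi>. \<phi> \<xi> + \<psi> \<xi>) \<in> weight_L2"
proof -
  note [measurable] = assms[THEN weight_L2_measurable]
  have "integrable weight_measure (\<lambda>\<xi>. (cmod (\<phi> \<xi> + \<psi> \<xi>))\<^sup>2)"
  proof (rule Bochner_Integration.integrable_bound)
    show "integrable weight_measure (\<lambda>\<xi>. 2 * (cmod (\<phi> \<xi>))\<^sup>2 + 2 * (cmod (\<psi> \<xi>))\<^sup>2)"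
      using assms[THEN weight_L2_square] by simp
    have "(cmod (\<phi> \<xi> + \<psi> \<xi>))\<^sup>2 \<le> 2 * (cmod (\<phi> \<xi>))\<^sup>2 + 2 * (cmod (\<psi> \<xi>))\<^sup>2" for \<xi>
    proof -
      have "(cmod (\<phi> \<xi> + \<psi> \<xi>))\<^sup>2 \<le> (cmod (\<phi> \<xi>) + cmod (\<psi> \<xi>))\<^sup>2"
        by (intro power_mono norm_triangle_ineq) auto
      also have "\<dots> \<le> 2 * (cmod (\<phi> \<xi>))\<^sup>2 + 2 * (cmod (\<psi> \<xi>))\<^sup>2"
        using sum_squares_bound[of "cmod (\<phi> \<xi>)" "cmod (\<psi> \<xi>)"] by (simp add: power2_sum)
      finally show ?thesis .
    qed
    then show "AE \<xi> in weight_measure. norm ((cmod (\<phi> \<xi> + \<psi> \<xi>))\<^sup>2) \<le>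
        norm (2 * (cmod (\<phi> \<xi>))\<^sup>2 + 2 * (cmod (\<psi> \<xi>))\<^sup>2)" by simp
  qed simp
  then show ?thesis by (simp add: weight_L2_def)
qed

lemma weight_L2_diff:
  assumes "\<phi> \<in> weight_L2" "\<psi> \<in> weight_L2" shows "(\<lambda>\<xi>. \<phi> \<xi> - \<psi> \<xi>) \<in> weight_L2"
  using weight_L2_add[OF assms(1) weight_L2_scale[OF assms(2), of "-1"]] by simp

lemma weight_L2_bounded:
  assumes [measurable]: "\<phi> \<in> borel_measurable borel" and "\<And>\<xi>. cmod (\<phi> \<xi>) \<le> B"
  shows "\<phi> \<in> weight_L2"
proof -
  interpret finite_measure weight_measure by (rule finite_weight_measure)
  have "integrable weight_measure (\<lambda>\<xi>. (cmod (\<phi> \<xi>))\<^sup>2)"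
    by (rule integrable_const_bound[where B = "B\<^sup>2"]) (auto intro!: always_eventually power_mono assms)
  then show ?thesis using assms by (simp add: weight_L2_def)
qed

lemma
  assumes [measurable]: "\<phi> \<in> weight_L2" and "0 \<le> c"
  shows integrable_weight_L2_exp: "integrable weight_measure (\<lambda>\<xi>. cmod (\<phi> \<xi>) * exp (c * \<bar>\<xi>\<bar>))"
    and integral_weight_L2_exp_le: "(LINT \<xi>|weight_measure. cmod (\<phi> \<xi>) * exp (c * \<bar>\<xi>\<bar>)) \<le>
      ((LINT \<xi>|weight_measure. (cmod (\<phi> \<xi>))\<^sup>2) + (LINT \<xi>|weight_measure. exp (2 * c * \<bar>\<xi>\<bar>))) / 2"
proof -
  let ?d = "\<lambda>\<xi>. ((cmod (\<phi> \<xi>))\<^sup>2 + exp (2 * c * \<bar>\<xi>\<bar>)) / 2"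
  have dom: "integrable weight_measure ?d"
    using weight_L2_square[OF assms(1)] integrable_exp_weight_measure[of "2 * c"] assms(2) by simp
  have le: "cmod (\<phi> \<xi>) * exp (c * \<bar>\<xi>\<bar>) \<le> ?d \<xi>" for \<xi>
  proof -
    have "2 * cmod (\<phi> \<xi>) * exp (c * \<bar>\<xi>\<bar>) \<le> (cmod (\<phi> \<xi>))\<^sup>2 + (exp (c * \<bar>\<xi>\<bar>))\<^sup>2"
      by (rule sum_squares_bound)
    also have "(exp (c * \<bar>\<xi>\<bar>))\<^sup>2 = exp (2 * c * \<bar>\<xi>\<bar>)" by (simp flip: exp_double add: mult.assoc)
    finally show ?thesis by simp
  qed
  show int: "integrable weight_measure (\<lambda>\<xi>. cmod (\<phi> \<xi>) * exp (c * \<bar>\<xi>\<bar>))"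
    by (rule Bochner_Integration.integrable_bound[OF dom]) (use le in \<open>auto simp: abs_mult\<close>)
  have "(LINT \<xi>|weight_measure. cmod (\<phi> \<xi>) * exp (c * \<bar>\<xi>\<bar>)) \<le> (LINT \<xi>|weight_measure. ?d \<xi>)"
    by (rule integral_mono[OF int dom le])
  also have "\<dots> = ((LINT \<xi>|weight_measure. (cmod (\<phi> \<xi>))\<^sup>2) + (LINT \<xi>|weight_measure. exp (2 * c * \<bar>\<xi>\<bar>))) / 2"
    using weight_L2_square[OF assms(1)] integrable_exp_weight_measure[of "2 * c"] assms(2) by simp
  finally show "(LINT \<xi>|weight_measure. cmod (\<phi> \<xi>) * exp (c * \<bar>\<xi>\<bar>)) \<le>
      ((LINT \<xi>|weight_measure. (cmod (\<phi> \<xi>))\<^sup>2) + (LINT \<xi>|weight_measure. exp (2 * c * \<bar>\<xi>\<bar>))) / 2" .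
qed

text \<open>For real \<open>z\<close> this is the inverse Fourier transform of \<open>\<phi>\<close> times the weight; allowing complex \<open>z\<close>
  gives its entire extension.\<close>

definition synthesis :: "(real \<Rightarrow> complex) \<Rightarrow> complex \<Rightarrow> complex" where
  "synthesis \<phi> z = (LINT \<xi>|weight_measure. \<phi> \<xi> * exp (2 * pi * \<i> * of_real \<xi> * z))"

lemma norm_exp_frequency_le:
  "cmod (exp (2 * pi * \<i> * of_real \<xi> * z)) \<le> exp (2 * pi * \<bar>Im z\<bar> * \<bar>\<xi>\<bar>)"
proof -
  have "cmod (exp (2 * pi * \<i> * of_real \<xi> * z)) = exp (- (2 * pi * (\<xi> * Im z)))"
    by (simp add: norm_exp_eq_Re)
  also have "\<dots> \<le> exp (2 * pi * (\<bar>\<xi>\<bar> * \<bar>Im z\<bar>))"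
    unfolding abs_mult[symmetric] exp_le_cancel_iff
    using mult_left_mono[OF abs_ge_minus_self[of "\<xi> * Im z"], of "2 * pi"] by simp
  finally show ?thesis by (simp add: mult.commute mult.left_commute)
qed

lemma norm_mult_exp_frequency_le:
  "cmod (c * exp (2 * pi * \<i> * of_real \<xi> * z)) \<le> cmod c * exp (2 * pi * \<bar>Im z\<bar> * \<bar>\<xi>\<bar>)"
  unfolding norm_mult[of c] by (rule mult_left_mono[OF norm_exp_frequency_le]) simp

lemma integrable_synthesis:
  assumes [measurable]: "\<phi> \<in> weight_L2"
  shows "integrable weight_measure (\<lambda>\<xi>. \<phi> \<xi> * exp (2 * pi * \<i> * of_real \<xi> * z))"
proof (rule Bochner_Integration.integrable_bound)
  show "integrable weight_measure (\<lambda>\<xi>. cmod (\<phi> \<xi>) * exp (2 * pi * \<bar>Im z\<bar> * \<bar>\<xi>\<bar>))"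
    by (rule integrable_weight_L2_exp[OF assms]) simp
  show "AE \<xi> in weight_measure. norm (\<phi> \<xi> * exp (2 * pi * \<i> * of_real \<xi> * z)) \<le>
      norm (cmod (\<phi> \<xi>) * exp (2 * pi * \<bar>Im z\<bar> * \<bar>\<xi>\<bar>))"
    using norm_mult_exp_frequency_le by (simp only: abs_mult abs_norm_cancel abs_exp_cancel real_norm_def) simp
qed simp

text \<open>The arithmetic-geometric mean inequality is used in place of the Cauchy-Schwarz inequality: the
  sum of the two integrals instead of the root of their product does not matter on the doubly
  exponential scale on which this bound is used.\<close>

lemma norm_synthesis_le:
  assumes [measurable]: "\<phi> \<in> weight_L2"
  shows "cmod (synthesis \<phi> z) \<le> ((LINT \<xi>|weight_measure. (cmod (\<phi> \<xi>))\<^sup>2) +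
    (LINT \<xi>|weight_measure. exp (4 * pi * \<bar>Im z\<bar> * \<bar>\<xi>\<bar>))) / 2"
proof -
  have "cmod (synthesis \<phi> z) \<le> (LINT \<xi>|weight_measure. cmod (\<phi> \<xi> * exp (2 * pi * \<i> * of_real \<xi> * z)))"
    unfolding synthesis_def by (rule integral_norm_bound)
  also have "\<dots> \<le> (LINT \<xi>|weight_measure. cmod (\<phi> \<xi>) * exp (2 * pi * \<bar>Im z\<bar> * \<bar>\<xi>\<bar>))"
    by (intro integral_mono integrable_norm integrable_synthesis integrable_weight_L2_exp assms
        norm_mult_exp_frequency_le) simp
  also have "\<dots> \<le> ((LINT \<xi>|weight_measure. (cmod (\<phi> \<xi>))\<^sup>2) +
    (LINT \<xi>|weight_measure. exp (2 * (2 * pi * \<bar>Im z\<bar>) * \<bar>\<xi>\<bar>))) / 2"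
    by (rule integral_weight_L2_exp_le[OF assms]) simp
  finally show ?thesis by (simp add: mult.assoc)
qed

lemma synthesis_add:
  assumes "\<phi> \<in> weight_L2" "\<psi> \<in> weight_L2"
  shows "synthesis (\<lambda>\<xi>. \<phi> \<xi> + \<psi> \<xi>) z = synthesis \<phi> z + synthesis \<psi> z"
  unfolding synthesis_def distrib_right
  by (intro Bochner_Integration.integral_add integrable_synthesis assms)

lemma synthesis_scale: "synthesis (\<lambda>\<xi>. c * \<phi> \<xi>) z = c * synthesis \<phi> z"
  by (simp add: synthesis_def mult.assoc)

lemma synthesis_diff:
  assumes "\<phi> \<in> weight_L2" "\<psi> \<in> weight_L2"
  shows "synthesis (\<lambda>\<xi>. \<phi> \<xi> - \<psi> \<xi>) z = synthesis \<phi> z - synthesis \<psi> z"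
  unfolding synthesis_def left_diff_distrib
  by (intro Bochner_Integration.integral_diff integrable_synthesis assms)

lemma synthesis_cong_AE:
  assumes "\<phi> \<in> weight_L2" "\<psi> \<in> weight_L2" "AE \<xi> in weight_measure. \<phi> \<xi> = \<psi> \<xi>"
  shows "synthesis \<phi> z = synthesis \<psi> z"
proof -
  note [measurable] = assms(1,2)[THEN weight_L2_measurable]
  show ?thesis
    unfolding synthesis_def using assms(3) by (intro integral_cong_AE) auto
qed

lemma holomorphic_synthesis:
  assumes [measurable]: "\<phi> \<in> weight_L2"
  shows "synthesis \<phi> holomorphic_on UNIV"
proof -
  define a where "a j = (LINT \<xi>|weight_measure. \<phi> \<xi> * ((2 * pi * \<i> * of_real \<xi>) ^ j /\<^sub>R fact j))" for j :: nat
  have sums: "(\<lambda>j. a j * z ^ j) sums synthesis \<phi> z" for z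
  proof -
    define f where "f j \<xi> = \<phi> \<xi> * ((2 * pi * \<i> * of_real \<xi> * z) ^ j /\<^sub>R fact j)" for j \<xi>
    define c where "c = 2 * pi * cmod z"
    have [measurable]: "f j \<in> borel_measurable borel" for j unfolding f_def by measurable
    have dom: "integrable weight_measure (\<lambda>\<xi>. cmod (\<phi> \<xi>) * exp (c * \<bar>\<xi>\<bar>))"
      by (rule integrable_weight_L2_exp) (auto simp: c_def assms)
    have norm_f: "cmod (f j \<xi>) = cmod (\<phi> \<xi>) * ((c * \<bar>\<xi>\<bar>) ^ j /\<^sub>R fact j)" for j \<xi>
      by (simp add: f_def norm_mult norm_power c_def norm_divide mult.commute mult.left_commute)
    have norm_sums: "(\<lambda>j. cmod (f j \<xi>)) sums (cmod (\<phi> \<xi>) * exp (c * \<bar>\<xi>\<bar>))" for \<xi>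
      unfolding norm_f by (intro sums_mult exp_converges)
    have partial: "(\<Sum>j<m. cmod (f j \<xi>)) \<le> cmod (\<phi> \<xi>) * exp (c * \<bar>\<xi>\<bar>)" for m \<xi>
      using sum_le_suminf[OF sums_summable[OF norm_sums[of \<xi>]], of "{..<m}"] sums_unique[OF norm_sums[of \<xi>]]
      by simp
    have int: "integrable weight_measure (f j)" for j
    proof (rule Bochner_Integration.integrable_bound[OF dom])
      have "cmod (f j \<xi>) \<le> cmod (\<phi> \<xi>) * exp (c * \<bar>\<xi>\<bar>)" for \<xi>
        using order_trans[OF member_le_sum[of j "{..<Suc j}" "\<lambda>j. cmod (f j \<xi>)"] partial[of \<xi> "Suc j"]] by simp
      then show "AE \<xi> in weight_measure. cmod (f j \<xi>) \<le> norm (cmod (\<phi> \<xi>) * exp (c * \<bar>\<xi>\<bar>))" by simp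
    qed simp
    have "(\<lambda>j. LINT \<xi>|weight_measure. f j \<xi>) sums (LINT \<xi>|weight_measure. (\<Sum>j. f j \<xi>))"
    proof (rule sums_integral[OF int])
      show "AE \<xi> in weight_measure. summable (\<lambda>j. norm (f j \<xi>))"
        using norm_sums by (auto simp: sums_iff)
      show "summable (\<lambda>j. LINT \<xi>|weight_measure. norm (f j \<xi>))"
      proof (rule summableI_nonneg_bounded)
        fix m
        have "(\<Sum>j<m. LINT \<xi>|weight_measure. norm (f j \<xi>)) = (LINT \<xi>|weight_measure. (\<Sum>j<m. norm (f j \<xi>)))"
          using int by simp
        also have "\<dots> \<le> (LINT \<xi>|weight_measure. cmod (\<phi> \<xi>) * exp (c * \<bar>\<xi>\<bar>))"
          using int dom partial by (intro integral_mono) auto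
        finally show "(\<Sum>j<m. LINT \<xi>|weight_measure. norm (f j \<xi>)) \<le>
            (LINT \<xi>|weight_measure. cmod (\<phi> \<xi>) * exp (c * \<bar>\<xi>\<bar>))" .
      qed simp
    qed
    moreover have "(\<Sum>j. f j \<xi>) = \<phi> \<xi> * exp (2 * pi * \<i> * of_real \<xi> * z)" for \<xi>
      unfolding f_def by (intro sums_unique[symmetric] sums_mult exp_converges)
    moreover have "(LINT \<xi>|weight_measure. f j \<xi>) = a j * z ^ j" for j
    proof -
      have "f j = (\<lambda>\<xi>. z ^ j * (\<phi> \<xi> * ((2 * pi * \<i> * of_real \<xi>) ^ j /\<^sub>R fact j)))"
        unfolding f_def by (auto simp: power_mult_distrib)
      then show ?thesis unfolding a_def by (simp only: integral_mult_right_zero mult.commute)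
    qed
    ultimately show ?thesis by (simp add: synthesis_def)
  qed
  have "synthesis \<phi> holomorphic_on ball 0 r" for r
    by (rule power_series_holomorphic[of 0 r a]) (use sums in simp)
  then have "synthesis \<phi> holomorphic_on (\<Union>r. ball 0 r)"
    by (intro holomorphic_on_UN_open) auto
  moreover have "(\<Union>r. ball 0 r) = (UNIV :: complex set)"
    by (auto intro: gt_ex)
  ultimately show ?thesis by simp
qed

section \<open>Uniqueness of Fourier transforms\<close>

text \<open>After division by the common total mass, \<open>p\<close> and \<open>q\<close> are probability densities with the same
  characteristic function.\<close>

lemma fourier_nonneg_unique:
  fixes M :: "real measure" and p q :: "real \<Rightarrow> real"
  assumes sets: "sets M = sets borel"
    and p: "integrable M p" "\<And>x. 0 \<le> p x" and q: "integrable M q" "\<And>x. 0 \<le> q x"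
    and eq: "\<And>t. (LINT x|M. p x *\<^sub>R iexp (t * x)) = (LINT x|M. q x *\<^sub>R iexp (t * x))"
  shows "AE x in M. p x = q x"
proof -
  define m where "m = (LINT x|M. p x)"
  have [measurable]: "p \<in> borel_measurable M" "q \<in> borel_measurable M" using p q by auto
  note [measurable_cong] = sets
  have "complex_of_real m = complex_of_real (LINT x|M. q x)"
    using eq[of 0] by (simp add: m_def scaleR_conv_of_real)
  then have mq: "(LINT x|M. q x) = m" by simp
  show ?thesis
  proof (cases "m = 0")
    case True
    then have "AE x in M. p x = 0" "AE x in M. q x = 0"
      using integral_nonneg_eq_0_iff_AE[OF p(1)] integral_nonneg_eq_0_iff_AE[OF q(1)] p(2) q(2) mq
      by (auto simp: m_def)
    then show ?thesis by eventually_elim simp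
  next
    case False
    then have m: "m > 0" using p by (simp add: m_def order_less_le integral_nonneg)
    have dist: "real_distribution (density M (\<lambda>x. ennreal (r x / m)))"
      if r: "integrable M r" "\<And>x. 0 \<le> r x" "(LINT x|M. r x) = m" for r
    proof (intro real_distribution.intro real_distribution_axioms.intro)
      have [measurable]: "r \<in> borel_measurable M" using r by auto
      have "(\<integral>\<^sup>+x. ennreal (r x / m) \<partial>M) = ennreal (LINT x|M. r x / m)"
        using r m by (intro nn_integral_eq_integral) auto
      then have total: "(\<integral>\<^sup>+x. ennreal (r x / m) \<partial>M) = 1" using r(3) m by simp
      show "prob_space (density M (\<lambda>x. ennreal (r x / m)))"
        by (rule prob_spaceI)
          (use total in \<open>simp add: emeasure_density cong: nn_integral_cong_simp\<close>)
      show "sets (density M (\<lambda>x. ennreal (r x / m))) = sets borel" using sets by simp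
    qed
    have char: "char (density M (\<lambda>x. ennreal (r x / m))) t = (LINT x|M. r x *\<^sub>R iexp (t * x)) / m"
      if r: "integrable M r" "\<And>x. 0 \<le> r x" for r t
    proof -
      have [measurable]: "r \<in> borel_measurable M" using r by auto
      have "char (density M (\<lambda>x. ennreal (r x / m))) t = (LINT x|M. (r x / m) *\<^sub>R iexp (t * x))"
        unfolding char_def using r m by (intro integral_density) auto
      also have "\<dots> = (LINT x|M. (r x *\<^sub>R iexp (t * x)) / m)"
        by (simp add: scaleR_conv_of_real)
      finally show ?thesis by simp
    qed
    have "density M (\<lambda>x. ennreal (p x / m)) = density M (\<lambda>x. ennreal (q x / m))"
    proof (rule Levy_uniqueness[OF dist[OF p m_def[symmetric]] dist[OF q mq]])
      show "char (density M (\<lambda>x. ennreal (p x / m))) = char (density M (\<lambda>x. ennreal (q x / m)))"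
        by (rule ext) (simp only: char[OF p] char[OF q] eq)
    qed
    moreover have "(\<integral>\<^sup>+x. ennreal (p x / m) \<partial>M) = ennreal (LINT x|M. p x / m)"
      using p m by (intro nn_integral_eq_integral) auto
    ultimately have "AE x in M. ennreal (p x / m) = ennreal (q x / m)"
      by (subst (asm) finite_density_unique) auto
    then show ?thesis by eventually_elim (use m p q in \<open>simp add: divide_nonneg_pos\<close>)
  qed
qed

lemma fourier_unique_real:
  fixes M :: "real measure" and u :: "real \<Rightarrow> real"
  assumes sets: "sets M = sets borel" and u: "integrable M u"
    and eq: "\<And>t. (LINT x|M. u x *\<^sub>R iexp (t * x)) = 0"
  shows "AE x in M. u x = 0"
proof -
  note [measurable_cong] = sets
  have [measurable]: "u \<in> borel_measurable M" using u by auto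
  have int: "integrable M (\<lambda>x. max (u x) 0)" "integrable M (\<lambda>x. max (- u x) 0)" using u by auto
  have "AE x in M. max (u x) 0 = max (- u x) 0"
  proof (rule fourier_nonneg_unique[OF sets int(1) _ int(2)])
    fix t
    have int': "integrable M (\<lambda>x. r x *\<^sub>R iexp (t * x))" if "integrable M r" for r :: "real \<Rightarrow> real"
    proof -
      have [measurable]: "r \<in> borel_measurable M" using that by auto
      show ?thesis by (rule Bochner_Integration.integrable_bound[OF that]) auto
    qed
    have "(LINT x|M. max (u x) 0 *\<^sub>R iexp (t * x)) - (LINT x|M. max (- u x) 0 *\<^sub>R iexp (t * x)) =
      (LINT x|M. max (u x) 0 *\<^sub>R iexp (t * x) - max (- u x) 0 *\<^sub>R iexp (t * x))"
      by (rule Bochner_Integration.integral_diff[symmetric]) (intro int' int)+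
    also have "\<dots> = (LINT x|M. u x *\<^sub>R iexp (t * x))"
      by (intro Bochner_Integration.integral_cong) (auto simp: max_def simp flip: scaleR_left_diff_distrib)
    finally show "(LINT x|M. max (u x) 0 *\<^sub>R iexp (t * x)) = (LINT x|M. max (- u x) 0 *\<^sub>R iexp (t * x))"
      using eq by simp
  qed auto
  then show ?thesis by eventually_elim (auto simp: max_def split: if_splits)
qed

lemma fourier_unique:
  fixes M :: "real measure" and \<phi> :: "real \<Rightarrow> complex"
  assumes sets: "sets M = sets borel" and \<phi>: "integrable M \<phi>"
    and eq: "\<And>t. (LINT x|M. \<phi> x * iexp (t * x)) = 0"
  shows "AE x in M. \<phi> x = 0"
proof -
  note [measurable_cong] = sets
  have [measurable]: "\<phi> \<in> borel_measurable M" using \<phi> by auto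
  have int: "integrable M (\<lambda>x. \<psi> x * iexp (t * x))" if "integrable M \<psi>" for t and \<psi> :: "real \<Rightarrow> complex"
  proof -
    have [measurable]: "\<psi> \<in> borel_measurable M" using that by auto
    show ?thesis by (rule Bochner_Integration.integrable_bound[OF that]) (auto simp: norm_mult)
  qed
  have conj: "(LINT x|M. cnj (\<phi> x) * iexp (t * x)) = 0" for t
  proof -
    have "(LINT x|M. cnj (\<phi> x) * iexp (t * x)) = (LINT x|M. cnj (\<phi> x * iexp (- t * x)))"
      by (intro Bochner_Integration.integral_cong) (auto simp: exp_cnj)
    also have "\<dots> = cnj (LINT x|M. \<phi> x * iexp (- t * x))" by (rule Bochner_Integration.integral_cnj)
    finally show ?thesis using eq[of "- t"] by simp
  qed
  have \<phi>': "integrable M (\<lambda>x. cnj (\<phi> x))" using \<phi> by simp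
  have "AE x in M. Re (\<phi> x) = 0"
  proof (rule fourier_unique_real[OF sets])
    fix t
    have "(LINT x|M. Re (\<phi> x) *\<^sub>R iexp (t * x)) = (LINT x|M. (1/2) * (\<phi> x * iexp (t * x) + cnj (\<phi> x) * iexp (t * x)))"
      by (intro Bochner_Integration.integral_cong)
        (auto simp: scaleR_conv_of_real complex_add_cnj simp flip: distrib_right)
    also have "\<dots> = 0"
      by (simp only: integral_mult_right_zero Bochner_Integration.integral_add[OF int[OF \<phi>] int[OF \<phi>']] eq conj) simp
    finally show "(LINT x|M. Re (\<phi> x) *\<^sub>R iexp (t * x)) = 0" .
  qed (use \<phi> in simp)
  moreover have "AE x in M. Im (\<phi> x) = 0"
  proof (rule fourier_unique_real[OF sets])
    fix t
    have "(LINT x|M. Im (\<phi> x) *\<^sub>R iexp (t * x)) = (LINT x|M. (1/(2*\<i>)) * (\<phi> x * iexp (t * x) - cnj (\<phi> x) * iexp (t * x)))"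
      by (intro Bochner_Integration.integral_cong)
        (auto simp: scaleR_conv_of_real complex_diff_cnj complex_eq_iff simp flip: left_diff_distrib)
    also have "\<dots> = 0"
      by (simp only: integral_mult_right_zero Bochner_Integration.integral_diff[OF int[OF \<phi>] int[OF \<phi>']] eq conj) simp
    finally show "(LINT x|M. Im (\<phi> x) *\<^sub>R iexp (t * x)) = 0" .
  qed (use \<phi> in simp)
  ultimately show ?thesis by eventually_elim (simp add: complex_eq_iff)
qed

lemma synthesis_eq_zero:
  assumes [measurable]: "\<phi> \<in> weight_L2" and zero: "\<And>x::real. synthesis \<phi> (of_real x) = 0"
  shows "AE \<xi> in weight_measure. \<phi> \<xi> = 0"
proof (rule fourier_unique)
  show "integrable weight_measure \<phi>" using integrable_synthesis[OF assms(1), of 0] by simp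
  fix t
  show "(LINT \<xi>|weight_measure. \<phi> \<xi> * iexp (t * \<xi>)) = 0"
    using zero[of "t / (2 * pi)"] by (simp add: synthesis_def mult.commute mult.left_commute)
qed simp

section \<open>Completeness of square integrable functions\<close>

text \<open>The Riesz-Fischer theorem. A subsequence \<open>R\<close> with squared distances below \<open>4 ^ (- k)\<close> has differences
  that are summable almost everywhere, because \<open>g \<le> (2 ^ k g\<^sup>2 + 2 ^ (- k)) / 2\<close> bounds their
  integrals on a finite measure space. Fatou's lemma transfers the distances to the limit.\<close>

lemma (in finite_measure) square_integrable_complete:
  fixes \<phi> :: "nat \<Rightarrow> 'a \<Rightarrow> 'b::{banach, second_countable_topology}"
  assumes [measurable]: "\<And>n. \<phi> n \<in> borel_measurable M"
    and int: "\<And>m n. integrable M (\<lambda>x. (norm (\<phi> m x - \<phi> n x))\<^sup>2)"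
    and cauchy: "\<And>e. e > 0 \<Longrightarrow> \<exists>N. \<forall>m\<ge>N. \<forall>n\<ge>N. (LINT x|M. (norm (\<phi> m x - \<phi> n x))\<^sup>2) < e"
  obtains \<psi> where "\<psi> \<in> borel_measurable M" "\<And>n. integrable M (\<lambda>x. (norm (\<phi> n x - \<psi> x))\<^sup>2)"
    "(\<lambda>n. LINT x|M. (norm (\<phi> n x - \<psi> x))\<^sup>2) \<longlonglongrightarrow> 0"
proof -
  have "\<exists>N. \<forall>m\<ge>N. \<forall>n\<ge>N. (LINT x|M. (norm (\<phi> m x - \<phi> n x))\<^sup>2) < (1/4) ^ k" for k :: nat
    by (rule cauchy) simp
  then obtain N where N: "\<And>k m n. N k \<le> m \<Longrightarrow> N k \<le> n \<Longrightarrow> (LINT x|M. (norm (\<phi> m x - \<phi> n x))\<^sup>2) < (1/4) ^ k"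
    by metis
  \<comment> \<open>The partial sums of \<open>N\<close> are indices beyond \<open>N k\<close> that also increase strictly.\<close>
  define R where "R k = (\<Sum>i\<le>k. Suc (N i))" for k
  have NR: "N k \<le> R k" for k
    using member_le_sum[of k "{..k}" "\<lambda>i. Suc (N i)"] by (simp add: R_def)
  have RS: "N k \<le> R (Suc k)" for k using NR[of k] by (simp add: R_def)
  define g where "g k x = norm (\<phi> (R (Suc k)) x - \<phi> (R k) x)" for k x
  have [measurable]: "g k \<in> borel_measurable M" for k unfolding g_def by measurable
  define C where "C = (1 + measure M (space M)) / 2"
  have g_int: "(\<integral>\<^sup>+x. ennreal (g k x) \<partial>M) \<le> ennreal (C * (1/2) ^ k)" for k
  proof -
    have le: "g k x \<le> (2 ^ k * (g k x)\<^sup>2 + (1/2) ^ k) / 2" for x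
    proof -
      have "0 \<le> 2 ^ k * (g k x - (1/2) ^ k)\<^sup>2" by simp
      also have "\<dots> = 2 ^ k * (g k x)\<^sup>2 - 2 * (2 ^ k * (1/2) ^ k) * g k x + (2 ^ k * (1/2) ^ k) * (1/2) ^ k"
        by (simp add: power2_eq_square algebra_simps)
      also have "2 ^ k * (1/2) ^ k = (1 :: real)" by (simp flip: power_mult_distrib)
      finally show ?thesis by simp
    qed
    have sq: "integrable M (\<lambda>x. (g k x)\<^sup>2)" unfolding g_def by (rule int)
    have dom: "integrable M (\<lambda>x. (2 ^ k * (g k x)\<^sup>2 + (1/2) ^ k) / 2)" using sq by simp
    have "(\<integral>\<^sup>+x. ennreal (g k x) \<partial>M) \<le> (\<integral>\<^sup>+x. ennreal ((2 ^ k * (g k x)\<^sup>2 + (1/2) ^ k) / 2) \<partial>M)"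
      by (intro nn_integral_mono ennreal_leI le)
    also have "\<dots> = ennreal (LINT x|M. (2 ^ k * (g k x)\<^sup>2 + (1/2) ^ k) / 2)"
      by (intro nn_integral_eq_integral dom) auto
    also have "(LINT x|M. (2 ^ k * (g k x)\<^sup>2 + (1/2) ^ k) / 2) =
        (2 ^ k * (LINT x|M. (g k x)\<^sup>2) + measure M (space M) * (1/2) ^ k) / 2"
      using sq by simp
    also have "\<dots> \<le> (2 ^ k * (1/4) ^ k + measure M (space M) * (1/2) ^ k) / 2"
      using N[OF RS[of k] NR[of k]] unfolding g_def by (intro divide_right_mono add_right_mono mult_left_mono) auto
    also have "2 ^ k * (1/4) ^ k = (1/2 :: real) ^ k" by (simp flip: power_mult_distrib)
    finally show ?thesis by (simp add: C_def algebra_simps add_divide_distrib ennreal_leI)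
  qed
  have "(\<integral>\<^sup>+x. (\<Sum>k. ennreal (g k x)) \<partial>M) = (\<Sum>k. \<integral>\<^sup>+x. ennreal (g k x) \<partial>M)"
    by (rule nn_integral_suminf) simp
  also have "\<dots> \<le> (\<Sum>k. ennreal (C * (1/2) ^ k))"
    by (intro suminf_le g_int summableI)
  also have "\<dots> = ennreal (\<Sum>k. C * (1/2) ^ k)"
    by (intro suminf_ennreal2 summable_mult summable_geometric) (auto simp: C_def)
  finally have "(\<integral>\<^sup>+x. (\<Sum>k. ennreal (g k x)) \<partial>M) \<noteq> \<infinity>" by (auto simp: top_unique)
  then have "AE x in M. (\<Sum>k. ennreal (g k x)) \<noteq> \<infinity>"
    by (intro nn_integral_PInf_AE) auto
  then have conv: "AE x in M. convergent (\<lambda>k. \<phi> (R k) x)"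
  proof eventually_elim
    case (elim x)
    then have "summable (\<lambda>k. g k x)" by (intro summable_suminf_not_top) (auto simp: g_def)
    then have "summable (\<lambda>k. \<phi> (R (Suc k)) x - \<phi> (R k) x)"
      unfolding g_def by (rule summable_norm_cancel)
    then have "convergent (\<lambda>n. \<phi> (R n) x - \<phi> (R 0) x)"
      by (simp add: summable_iff_convergent sum_lessThan_telescope[of "\<lambda>k. \<phi> (R k) x"])
    then have "convergent (\<lambda>n. (\<phi> (R n) x - \<phi> (R 0) x) + \<phi> (R 0) x)"
      by (intro convergent_add convergent_const)
    then show ?case by simp
  qed
  define \<psi> where "\<psi> x = lim (\<lambda>k. \<phi> (R k) x)" for x
  have [measurable]: "\<psi> \<in> borel_measurable M" unfolding \<psi>_def by measurable
  have fatou: "(\<integral>\<^sup>+x. ennreal ((norm (\<phi> n x - \<psi> x))\<^sup>2) \<partial>M) \<le> ennreal e"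
    if tail: "\<forall>\<^sub>F m in sequentially. (LINT x|M. (norm (\<phi> n x - \<phi> m x))\<^sup>2) \<le> e" for n e
  proof -
    have "(\<integral>\<^sup>+x. ennreal ((norm (\<phi> n x - \<psi> x))\<^sup>2) \<partial>M) =
        (\<integral>\<^sup>+x. liminf (\<lambda>k. ennreal ((norm (\<phi> n x - \<phi> (R k) x))\<^sup>2)) \<partial>M)"
    proof (rule nn_integral_cong_AE)
      show "AE x in M. ennreal ((norm (\<phi> n x - \<psi> x))\<^sup>2) = liminf (\<lambda>k. ennreal ((norm (\<phi> n x - \<phi> (R k) x))\<^sup>2))"
        using conv
      proof eventually_elim
        case (elim x)
        then have "(\<lambda>k. \<phi> (R k) x) \<longlonglongrightarrow> \<psi> x" unfolding \<psi>_def by (simp add: convergent_LIMSEQ_iff)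
        then have "(\<lambda>k. ennreal ((norm (\<phi> n x - \<phi> (R k) x))\<^sup>2)) \<longlonglongrightarrow> ennreal ((norm (\<phi> n x - \<psi> x))\<^sup>2)"
          by (intro tendsto_intros)
        from lim_imp_Liminf[OF _ this] show ?case by simp
      qed
    qed
    also have "\<dots> \<le> liminf (\<lambda>k. \<integral>\<^sup>+x. ennreal ((norm (\<phi> n x - \<phi> (R k) x))\<^sup>2) \<partial>M)"
      by (rule nn_integral_liminf) simp
    also have "\<dots> \<le> limsup (\<lambda>k. \<integral>\<^sup>+x. ennreal ((norm (\<phi> n x - \<phi> (R k) x))\<^sup>2) \<partial>M)"
      by (rule Liminf_le_Limsup) simp
    also have "\<dots> \<le> ennreal e"
    proof (rule Limsup_bounded)
      have "filterlim R at_top sequentially"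
        by (rule filterlim_subseq) (auto simp: strict_mono_Suc_iff R_def)
      from eventually_compose_filterlim[OF tail this]
      show "\<forall>\<^sub>F k in sequentially. (\<integral>\<^sup>+x. ennreal ((norm (\<phi> n x - \<phi> (R k) x))\<^sup>2) \<partial>M) \<le> ennreal e"
        by eventually_elim (simp add: nn_integral_eq_integral[OF int] ennreal_leI)
    qed
    finally show ?thesis .
  qed
  have psi_int: "integrable M (\<lambda>x. (norm (\<phi> n x - \<psi> x))\<^sup>2)" for n
  proof -
    obtain K where K: "\<And>l m. K \<le> l \<Longrightarrow> K \<le> m \<Longrightarrow> (LINT x|M. (norm (\<phi> l x - \<phi> m x))\<^sup>2) < 1"
      using cauchy[of 1] by auto
    have far: "integrable M (\<lambda>x. (norm (\<phi> K x - \<psi> x))\<^sup>2)"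
    proof (rule integrableI_bounded)
      have "(\<integral>\<^sup>+x. ennreal ((norm (\<phi> K x - \<psi> x))\<^sup>2) \<partial>M) \<le> ennreal 1"
        by (rule fatou) (use K in \<open>auto simp: eventually_sequentially intro!: exI[of _ K] less_imp_le\<close>)
      then show "(\<integral>\<^sup>+x. ennreal (norm ((norm (\<phi> K x - \<psi> x))\<^sup>2)) \<partial>M) < \<infinity>"
        by (simp add: le_less_trans[OF _ ennreal_one_less_top])
    qed simp
    show ?thesis
    proof (rule Bochner_Integration.integrable_bound)
      show "integrable M (\<lambda>x. 2 * (norm (\<phi> n x - \<phi> K x))\<^sup>2 + 2 * (norm (\<phi> K x - \<psi> x))\<^sup>2)"
        using far int by simp
      have "(norm (\<phi> n x - \<psi> x))\<^sup>2 \<le> 2 * (norm (\<phi> n x - \<phi> K x))\<^sup>2 + 2 * (norm (\<phi> K x - \<psi> x))\<^sup>2" for x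
      proof -
        have "(norm (\<phi> n x - \<psi> x))\<^sup>2 \<le> (norm (\<phi> n x - \<phi> K x) + norm (\<phi> K x - \<psi> x))\<^sup>2"
          using norm_triangle_ineq[of "\<phi> n x - \<phi> K x" "\<phi> K x - \<psi> x"] by (intro power_mono) auto
        also have "\<dots> \<le> 2 * (norm (\<phi> n x - \<phi> K x))\<^sup>2 + 2 * (norm (\<phi> K x - \<psi> x))\<^sup>2"
          using sum_squares_bound[of "norm (\<phi> n x - \<phi> K x)" "norm (\<phi> K x - \<psi> x)"] by (simp add: power2_sum)
        finally show ?thesis .
      qed
      then show "AE x in M. norm ((norm (\<phi> n x - \<psi> x))\<^sup>2) \<le>
          norm (2 * (norm (\<phi> n x - \<phi> K x))\<^sup>2 + 2 * (norm (\<phi> K x - \<psi> x))\<^sup>2)" by simp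
    qed simp
  qed
  moreover have "(\<lambda>n. LINT x|M. (norm (\<phi> n x - \<psi> x))\<^sup>2) \<longlonglongrightarrow> 0"
  proof (rule LIMSEQ_I)
    fix e :: real assume e: "e > 0"
    then obtain K where K: "\<And>l m. K \<le> l \<Longrightarrow> K \<le> m \<Longrightarrow> (LINT x|M. (norm (\<phi> l x - \<phi> m x))\<^sup>2) < e / 2"
      using cauchy[of "e / 2"] by auto
    have "norm ((LINT x|M. (norm (\<phi> n x - \<psi> x))\<^sup>2) - 0) < e" if "n \<ge> K" for n
    proof -
      have "(\<integral>\<^sup>+x. ennreal ((norm (\<phi> n x - \<psi> x))\<^sup>2) \<partial>M) \<le> ennreal (e / 2)"
        by (rule fatou) (use K that in \<open>auto simp: eventually_sequentially intro!: exI[of _ K] less_imp_le\<close>)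
      then have "(LINT x|M. (norm (\<phi> n x - \<psi> x))\<^sup>2) \<le> e / 2"
        using e by (simp add: nn_integral_eq_integral[OF psi_int])
      then show ?thesis using e by simp
    qed
    then show "\<exists>K. \<forall>n\<ge>K. norm ((LINT x|M. (norm (\<phi> n x - \<psi> x))\<^sup>2) - 0) < e" by blast
  qed
  ultimately show ?thesis using that \<open>\<psi> \<in> borel_measurable M\<close> by blast
qed

section \<open>The reproducing kernel Hilbert space of the weight\<close>

definition synthesis_on :: "real set \<Rightarrow> (real \<Rightarrow> complex) \<Rightarrow> real \<Rightarrow> complex" where
  "synthesis_on U \<phi> = zero_outside U (\<lambda>x. synthesis \<phi> (of_real x))"

text \<open>A preimage under \<^const>\<open>synthesis_on\<close>; for nonempty open \<open>U\<close> it is determined almost everywhere.\<close>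

definition spectrum_on :: "real set \<Rightarrow> (real \<Rightarrow> complex) \<Rightarrow> real \<Rightarrow> complex" where
  "spectrum_on U h = (SOME \<phi>. \<phi> \<in> weight_L2 \<and> synthesis_on U \<phi> = h)"

definition synthesis_inner :: "real set \<Rightarrow> (real \<Rightarrow> complex) \<Rightarrow> (real \<Rightarrow> complex) \<Rightarrow> complex" where
  "synthesis_inner U g h = (LINT \<xi>|weight_measure. spectrum_on U g \<xi> * cnj (spectrum_on U h \<xi>))"

text \<open>A set without limit points is countable, so every uncountable set is large enough for the
  identity theorem.\<close>

lemma entire_eq_if_eq_on_uncountable:
  assumes "f holomorphic_on UNIV" "g holomorphic_on UNIV" "uncountable A" "\<And>z. z \<in> A \<Longrightarrow> f z = g z"
  shows "f z = g z"
proof -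
  obtain x where lim: "x islimpt A" using no_limpt_imp_countable assms(3) by blast
  have "f z - g z = 0"
    by (rule analytic_continuation[OF _ _ _ _ _ lim, where f = "\<lambda>w. f w - g w" and S = UNIV])
      (use assms in \<open>auto intro!: holomorphic_intros\<close>)
  then show ?thesis by simp
qed

lemma entire_eq_if_eq_on_real:
  assumes "f holomorphic_on UNIV" "g holomorphic_on UNIV" "open U" "U \<noteq> {}"
    and eq: "\<And>x::real. x \<in> U \<Longrightarrow> f (of_real x) = g (of_real x)"
  shows "f z = g z"
proof (rule entire_eq_if_eq_on_uncountable[OF assms(1,2)])
  obtain x e where "e > 0" "ball x e \<subseteq> U" using assms(3,4) open_contains_ball by blast
  then have "uncountable U" using uncountable_ball countable_subset by blast
  moreover have "inj_on complex_of_real U" by (auto intro: inj_onI)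
  ultimately show "uncountable (complex_of_real ` U)" using countable_image_inj_eq by blast
  show "f z = g z" if "z \<in> complex_of_real ` U" for z using that eq by blast
qed

lemma synthesis_on_add:
  assumes "\<phi> \<in> weight_L2" "\<psi> \<in> weight_L2"
  shows "synthesis_on U (\<lambda>\<xi>. \<phi> \<xi> + \<psi> \<xi>) = (\<lambda>x. synthesis_on U \<phi> x + synthesis_on U \<psi> x)"
  by (auto simp: synthesis_on_def zero_outside_def synthesis_add[OF assms])

lemma synthesis_on_diff:
  assumes "\<phi> \<in> weight_L2" "\<psi> \<in> weight_L2"
  shows "synthesis_on U (\<lambda>\<xi>. \<phi> \<xi> - \<psi> \<xi>) = (\<lambda>x. synthesis_on U \<phi> x - synthesis_on U \<psi> x)"
  by (auto simp: synthesis_on_def zero_outside_def synthesis_diff[OF assms])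

lemma synthesis_on_scale: "synthesis_on U (\<lambda>\<xi>. c * \<phi> \<xi>) = (\<lambda>x. c * synthesis_on U \<phi> x)"
  by (auto simp: synthesis_on_def zero_outside_def synthesis_scale)

lemma synthesis_on_zero: "synthesis_on U (\<lambda>_. 0) = (\<lambda>_. 0)"
  by (auto simp: synthesis_on_def zero_outside_def synthesis_def)

text \<open>An entire function that vanishes on a nonempty open set of reals vanishes on all reals, and then
  the uniqueness of Fourier transforms applies. Thus restriction to \<open>U\<close> loses nothing, and the space for
  \<open>U\<close> is isometric to the space for the whole line.\<close>

lemma synthesis_on_inj:
  assumes U: "open U" "U \<noteq> {}" and L2: "\<phi> \<in> weight_L2" "\<psi> \<in> weight_L2"
    and eq: "synthesis_on U \<phi> = synthesis_on U \<psi>"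
  shows "AE \<xi> in weight_measure. \<phi> \<xi> = \<psi> \<xi>"
proof -
  have "synthesis \<phi> z = synthesis \<psi> z" for z
    by (rule entire_eq_if_eq_on_real[OF holomorphic_synthesis[OF L2(1)] holomorphic_synthesis[OF L2(2)] U])
      (use eq in \<open>metis synthesis_on_def zero_outside_def\<close>)
  then have "AE \<xi> in weight_measure. \<phi> \<xi> - \<psi> \<xi> = 0"
    by (intro synthesis_eq_zero weight_L2_diff L2) (simp add: synthesis_diff[OF L2])
  then show ?thesis by simp
qed

lemma spectrum_on:
  assumes "h \<in> synthesis_on U ` weight_L2"
  shows "spectrum_on U h \<in> weight_L2" "synthesis_on U (spectrum_on U h) = h"
proof -
  have "\<exists>\<phi>. \<phi> \<in> weight_L2 \<and> synthesis_on U \<phi> = h" using assms by blast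
  from someI_ex[OF this] show "spectrum_on U h \<in> weight_L2" "synthesis_on U (spectrum_on U h) = h"
    by (simp_all add: spectrum_on_def)
qed

lemma cnj_borel_measurable [measurable]: "cnj \<in> borel_measurable borel"
  by (intro borel_measurable_continuous_onI continuous_intros)

lemma integrable_weight_L2_mult_cnj:
  assumes "\<phi> \<in> weight_L2" "\<psi> \<in> weight_L2"
  shows "integrable weight_measure (\<lambda>\<xi>. \<phi> \<xi> * cnj (\<psi> \<xi>))"
proof (rule Bochner_Integration.integrable_bound)
  note [measurable] = assms[THEN weight_L2_measurable]
  show "(\<lambda>\<xi>. \<phi> \<xi> * cnj (\<psi> \<xi>)) \<in> borel_measurable weight_measure" by measurable
  show "integrable weight_measure (\<lambda>\<xi>. (cmod (\<phi> \<xi>))\<^sup>2 + (cmod (\<psi> \<xi>))\<^sup>2)"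
    using assms[THEN weight_L2_square] by simp
  have "cmod (\<phi> \<xi> * cnj (\<psi> \<xi>)) \<le> (cmod (\<phi> \<xi>))\<^sup>2 + (cmod (\<psi> \<xi>))\<^sup>2" for \<xi>
    using sum_squares_bound[of "cmod (\<phi> \<xi>)" "cmod (\<psi> \<xi>)"]
      mult_nonneg_nonneg[OF norm_ge_zero[of "\<phi> \<xi>"] norm_ge_zero[of "\<psi> \<xi>"]]
    unfolding norm_mult complex_mod_cnj by linarith
  then show "AE \<xi> in weight_measure. norm (\<phi> \<xi> * cnj (\<psi> \<xi>)) \<le> norm ((cmod (\<phi> \<xi>))\<^sup>2 + (cmod (\<psi> \<xi>))\<^sup>2)"
    by simp
qed

context
  fixes U :: "real set"
  assumes U: "open U" "U \<noteq> {}"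
begin

lemma synthesis_inner_eq:
  assumes L2: "\<phi> \<in> weight_L2" "\<psi> \<in> weight_L2"
  shows "synthesis_inner U (synthesis_on U \<phi>) (synthesis_on U \<psi>) = (LINT \<xi>|weight_measure. \<phi> \<xi> * cnj (\<psi> \<xi>))"
proof -
  note spec = spectrum_on[OF imageI[OF L2(1)], of U] spectrum_on[OF imageI[OF L2(2)], of U]
  note [measurable] = spec(1,3)[THEN weight_L2_measurable] L2[THEN weight_L2_measurable]
  have "AE \<xi> in weight_measure. spectrum_on U (synthesis_on U \<phi>) \<xi> = \<phi> \<xi>"
    "AE \<xi> in weight_measure. spectrum_on U (synthesis_on U \<psi>) \<xi> = \<psi> \<xi>"
    using synthesis_on_inj[OF U] spec L2 by blast+
  then have "AE \<xi> in weight_measure. spectrum_on U (synthesis_on U \<phi>) \<xi> * cnj (spectrum_on U (synthesis_on U \<psi>) \<xi>) =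
      \<phi> \<xi> * cnj (\<psi> \<xi>)"
    by eventually_elim simp
  then show ?thesis unfolding synthesis_inner_def by (intro integral_cong_AE) auto
qed

lemma synthesis_inner_self:
  assumes L2: "\<phi> \<in> weight_L2"
  shows "synthesis_inner U (synthesis_on U \<phi>) (synthesis_on U \<phi>) = of_real (LINT \<xi>|weight_measure. (cmod (\<phi> \<xi>))\<^sup>2)"
  unfolding synthesis_inner_eq[OF L2 L2] complex_norm_square[symmetric] by (rule integral_complex_of_real)

lemma synthesis_norm_eq:
  assumes L2: "\<phi> \<in> weight_L2"
  shows "ip_norm (synthesis_inner U) (synthesis_on U \<phi>) = sqrt (LINT \<xi>|weight_measure. (cmod (\<phi> \<xi>))\<^sup>2)"
  unfolding ip_norm_def synthesis_inner_self[OF L2] by simp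

lemma function_hilbert_space_synthesis:
  "function_hilbert_space (synthesis_on U ` weight_L2) (synthesis_inner U)"
  unfolding function_hilbert_space_def
proof (intro conjI ballI allI impI)
  show "(\<lambda>x. 0) \<in> synthesis_on U ` weight_L2"
    using imageI[OF weight_L2_zero, of "synthesis_on U"] by (simp only: synthesis_on_zero)
next
  fix g h assume "g \<in> synthesis_on U ` weight_L2" "h \<in> synthesis_on U ` weight_L2"
  then obtain \<phi> \<psi> where L2: "\<phi> \<in> weight_L2" "\<psi> \<in> weight_L2" and gh: "g = synthesis_on U \<phi>" "h = synthesis_on U \<psi>"
    by blast
  show "(\<lambda>x. g x + h x) \<in> synthesis_on U ` weight_L2"
    unfolding gh synthesis_on_add[OF L2, symmetric] by (rule imageI[OF weight_L2_add[OF L2]])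
  show "synthesis_inner U h g = cnj (synthesis_inner U g h)"
    unfolding gh synthesis_inner_eq[OF L2] synthesis_inner_eq[OF L2(2,1)]
    by (subst Bochner_Integration.integral_cnj[symmetric]) (simp add: mult.commute)
next
  fix c h assume "h \<in> synthesis_on U ` weight_L2"
  then obtain \<psi> where L2: "\<psi> \<in> weight_L2" and h: "h = synthesis_on U \<psi>" by blast
  show "(\<lambda>x. c * h x) \<in> synthesis_on U ` weight_L2"
    unfolding h synthesis_on_scale[symmetric] by (rule imageI[OF weight_L2_scale[OF L2]])
next
  fix f g h assume "f \<in> synthesis_on U ` weight_L2" "g \<in> synthesis_on U ` weight_L2" "h \<in> synthesis_on U ` weight_L2"
  then obtain \<phi> \<psi> \<rho> where L2: "\<phi> \<in> weight_L2" "\<psi> \<in> weight_L2" "\<rho> \<in> weight_L2"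
    and fgh: "f = synthesis_on U \<phi>" "g = synthesis_on U \<psi>" "h = synthesis_on U \<rho>" by blast
  show "synthesis_inner U (\<lambda>x. f x + g x) h = synthesis_inner U f h + synthesis_inner U g h"
    unfolding fgh synthesis_on_add[OF L2(1,2), symmetric] synthesis_inner_eq[OF weight_L2_add[OF L2(1,2)] L2(3)]
      synthesis_inner_eq[OF L2(1,3)] synthesis_inner_eq[OF L2(2,3)] distrib_right
    by (intro Bochner_Integration.integral_add integrable_weight_L2_mult_cnj L2)
next
  fix c g h assume "g \<in> synthesis_on U ` weight_L2" "h \<in> synthesis_on U ` weight_L2"
  then obtain \<phi> \<psi> where L2: "\<phi> \<in> weight_L2" "\<psi> \<in> weight_L2" and gh: "g = synthesis_on U \<phi>" "h = synthesis_on U \<psi>"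
    by blast
  show "synthesis_inner U (\<lambda>x. c * g x) h = c * synthesis_inner U g h"
    unfolding gh synthesis_on_scale[symmetric] synthesis_inner_eq[OF weight_L2_scale[OF L2(1)] L2(2)]
      synthesis_inner_eq[OF L2] mult.assoc by (rule integral_mult_right_zero)
next
  fix h assume "h \<in> synthesis_on U ` weight_L2" and nz: "h \<noteq> (\<lambda>x. 0)"
  then obtain \<psi> where L2: "\<psi> \<in> weight_L2" and h: "h = synthesis_on U \<psi>" by blast
  have "(LINT \<xi>|weight_measure. (cmod (\<psi> \<xi>))\<^sup>2) \<noteq> 0"
  proof
    assume "(LINT \<xi>|weight_measure. (cmod (\<psi> \<xi>))\<^sup>2) = 0"
    then have "AE \<xi> in weight_measure. \<psi> \<xi> = 0"
      using integral_nonneg_eq_0_iff_AE[OF weight_L2_square[OF L2]] by simp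
    then have "synthesis \<psi> z = synthesis (\<lambda>_. 0) z" for z
      by (rule synthesis_cong_AE[OF L2 weight_L2_zero])
    then have "h = (\<lambda>x. 0)" unfolding h synthesis_on_def by (auto simp: zero_outside_def synthesis_def)
    then show False using nz by simp
  qed
  moreover have "0 \<le> (LINT \<xi>|weight_measure. (cmod (\<psi> \<xi>))\<^sup>2)" by (rule Bochner_Integration.integral_nonneg) simp
  ultimately have "0 < (LINT \<xi>|weight_measure. (cmod (\<psi> \<xi>))\<^sup>2)" by linarith
  then show "0 < Re (synthesis_inner U h h)"
    unfolding h synthesis_inner_self[OF L2] by simp
next
  fix s :: "nat \<Rightarrow> real \<Rightarrow> complex"
  assume s: "(\<forall>n. s n \<in> synthesis_on U ` weight_L2) \<and>
    (\<forall>e>0. \<exists>N. \<forall>m\<ge>N. \<forall>n\<ge>N. ip_norm (synthesis_inner U) (\<lambda>x. s m x - s n x) < e)"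
  then have "\<forall>n. \<exists>\<phi>. \<phi> \<in> weight_L2 \<and> s n = synthesis_on U \<phi>" by blast
  then obtain \<phi> where L2: "\<And>n. \<phi> n \<in> weight_L2" and s_eq: "\<And>n. s n = synthesis_on U (\<phi> n)"
    by metis
  have norm_eq: "ip_norm (synthesis_inner U) (\<lambda>x. s m x - synthesis_on U \<psi> x) =
      sqrt (LINT \<xi>|weight_measure. (cmod (\<phi> m \<xi> - \<psi> \<xi>))\<^sup>2)" if "\<psi> \<in> weight_L2" for m \<psi>
    unfolding s_eq synthesis_on_diff[OF L2 that, symmetric] by (rule synthesis_norm_eq[OF weight_L2_diff[OF L2 that]])
  interpret finite_measure weight_measure by (rule finite_weight_measure)
  obtain \<psi> where \<psi>: "\<psi> \<in> borel_measurable weight_measure" "\<And>n. integrable weight_measure (\<lambda>\<xi>. (cmod (\<phi> n \<xi> - \<psi> \<xi>))\<^sup>2)"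
    "(\<lambda>n. LINT \<xi>|weight_measure. (cmod (\<phi> n \<xi> - \<psi> \<xi>))\<^sup>2) \<longlonglongrightarrow> 0"
  proof (rule square_integrable_complete[of \<phi>])
    show "\<phi> n \<in> borel_measurable weight_measure" for n using weight_L2_measurable[OF L2[of n]] by simp
    show "integrable weight_measure (\<lambda>\<xi>. (cmod (\<phi> m \<xi> - \<phi> n \<xi>))\<^sup>2)" for m n
      by (rule weight_L2_square[OF weight_L2_diff[OF L2 L2]])
    fix e :: real assume e: "e > 0"
    then obtain N where N: "\<forall>m\<ge>N. \<forall>n\<ge>N. ip_norm (synthesis_inner U) (\<lambda>x. s m x - s n x) < sqrt e"
      using conjunct2[OF s] real_sqrt_gt_zero by blast
    have "(LINT \<xi>|weight_measure. (cmod (\<phi> m \<xi> - \<phi> n \<xi>))\<^sup>2) < e" if "m \<ge> N" "n \<ge> N" for m n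
    proof -
      have "ip_norm (synthesis_inner U) (\<lambda>x. s m x - synthesis_on U (\<phi> n) x) < sqrt e"
        using N that by (simp flip: s_eq)
      then show ?thesis unfolding norm_eq[OF L2] by (simp only: real_sqrt_less_iff)
    qed
    then show "\<exists>N. \<forall>m\<ge>N. \<forall>n\<ge>N. (LINT \<xi>|weight_measure. (cmod (\<phi> m \<xi> - \<phi> n \<xi>))\<^sup>2) < e" by blast
  qed blast
  have "(\<lambda>\<xi>. \<phi> 0 \<xi> - \<psi> \<xi>) \<in> weight_L2"
    using \<psi> weight_L2_measurable[OF L2[of 0]] by (auto simp: weight_L2_def)
  from weight_L2_diff[OF L2[of 0] this] have \<psi>_L2: "\<psi> \<in> weight_L2" by simp
  show "\<exists>h\<in>synthesis_on U ` weight_L2. (\<lambda>n. ip_norm (synthesis_inner U) (\<lambda>x. s n x - h x)) \<longlonglongrightarrow> 0"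
  proof (rule bexI[OF _ imageI[OF \<psi>_L2]])
    show "(\<lambda>n. ip_norm (synthesis_inner U) (\<lambda>x. s n x - synthesis_on U \<psi> x)) \<longlonglongrightarrow> 0"
      unfolding norm_eq[OF \<psi>_L2] using tendsto_real_sqrt[OF \<psi>(3)] by simp
  qed
qed

end

lemma weight_L2_frequency: "(\<lambda>\<xi>. exp (- (2 * pi * \<i> * of_real \<xi> * of_real x))) \<in> weight_L2"
  by (rule weight_L2_bounded[where B = 1]) (auto simp: norm_exp_eq_Re)

lemma weight_kernel_eq_synthesis:
  "weight_kernel x y = synthesis (\<lambda>\<xi>. exp (- (2 * pi * \<i> * of_real \<xi> * of_real x))) (of_real y)"
proof -
  have "synthesis (\<lambda>\<xi>. exp (- (2 * pi * \<i> * of_real \<xi> * of_real x))) (of_real y) =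
    (LINT \<xi>|lborel. weight \<xi> *\<^sub>R (exp (- (2 * pi * \<i> * of_real \<xi> * of_real x)) * exp (2 * pi * \<i> * of_real \<xi> * of_real y)))"
    unfolding synthesis_def by (rule integral_weight_measure) measurable
  also have "\<dots> = weight_kernel x y"
    unfolding weight_kernel_def fourier_def
    by (intro Bochner_Integration.integral_cong refl)
      (simp add: scaleR_conv_of_real algebra_simps flip: exp_add)
  finally show ?thesis by simp
qed

lemma is_rkhs_weight_kernel:
  assumes U: "open U" "U \<noteq> {}"
  shows "is_rkhs U weight_kernel (synthesis_on U ` weight_L2) (synthesis_inner U)"
  unfolding is_rkhs_def
proof (intro conjI ballI allI impI)
  show "function_hilbert_space (synthesis_on U ` weight_L2) (synthesis_inner U)"
    by (rule function_hilbert_space_synthesis[OF U])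
  show "h x = 0" if "h \<in> synthesis_on U ` weight_L2" "x \<notin> U" for h x
    using that by (auto simp: synthesis_on_def zero_outside_def)
  fix x assume x: "x \<in> U"
  let ?e = "\<lambda>\<xi>. exp (- (2 * pi * \<i> * of_real \<xi> * of_real x))"
  have k: "zero_outside U (weight_kernel x) = synthesis_on U ?e"
    unfolding synthesis_on_def weight_kernel_eq_synthesis[of x, abs_def] ..
  show "zero_outside U (weight_kernel x) \<in> synthesis_on U ` weight_L2"
    unfolding k by (rule imageI[OF weight_L2_frequency])
  fix h assume "h \<in> synthesis_on U ` weight_L2"
  then obtain \<phi> where \<phi>: "\<phi> \<in> weight_L2" "h = synthesis_on U \<phi>" by blast
  have "cnj (?e \<xi>) = exp (2 * pi * \<i> * of_real \<xi> * of_real x)" for \<xi>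
    by (simp add: exp_cnj)
  then show "synthesis_inner U h (zero_outside U (weight_kernel x)) = h x"
    unfolding k \<phi>(2) synthesis_inner_eq[OF U \<phi>(1) weight_L2_frequency]
    using x by (simp add: synthesis_on_def zero_outside_def synthesis_def)
qed

lemma rkhs_weight_kernel:
  assumes "open U" "U \<noteq> {}"
  shows "rkhs U weight_kernel = synthesis_on U ` weight_L2"
  by (rule rkhs_eqI[OF is_rkhs_weight_kernel[OF assms]])

section \<open>Band-limited test functions\<close>

text \<open>This is \<open>sin (pi z) / (pi z)\<close>. In the integral form it is entire by the results above, and it needs
  no separate value at 0.\<close>

definition normalized_sinc :: "complex \<Rightarrow> complex" where
  "normalized_sinc z = (LINT \<xi>|lborel. indicat_real {-1/2..<1/2::real} \<xi> *\<^sub>R exp (2 * pi * \<i> * of_real \<xi> * z))"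

text \<open>The factorial cancels the weight on the \<open>n\<close>-th band, so that the transform is a sinc function
  centred at \<open>t\<close> and modulated with frequency \<open>n\<close>. Its squared norm is only \<open>fact \<bar>n\<bar>\<close>, while it
  grows like \<open>exp (2 pi \<bar>n\<bar> \<bar>y\<bar>)\<close> in one of the two imaginary directions. The slow decay
  of the weight thus enters through these functions.\<close>

definition band_atom :: "int \<Rightarrow> real \<Rightarrow> real \<Rightarrow> complex" where
  "band_atom n t \<xi> = (indicat_real {-1/2..<1/2::real} (\<xi> - of_int n) * fact (nat \<bar>n\<bar>)) *\<^sub>R
     exp (- (2 * pi * \<i> * of_real \<xi> * of_real t))"

lemma weight_on_band:
  "weight \<xi> * (indicat_real {-1/2..<1/2::real} (\<xi> - of_int n) * fact (nat \<bar>n\<bar>)) = indicat_real {-1/2..<1/2::real} (\<xi> - of_int n)"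
proof (cases "\<xi> - of_int n \<in> {-1/2..<1/2::real}")
  case True
  then have "\<lfloor>\<xi> + 1/2\<rfloor> = n" by (intro floor_unique) auto
  then show ?thesis by (simp add: weight_eq)
qed simp

lemma band_atom_measurable [measurable]: "band_atom n t \<in> borel_measurable borel"
  unfolding band_atom_def by measurable

lemma norm_band_atom: "cmod (band_atom n t \<xi>) = indicat_real {-1/2..<1/2::real} (\<xi> - of_int n) * fact (nat \<bar>n\<bar>)"
  by (simp add: band_atom_def norm_exp_eq_Re abs_mult)

lemma band_atom_L2: "band_atom n t \<in> weight_L2"
  by (rule weight_L2_bounded[where B = "fact (nat \<bar>n\<bar>)"]) (auto simp: norm_band_atom indicator_def)

lemma integrable_indicator_Ico: "integrable lborel (indicat_real {a..<b::real})"
  by (cases "a \<le> b") (auto simp: integrable_indicator_iff)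

lemma lborel_integral_translate:
  fixes f :: "real \<Rightarrow> 'a :: {banach, second_countable_topology}"
  shows "(LINT \<xi>|lborel. f (\<xi> - c)) = (LINT \<xi>|lborel. f \<xi>)"
  using lborel_integral_real_affine[of 1 "\<lambda>\<xi>. f (\<xi> - c)" c] by simp

lemma band_atom_norm_square: "(LINT \<xi>|weight_measure. (cmod (band_atom n t \<xi>))\<^sup>2) = fact (nat \<bar>n\<bar>)"
proof -
  have "(LINT \<xi>|weight_measure. (cmod (band_atom n t \<xi>))\<^sup>2) = (LINT \<xi>|lborel. weight \<xi> *\<^sub>R (cmod (band_atom n t \<xi>))\<^sup>2)"
    by (rule integral_weight_measure) measurable
  also have "\<dots> = (LINT \<xi>|lborel. fact (nat \<bar>n\<bar>) * indicat_real {-1/2..<1/2::real} (\<xi> - of_int n))"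
  proof (intro Bochner_Integration.integral_cong refl)
    fix \<xi> :: real
    let ?I = "indicat_real {-1/2..<1/2::real} (\<xi> - of_int n)"
    have "weight \<xi> *\<^sub>R (cmod (band_atom n t \<xi>))\<^sup>2 = weight \<xi> * (?I * fact (nat \<bar>n\<bar>)) * (?I * fact (nat \<bar>n\<bar>))"
      by (simp add: norm_band_atom power2_eq_square)
    also have "\<dots> = ?I * (?I * fact (nat \<bar>n\<bar>))" by (simp only: weight_on_band)
    finally show "weight \<xi> *\<^sub>R (cmod (band_atom n t \<xi>))\<^sup>2 = fact (nat \<bar>n\<bar>) * ?I" by (simp add: indicator_def)
  qed
  also have "\<dots> = fact (nat \<bar>n\<bar>) * (LINT \<xi>|lborel. indicat_real {-1/2..<1/2::real} (\<xi> - of_int n))" by simp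
  also have "(LINT \<xi>|lborel. indicat_real {-1/2..<1/2::real} (\<xi> - of_int n)) = 1"
    by (subst lborel_integral_translate) simp
  finally show ?thesis by simp
qed

lemma synthesis_band_atom:
  "synthesis (band_atom n t) z = exp (2 * pi * \<i> * of_int n * (z - of_real t)) * normalized_sinc (z - of_real t)"
proof -
  let ?e = "\<lambda>\<xi> w. exp (2 * pi * \<i> * of_real \<xi> * w)"
  have "synthesis (band_atom n t) z = (LINT \<xi>|lborel. weight \<xi> *\<^sub>R (band_atom n t \<xi> * ?e \<xi> z))"
    unfolding synthesis_def by (rule integral_weight_measure) measurable
  also have "\<dots> = (LINT \<xi>|lborel. (\<lambda>\<xi>. ?e (of_int n) (z - of_real t) *
      (indicat_real {-1/2..<1/2::real} \<xi> *\<^sub>R ?e \<xi> (z - of_real t))) (\<xi> - of_int n))"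
  proof (intro Bochner_Integration.integral_cong refl)
    fix \<xi> :: real
    let ?I = "indicat_real {-1/2..<1/2::real} (\<xi> - of_int n)"
    have "weight \<xi> *\<^sub>R (band_atom n t \<xi> * ?e \<xi> z) =
        (weight \<xi> * (?I * fact (nat \<bar>n\<bar>))) *\<^sub>R (exp (- (2 * pi * \<i> * of_real \<xi> * of_real t)) * ?e \<xi> z)"
      by (simp add: band_atom_def mult.assoc)
    also have "exp (- (2 * pi * \<i> * of_real \<xi> * of_real t)) * ?e \<xi> z = ?e \<xi> (z - of_real t)"
      by (simp add: algebra_simps flip: exp_add)
    also have "\<dots> = ?e (of_int n) (z - of_real t) * ?e (\<xi> - of_int n) (z - of_real t)"
      by (simp add: algebra_simps flip: exp_add)
    finally show "weight \<xi> *\<^sub>R (band_atom n t \<xi> * ?e \<xi> z) = (\<lambda>\<xi>. ?e (of_int n) (z - of_real t) *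
        (indicat_real {-1/2..<1/2::real} \<xi> *\<^sub>R ?e \<xi> (z - of_real t))) (\<xi> - of_int n)"
      unfolding weight_on_band by simp
  qed
  also have "\<dots> = ?e (of_int n) (z - of_real t) * normalized_sinc (z - of_real t)"
    by (subst lborel_integral_translate) (simp only: integral_mult_right_zero normalized_sinc_def)
  finally show ?thesis by simp
qed

lemma normalized_sinc_0: "normalized_sinc 0 = 1"
  by (simp add: normalized_sinc_def)

lemma normalized_sinc_of_int:
  assumes "k \<noteq> 0" shows "normalized_sinc (of_int k) = 0"
proof -
  let ?f = "\<lambda>\<xi>. exp (2 * pi * \<i> * of_real \<xi> * of_int k)"
  let ?F = "\<lambda>\<xi>. exp (2 * pi * \<i> * of_real \<xi> * of_int k) / (2 * pi * \<i> * of_int k)"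
  have "normalized_sinc (of_int k) = (LINT \<xi>|lborel. indicat_real {-1/2..1/2} \<xi> *\<^sub>R ?f \<xi>)"
    unfolding normalized_sinc_def
  proof (rule integral_cong_AE)
    have "AE \<xi> in lborel. \<xi> \<noteq> (1/2 :: real)" by (rule AE_lborel_singleton)
    then show "AE \<xi> in lborel. indicat_real {-1/2..<1/2::real} \<xi> *\<^sub>R ?f \<xi> = indicat_real {-1/2..1/2} \<xi> *\<^sub>R ?f \<xi>"
      by eventually_elim (auto simp: indicator_def)
  qed measurable
  also have "\<dots> = ?F (1/2) - ?F (-1/2)"
  proof (rule integral_FTC_Icc)
    show "(?F has_vector_derivative ?f \<xi>) (at \<xi> within {-1/2..1/2})" for \<xi>
    proof -
      have "((\<lambda>z. exp (2 * pi * \<i> * z * of_int k) / (2 * pi * \<i> * of_int k)) has_field_derivative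
          exp (2 * pi * \<i> * of_real \<xi> * of_int k)) (at (of_real \<xi>))"
        using assms by (auto intro!: derivative_eq_intros)
      then show ?thesis
        using has_field_derivative_at_within has_vector_derivative_real_field by blast
    qed
    show "continuous_on {-1/2..1/2} ?f" by (intro continuous_intros)
  qed simp
  also have "\<dots> = (exp (pi * \<i> * of_int k) - exp (- (pi * \<i> * of_int k))) / (2 * pi * \<i> * of_int k)"
    by (simp add: diff_divide_distrib)
  also have "exp (pi * \<i> * of_int k) = exp (- (pi * \<i> * of_int k))"
    by (subst exp_eq) (auto intro!: exI[of _ k])
  finally show ?thesis by simp
qed

text \<open>The integrand is positive, and at least 1 on one half of the band.\<close>

lemma norm_normalized_sinc_imaginary_ge: "1/2 \<le> cmod (normalized_sinc (\<i> * of_real y))"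
proof -
  let ?g = "\<lambda>\<xi>. indicat_real {-1/2..<1/2::real} \<xi> * exp (- (2 * pi * \<xi> * y))"
  let ?J = "if y \<ge> 0 then {-1/2..<0} else {0..<1/2::real}"
  have "normalized_sinc (\<i> * of_real y) = (LINT \<xi>|lborel. complex_of_real (?g \<xi>))"
    unfolding normalized_sinc_def
  proof (intro Bochner_Integration.integral_cong refl)
    fix \<xi> :: real
    have "2 * pi * \<i> * complex_of_real \<xi> * (\<i> * of_real y) = of_real (- (2 * pi * \<xi> * y))"
      by (simp add: algebra_simps)
    then show "indicat_real {-1/2..<1/2::real} \<xi> *\<^sub>R exp (2 * pi * \<i> * complex_of_real \<xi> * (\<i> * of_real y)) =
        complex_of_real (?g \<xi>)"
      by (simp only: exp_of_real scaleR_conv_of_real of_real_mult)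
  qed
  also have "\<dots> = of_real (LINT \<xi>|lborel. ?g \<xi>)" by (rule integral_complex_of_real)
  finally have eq: "normalized_sinc (\<i> * of_real y) = of_real (LINT \<xi>|lborel. ?g \<xi>)" .
  have "(LINT \<xi>|lborel. indicat_real ?J \<xi>) = 1/2" by simp
  moreover have "(LINT \<xi>|lborel. indicat_real ?J \<xi>) \<le> (LINT \<xi>|lborel. ?g \<xi>)"
  proof (rule integral_mono)
    show "integrable lborel (indicat_real ?J)" by (simp add: integrable_indicator_Ico)
    show "integrable lborel ?g"
    proof (rule Bochner_Integration.integrable_bound)
      show "integrable lborel (\<lambda>\<xi>. exp (pi * \<bar>y\<bar>) * indicat_real {-1/2..<1/2::real} \<xi>)"
        by (rule integrable_mult_right[OF integrable_indicator_Ico])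
      have "?g \<xi> \<le> exp (pi * \<bar>y\<bar>) * indicat_real {-1/2..<1/2::real} \<xi>" for \<xi>
      proof (cases "\<xi> \<in> {-1/2..<1/2::real}")
        case True
        have "- (2 * pi * \<xi> * y) \<le> \<bar>2 * pi * \<xi> * y\<bar>" by simp
        also have "\<dots> = 2 * pi * (\<bar>\<xi>\<bar> * \<bar>y\<bar>)" by (simp add: abs_mult)
        also have "\<dots> \<le> 2 * pi * (1/2 * \<bar>y\<bar>)"
          using True by (intro mult_left_mono mult_right_mono) auto
        finally show ?thesis using True by simp
      qed simp
      then show "AE \<xi> in lborel. norm (?g \<xi>) \<le> norm (exp (pi * \<bar>y\<bar>) * indicat_real {-1/2..<1/2::real} \<xi>)"
        by (simp add: abs_mult)
    qed simp
    show "indicat_real ?J \<xi> \<le> ?g \<xi>" for \<xi>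
      by (auto simp: indicator_def mult_nonpos_nonneg mult_nonneg_nonpos)
  qed
  ultimately show ?thesis unfolding eq by simp
qed

section \<open>Entire functions\<close>

text \<open>The order of vanishing of \<open>S n\<close> at a fixed point is an arithmetic progression in the integer \<open>n\<close>.
  It is never negative, so it is constant, and the quotient of consecutive terms has neither zeros nor poles.\<close>

lemma entire_quotient_of_geometric_sequence:
  fixes S :: "int \<Rightarrow> complex \<Rightarrow> complex"
  assumes hol: "\<And>n. S n holomorphic_on UNIV" and nz: "\<And>n. \<exists>z. S n z \<noteq> 0"
    and geometric: "\<And>n z. S (n + 1) z * S (n - 1) z = (S n z)\<^sup>2"
  obtains g where "g holomorphic_on UNIV" "\<And>z. g z \<noteq> 0" "\<And>z. S 1 z = g z * S 0 z"
proof -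
  have ana: "S n analytic_on {z}" for n z
    using hol analytic_on_open[of UNIV] analytic_on_subset by blast
  have mero: "S n meromorphic_on {z}" for n z
    by (rule analytic_on_imp_meromorphic_on[OF ana])
  have ev: "\<forall>\<^sub>F w in at z. S n w \<noteq> 0" for n z
  proof -
    obtain \<beta> where "S n \<beta> \<noteq> 0" using nz by blast
    from non_zero_neighbour_alt[OF hol open_UNIV connected_UNIV UNIV_I UNIV_I this, of z]
    show ?thesis by eventually_elim simp
  qed
  have fr: "\<exists>\<^sub>F w in at z. S n w \<noteq> 0" for n z using ev[of n z] by (simp add: eventually_frequently)
  have order_eq: "zorder (S n) z = zorder (S 0) z" for n z
  proof -
    define a where "a n = zorder (S n) z" for n
    have a_nonneg: "0 \<le> a n" for n unfolding a_def by (rule zorder_ge_0[OF ana fr])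
    have rec: "a (n + 1) + a (n - 1) = 2 * a n" for n
    proof -
      have "a (n + 1) + a (n - 1) = zorder (\<lambda>w. S (n + 1) w * S (n - 1) w) z"
        unfolding a_def by (rule zorder_mult[OF mero fr mero fr, symmetric])
      also have "\<dots> = zorder (\<lambda>w. S n w ^ 2) z" by (simp add: geometric)
      also have "\<dots> = 2 * a n" unfolding a_def by (simp add: zorder_power[OF mero fr])
      finally show ?thesis .
    qed
    define d where "d = a 1 - a 0"
    have up: "a (int m) = a 0 + int m * d \<and> a (int (Suc m)) = a 0 + int (Suc m) * d" for m
    proof (induction m)
      case (Suc m)
      then show ?case using rec[of "int (Suc m)"] by (simp add: algebra_simps)
    qed (simp add: d_def)
    have down: "a (- int m) = a 0 - int m * d \<and> a (1 - int m) = a 0 + (1 - int m) * d" for m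
    proof (induction m)
      case (Suc m)
      have "a (- int (Suc m)) = 2 * a (- int m) - a (1 - int m)"
      proof -
        have *: "- int (Suc m) = - int m - 1" "1 - int m = - int m + 1" by auto
        show ?thesis unfolding * using rec[of "- int m"] by linarith
      qed
      then show ?case using Suc by (simp add: algebra_simps)
    qed (simp add: d_def)
    \<comment> \<open>An arithmetic progression indexed by all integers is nonnegative only if it is constant.\<close>
    have "d = 0"
    proof (rule ccontr)
      assume "d \<noteq> 0"
      define K where "K = (a 0 + 1) * d"
      from \<open>d \<noteq> 0\<close> consider "d \<ge> 1" | "d \<le> -1" by linarith
      then show False
      proof cases
        case 1
        have "a 0 + 1 \<le> K"
          using mult_left_mono[of 1 d "a 0 + 1"] 1 a_nonneg[of 0] by (simp add: K_def)
        moreover have "\<exists>j. a j = a 0 - K"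
          unfolding K_def using down[of "nat (a 0 + 1)"] a_nonneg[of 0]
          by (intro exI[of _ "- int (nat (a 0 + 1))"]) simp
        then obtain j where "a j = a 0 - K" ..
        ultimately show ?thesis using a_nonneg[of j] by linarith
      next
        case 2
        have "K \<le> - a 0 - 1"
          using mult_left_mono[of d "-1" "a 0 + 1"] 2 a_nonneg[of 0] by (simp add: K_def)
        moreover have "\<exists>j. a j = a 0 + K"
          unfolding K_def using up[of "nat (a 0 + 1)"] a_nonneg[of 0]
          by (intro exI[of _ "int (nat (a 0 + 1))"]) simp
        then obtain j where "a j = a 0 + K" ..
        ultimately show ?thesis using a_nonneg[of j] by linarith
      qed
    qed
    then have "a n = a 0" using up[of "nat n"] down[of "nat (- n)"] by (cases "n \<ge> 0") auto
    then show ?thesis by (simp add: a_def)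
  qed
  define f where "f z = S 1 z / S 0 z" for z
  define g where "g = remove_sings f"
  have f_mero: "f meromorphic_on {z}" for z
    unfolding f_def[abs_def] by (intro meromorphic_on_divide mero)
  have f_ev: "\<forall>\<^sub>F w in at z. f w \<noteq> 0" for z
    using ev[of 1 z] ev[of 0 z] by eventually_elim (simp add: f_def)
  have f_sing: "isolated_singularity_at f z" "not_essential f z" for z
    using f_mero[of z] by (simp_all add: meromorphic_at_iff)
  have f_order: "zorder f z = 0" for z
    unfolding f_def[abs_def] zorder_divide[OF mero fr mero fr] order_eq[of 1 z] by simp
  have g_ana: "g analytic_on {z}" and g_nz: "g z \<noteq> 0" for z
  proof -
    have "\<not> is_pole f z" using isolated_pole_imp_neg_zorder[OF f_sing(1)] f_order[of z] by fastforce
    then obtain c where "f \<midarrow>z\<rightarrow> c" using f_sing(2)[of z] by (auto simp: not_essential_def)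
    then show ana_g: "g analytic_on {z}" unfolding g_def by (rule remove_sings_analytic_at[OF f_sing(1)])
    have "\<forall>\<^sub>F w in at z. g w \<noteq> 0"
      using eventually_remove_sings_eq_at[OF f_sing(1)[of z]] f_ev[of z] unfolding g_def
      by eventually_elim simp
    then have "\<exists>\<^sub>F w in at z. g w \<noteq> 0" by (simp add: eventually_frequently)
    then show "g z \<noteq> 0"
      using zorder_eq_0_iff[OF ana_g] f_order[of z] zorder_remove_sings[OF f_sing(1)[of z]] by (simp add: g_def)
  qed
  have "S 1 z = g z * S 0 z" for z
  proof (cases "S 0 z = 0")
    case True
    have "zorder (S 1) z > 0" using zorder_pos_iff'[OF ana fr, of 0 z] True order_eq[of 1 z] by simp
    then show ?thesis using zorder_pos_iff'[OF ana fr, of 1 z] True by simp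
  next
    case False
    have "f analytic_on {z}" unfolding f_def[abs_def] by (intro analytic_on_divide ana) (use False in auto)
    then have "g z = f z" unfolding g_def by simp
    then show ?thesis using False by (simp add: f_def)
  qed
  moreover have "g holomorphic_on UNIV"
    using g_ana by (meson analytic_imp_holomorphic analytic_on_analytic_at UNIV_I)
  ultimately show ?thesis using g_nz that by blast
qed

text \<open>Cauchy's inequality for \<open>exp (\<i> c F)\<close>, whose modulus depends on the imaginary part of \<open>F\<close> alone,
  bounds \<open>deriv F z\<close>: on a circle of radius \<open>r = \<bar>z\<bar> + 1\<close> around \<open>z\<close> the imaginary part is at most \<open>M r\<close>,
  and \<open>c = 1 / (M r)\<close> makes the modulus lie between \<open>exp (- 1)\<close> and \<open>exp 1\<close>.\<close>

lemma entire_Im_linear_bound_imp_affine: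
  assumes hol: "F holomorphic_on UNIV" and Im: "\<And>z. \<bar>Im (F z)\<bar> \<le> C + D * cmod z" and "0 \<le> C" "0 \<le> D"
  obtains a b where "\<And>z. F z = a * z + b"
proof -
  have dF: "(F has_field_derivative deriv F z) (at z)" for z
    using holomorphic_derivI[OF hol open_UNIV UNIV_I] .
  define M where "M = C + 2 * D + 1"
  have M: "M > 0" using assms(3,4) by (simp add: M_def)
  have bound: "cmod (deriv F z) \<le> (exp 1)\<^sup>2 * M" for z
  proof -
    define r where "r = cmod z + 1"
    define c where "c = 1 / (M * r)"
    have r: "r \<ge> 1" by (simp add: r_def)
    have c: "c > 0" using M r by (simp add: c_def)
    define E where "E w = exp (\<i> * of_real c * F w)" for w
    have dE: "(E has_field_derivative (\<i> * of_real c * deriv F w * E w)) (at w)" for w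
      unfolding E_def[abs_def] by (auto intro!: derivative_eq_intros dF)
    have E_hol: "E holomorphic_on UNIV" using dE by (auto simp: holomorphic_on_open intro!: exI)
    have norm_E: "cmod (E w) = exp (- (c * Im (F w)))" for w
      by (simp add: E_def norm_exp_eq_Re)
    have Im_small: "c * \<bar>Im (F w)\<bar> \<le> 1" if "cmod (z - w) \<le> r" for w
    proof -
      have "cmod w \<le> cmod z + r" using that norm_triangle_sub[of w z] by (simp add: norm_minus_commute)
      then have "cmod w \<le> 2 * r" by (simp add: r_def)
      then have "\<bar>Im (F w)\<bar> \<le> C + D * (2 * r)"
        using Im[of w] mult_left_mono[OF _ assms(4), of "cmod w" "2 * r"] by linarith
      also have "\<dots> \<le> M * r"
        using mult_left_mono[OF r assms(3)] r by (simp add: M_def algebra_simps)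
      finally show ?thesis using M r by (simp add: c_def field_simps)
    qed
    have E_le: "cmod (E w) \<le> exp 1" if "cmod (z - w) \<le> r" for w
    proof -
      have "- (c * Im (F w)) \<le> c * \<bar>Im (F w)\<bar>" using c mult_left_mono[of "- Im (F w)" "\<bar>Im (F w)\<bar>" c] by simp
      then show ?thesis using Im_small[OF that] by (simp add: norm_E)
    qed
    have "cmod ((deriv ^^ 1) E z) \<le> fact 1 * exp 1 / r ^ 1"
      by (rule Cauchy_inequality) (use E_hol holomorphic_on_subset holomorphic_on_imp_continuous_on r E_le in force)+
    then have "cmod (\<i> * of_real c * deriv F z * E z) \<le> exp 1 / r" using DERIV_imp_deriv[OF dE] by simp
    then have le: "c * cmod (deriv F z) * cmod (E z) \<le> exp 1 / r" using c by (simp add: norm_mult)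
    have "c * Im (F z) \<le> c * \<bar>Im (F z)\<bar>" using c by (intro mult_left_mono) auto
    also have "\<dots> \<le> 1" using Im_small[of z] r by simp
    finally have "c * Im (F z) \<le> 1" .
    then have "exp (- 1) \<le> cmod (E z)" by (simp add: norm_E)
    then have "c * cmod (deriv F z) * exp (- 1) \<le> exp 1 / r"
      using le c by (meson mult_left_mono mult_nonneg_nonneg less_imp_le norm_ge_zero order_trans)
    then have "c * cmod (deriv F z) * exp (- 1) * (M * r) * exp 1 \<le> exp 1 / r * (M * r) * exp 1"
      using M r by (intro mult_right_mono) auto
    moreover have "c * cmod (deriv F z) * exp (- 1) * (M * r) * exp 1 = cmod (deriv F z)"
      using M r by (simp add: c_def exp_minus)
    moreover have "exp 1 / r * (M * r) * exp 1 = (exp 1)\<^sup>2 * M" using r by (simp add: power2_eq_square)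
    ultimately show ?thesis by (simp only:)
  qed
  have "deriv F constant_on UNIV"
    using bound holomorphic_deriv[OF hol open_UNIV] by (intro Liouville_theorem) (auto simp: bounded_iff)
  then obtain a where a: "\<And>z. deriv F z = a" by (auto simp: constant_on_def)
  have "((\<lambda>z. F z - a * z) has_field_derivative 0) (at z within UNIV)" for z
    using dF[of z] by (auto intro!: derivative_eq_intros simp: a)
  then obtain b where "\<And>z. F z - a * z = b"
    using has_field_derivative_zero_constant[OF convex_UNIV] by (metis UNIV_I)
  then have "F z = a * z + b" for z by (metis add.commute diff_add_cancel)
  then show ?thesis using that by blast
qed

text \<open>The optimal choice of \<open>n\<close> is about \<open>exp c\<close>: then both \<open>fact n\<close> and the doubly exponential term are at
  most \<open>exp (n (c + 4))\<close>, and comparing exponents yields a bound on \<open>v\<close> that is linear in \<open>c\<close>.\<close>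

lemma growth_exponent_le:
  assumes BD: "0 \<le> B" "0 \<le> D" and c: "0 \<le> c"
    and le: "\<And>n::nat. exp (real n * v) \<le> B * fact n + exp ((c + 1) / 2 + exp (c + 1)) * D"
  shows "v \<le> c + 4 + ln (B + D + 1)"
proof -
  define n where "n = nat \<lceil>exp c\<rceil>"
  have n_ge: "exp c \<le> real n" unfolding n_def by linarith
  have "real n \<le> exp c + 1" unfolding n_def by (simp add: of_nat_nat)
  moreover have "exp c \<ge> 1" using c by simp
  ultimately have n_le: "real n \<le> exp c * 2" and n1: "real n \<ge> 1" using n_ge by linarith+
  have "ln (real n) \<le> ln (exp c * 2)" using n_le n1 by (intro ln_mono) auto
  also have "\<dots> = c + ln 2" by (simp add: ln_mult)
  finally have ln_n: "ln (real n) \<le> c + 1" using ln_2_less_1 by linarith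
  have "fact n \<le> real n ^ n" using fact_le_power[of n, where 'a = real] by simp
  also have "\<dots> = exp (real n * ln (real n))" using n1 by (simp add: exp_of_nat_mult)
  also have "\<dots> \<le> exp (real n * (c + 4))" using ln_n n1 by (intro exp_le_cancel_iff[THEN iffD2] mult_left_mono) auto
  finally have fact_n: "fact n \<le> exp (real n * (c + 4))" .
  have "exp (c + 1) = exp c * exp 1" by (rule exp_add)
  also have "\<dots> \<le> real n * 3" using n_ge exp_le by (intro mult_mono) auto
  finally have "exp (c + 1) \<le> real n * 3" .
  moreover have "1 * ((c + 1) / 2) \<le> real n * (c + 1)" using n1 c by (intro mult_mono) auto
  moreover have "real n * (c + 4) = real n * 3 + real n * (c + 1)" by (simp add: algebra_simps)
  ultimately have "(c + 1) / 2 + exp (c + 1) \<le> real n * (c + 4)" by linarith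
  then have "exp ((c + 1) / 2 + exp (c + 1)) * D \<le> exp (real n * (c + 4)) * D"
    using BD(2) by (intro mult_right_mono) auto
  then have "exp (real n * v) \<le> B * exp (real n * (c + 4)) + exp (real n * (c + 4)) * D"
    using le[of n] mult_left_mono[OF fact_n BD(1)] by linarith
  also have "\<dots> \<le> (B + D + 1) * exp (real n * (c + 4))" by (simp add: algebra_simps)
  also have "\<dots> = exp (ln (B + D + 1) + real n * (c + 4))" using BD by (simp add: exp_add)
  finally have "real n * v \<le> ln (B + D + 1) + real n * (c + 4)" by simp
  also have "\<dots> \<le> real n * ln (B + D + 1) + real n * (c + 4)"
    using mult_right_mono[OF n1, of "ln (B + D + 1)"] BD by simp
  finally have "real n * v \<le> real n * (c + 4 + ln (B + D + 1))" by (simp add: algebra_simps)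
  then show ?thesis using n1 by simp
qed

section \<open>Bounded composition operators\<close>

text \<open>Composition with \<open>f\<close> turns an atom into the restriction of an entire function \<open>S\<close>. The bound on \<open>S\<close>
  combines boundedness of the composition operator with the growth bound for transforms; its
  constant does not depend on \<open>n\<close> and \<open>t\<close>.\<close>

lemma pullback_band_atom:
  assumes U: "open U" "U \<noteq> {}"
    and comp: "\<And>h. h \<in> synthesis_on UNIV ` weight_L2 \<Longrightarrow> zero_outside U (h \<circ> f) \<in> synthesis_on U ` weight_L2"
  obtains B where "0 \<le> B" "\<And>n t. \<exists>S. S holomorphic_on UNIV \<and>
      (\<forall>x\<in>U. S (of_real x) = synthesis (band_atom n t) (of_real (f x))) \<and>
      (\<forall>z. cmod (S z) \<le> (B * fact (nat \<bar>n\<bar>) + (LINT \<xi>|weight_measure. exp (4 * pi * \<bar>Im z\<bar> * \<bar>\<xi>\<bar>))) / 2)"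
proof -
  obtain B where B: "B \<ge> 0" "\<And>h. h \<in> synthesis_on UNIV ` weight_L2 \<Longrightarrow>
      ip_norm (synthesis_inner U) (zero_outside U (h \<circ> f)) \<le> B * ip_norm (synthesis_inner UNIV) h"
    using composition_bounded[OF is_rkhs_weight_kernel[OF open_UNIV UNIV_not_empty] is_rkhs_weight_kernel[OF U] UNIV_I comp]
    by blast
  have "\<exists>S. S holomorphic_on UNIV \<and> (\<forall>x\<in>U. S (of_real x) = synthesis (band_atom n t) (of_real (f x))) \<and>
      (\<forall>z. cmod (S z) \<le> (B\<^sup>2 * fact (nat \<bar>n\<bar>) + (LINT \<xi>|weight_measure. exp (4 * pi * \<bar>Im z\<bar> * \<bar>\<xi>\<bar>))) / 2)" for n t
  proof -
    define h where "h = synthesis_on UNIV (band_atom n t)"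
    have h: "h \<in> synthesis_on UNIV ` weight_L2" unfolding h_def by (rule imageI[OF band_atom_L2])
    obtain \<psi> where \<psi>: "\<psi> \<in> weight_L2" "zero_outside U (h \<circ> f) = synthesis_on U \<psi>"
      using comp[OF h] by blast
    have "synthesis \<psi> (of_real x) = synthesis (band_atom n t) (of_real (f x))" if "x \<in> U" for x
      using fun_cong[OF \<psi>(2), of x] that by (simp add: h_def synthesis_on_def zero_outside_def)
    moreover have "(LINT \<xi>|weight_measure. (cmod (\<psi> \<xi>))\<^sup>2) \<le> B\<^sup>2 * fact (nat \<bar>n\<bar>)"
    proof -
      have "sqrt (LINT \<xi>|weight_measure. (cmod (\<psi> \<xi>))\<^sup>2) \<le> B * sqrt (fact (nat \<bar>n\<bar>))"
        using B(2)[OF h] unfolding \<psi>(2) synthesis_norm_eq[OF U \<psi>(1)]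
        unfolding h_def synthesis_norm_eq[OF open_UNIV UNIV_not_empty band_atom_L2] band_atom_norm_square .
      also have "\<dots> = sqrt (B\<^sup>2 * fact (nat \<bar>n\<bar>))" using B(1) by (simp add: real_sqrt_mult)
      finally show ?thesis by (simp only: real_sqrt_le_iff)
    qed
    then have "cmod (synthesis \<psi> z) \<le>
        (B\<^sup>2 * fact (nat \<bar>n\<bar>) + (LINT \<xi>|weight_measure. exp (4 * pi * \<bar>Im z\<bar> * \<bar>\<xi>\<bar>))) / 2" for z
      using norm_synthesis_le[OF \<psi>(1), of z] by (simp add: field_simps)
    ultimately show ?thesis using holomorphic_synthesis[OF \<psi>(1)] by blast
  qed
  then show ?thesis using that[of "B\<^sup>2"] by simp
qed

text \<open>If \<open>t\<close> is a value of \<open>f\<close>, the functions \<open>S n t\<close> form a geometric sequence in \<open>n\<close> whose ratio is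
  \<open>exp (2 pi \<i> (f - t))\<close> on \<open>U\<close>. This ratio extends to an entire function without zeros, and its
  logarithm yields an entire function \<open>F0\<close> that differs from \<open>f\<close> by integers near a point of \<open>U\<close>. No
  continuity of \<open>f\<close> is known, so these integers may vary a priori; but one of them occurs uncountably often,
  and this suffices to identify all the entire functions \<open>S n s\<close>.\<close>

lemma symbol_entire_extension:
  fixes U :: "real set" and f :: "real \<Rightarrow> real"
  assumes U: "open U" "U \<noteq> {}"
    and S_hol: "\<And>n t. S n t holomorphic_on UNIV"
    and S_eq: "\<And>n t x. x \<in> U \<Longrightarrow> S n t (of_real x) = synthesis (band_atom n t) (of_real (f x))"
  obtains F where "F holomorphic_on UNIV" "\<And>n t z. S n t z = synthesis (band_atom n t) (F z)"
proof -
  obtain x0 where x0: "x0 \<in> U" using U(2) by blast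
  define t where "t = f x0"
  define e where "e x = exp (2 * pi * \<i> * (of_real (f x) - of_real t))" for x
  have S_t: "S n t (of_real x) = exp (2 * pi * \<i> * of_int n * (of_real (f x) - of_real t)) *
      normalized_sinc (of_real (f x) - of_real t)" if "x \<in> U" for n x
    by (simp only: S_eq[OF that] synthesis_band_atom)
  have S_x0: "S n t (of_real x0) = 1" for n unfolding S_t[OF x0] by (simp add: t_def normalized_sinc_0)
  have geometric: "S (n + 1) t z * S (n - 1) t z = (S n t z)\<^sup>2" for n z
  proof (rule entire_eq_if_eq_on_real[where f = "\<lambda>z. S (n + 1) t z * S (n - 1) t z" and g = "\<lambda>z. (S n t z)\<^sup>2",
        OF _ _ U])
    fix x assume x: "x \<in> U"
    show "S (n + 1) t (of_real x) * S (n - 1) t (of_real x) = (S n t (of_real x))\<^sup>2"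
    proof -
      define w where "w = complex_of_real (f x) - of_real t"
      have "2 * pi * \<i> * of_int (n + 1) * w + 2 * pi * \<i> * of_int (n - 1) * w =
          2 * pi * \<i> * of_int n * w + 2 * pi * \<i> * of_int n * w"
        by (simp add: algebra_simps)
      then have *: "exp (2 * pi * \<i> * of_int (n + 1) * w) * exp (2 * pi * \<i> * of_int (n - 1) * w) =
          exp (2 * pi * \<i> * of_int n * w) * exp (2 * pi * \<i> * of_int n * w)"
        by (simp only: exp_add[symmetric])
      have swap: "(a * s) * (b * s) = (c * s) * (c * s)" if "a * b = c * c" for a b c s :: complex
      proof -
        have "(a * s) * (b * s) = (a * b) * (s * s)" by (simp only: mult_ac)
        also have "\<dots> = (c * s) * (c * s)" unfolding that by (simp only: mult_ac)
        finally show ?thesis .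
      qed
      show ?thesis unfolding S_t[OF x] w_def[symmetric] power2_eq_square by (rule swap[OF *])
    qed
  qed (auto intro!: holomorphic_intros S_hol)
  have nz: "\<exists>z. S n t z \<noteq> 0" for n using S_x0[of n] by (intro exI[of _ "of_real x0"]) simp
  obtain g where g: "g holomorphic_on UNIV" "\<And>z. g z \<noteq> 0" "\<And>z. S 1 t z = g z * S 0 t z"
    by (rule entire_quotient_of_geometric_sequence[of "\<lambda>n. S n t", OF S_hol nz geometric]) (rule that)
  obtain G where G: "G holomorphic_on UNIV" "\<And>z. z \<in> UNIV \<Longrightarrow> g z = exp (G z)"
    by (rule contractible_imp_holomorphic_log[OF g(1) contractible_UNIV g(2)]) (rule that)
  define F0 where "F0 z = G z / (2 * pi * \<i>) + of_real t" for z
  have F0_hol: "F0 holomorphic_on UNIV" unfolding F0_def by (intro holomorphic_intros G) auto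
  \<comment> \<open>Near \<open>x0\<close> the function \<open>S 0 t\<close> does not vanish, so \<open>F0\<close> and \<open>f\<close> differ by an integer there.\<close>
  have "continuous_on UNIV (\<lambda>x::real. S 0 t (of_real x))"
    by (intro continuous_on_compose2[OF holomorphic_on_imp_continuous_on[OF S_hol[of 0 t]]] continuous_intros) auto
  then have "open ((\<lambda>x::real. S 0 t (of_real x)) -` (- {0}))" by (intro open_vimage) auto
  then have "open (U \<inter> (\<lambda>x::real. S 0 t (of_real x)) -` (- {0}))" using U(1) by blast
  moreover have "x0 \<in> U \<inter> (\<lambda>x::real. S 0 t (of_real x)) -` (- {0})" using x0 S_x0 by simp
  ultimately obtain d where d: "d > 0" "ball x0 d \<subseteq> U \<inter> (\<lambda>x::real. S 0 t (of_real x)) -` (- {0})"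
    using open_contains_ball by blast
  define J where "J k = {x \<in> ball x0 d. F0 (of_real x) = of_real (f x) + of_int k}" for k :: int
  have "ball x0 d \<subseteq> (\<Union>k. J k)"
  proof
    fix x assume x: "x \<in> ball x0 d"
    then have xU: "x \<in> U" and nz: "S 0 t (of_real x) \<noteq> 0" using d(2) by auto
    have "exp (G (of_real x)) * normalized_sinc (of_real (f x) - of_real t) = S 1 t (of_real x)"
      using g(3)[of "of_real x"] S_t[OF xU, of 0] by (simp add: G(2))
    also have "\<dots> = exp (2 * pi * \<i> * (of_real (f x) - of_real t)) * normalized_sinc (of_real (f x) - of_real t)"
      using S_t[OF xU, of 1] by simp
    finally have "exp (G (of_real x)) * normalized_sinc (of_real (f x) - of_real t) =
        exp (2 * pi * \<i> * (of_real (f x) - of_real t)) * normalized_sinc (of_real (f x) - of_real t)" .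
    moreover have "normalized_sinc (of_real (f x) - of_real t) \<noteq> 0" using nz S_t[OF xU, of 0] by simp
    ultimately have "exp (G (of_real x)) = exp (2 * pi * \<i> * (of_real (f x) - of_real t))" by simp
    then obtain k where "G (of_real x) = 2 * pi * \<i> * (of_real (f x) - of_real t) + of_int (2 * k) * pi * \<i>"
      unfolding exp_eq by (auto simp: mult.commute)
    then have "F0 (of_real x) = of_real (f x) + of_int k" by (simp add: F0_def field_simps)
    then show "x \<in> (\<Union>k. J k)" using x by (auto simp: J_def)
  qed
  then obtain k where k: "uncountable (J k)"
    using uncountable_ball[OF d(1), of x0] countable_subset by (metis countable_UN uncountable_def countableI_type)
  define F where "F z = F0 z - of_int k" for z
  have F_hol: "F holomorphic_on UNIV" unfolding F_def by (intro holomorphic_intros F0_hol)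
  have "S n s z = synthesis (band_atom n s) (F z)" for n s z
  proof (rule entire_eq_if_eq_on_uncountable[OF S_hol])
    show "(\<lambda>z. synthesis (band_atom n s) (F z)) holomorphic_on UNIV"
      using holomorphic_on_compose[OF F_hol holomorphic_on_subset[OF holomorphic_synthesis[OF band_atom_L2]]]
      by (simp add: o_def)
    have "inj_on complex_of_real (J k)" by (auto intro: inj_onI)
    then show "uncountable (complex_of_real ` J k)" using k countable_image_inj_eq by blast
    show "S n s z = synthesis (band_atom n s) (F z)" if "z \<in> complex_of_real ` J k" for z
    proof -
      from that obtain x where x: "z = of_real x" "x \<in> J k" by blast
      then have "x \<in> U" "F z = of_real (f x)" using d(2) by (auto simp: J_def F_def)
      then show ?thesis using S_eq x(1) by simp
    qed
  qed
  then show ?thesis using that F_hol by blast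
qed

text \<open>The entire extension \<open>F\<close> of the symbol satisfies \<open>exp (2 pi m \<bar>Im (F z)\<bar>) \<le> B m! + K (Im z)\<close> for
  all \<open>m\<close>, where \<open>K\<close> is doubly exponential. Hence the imaginary part of \<open>F\<close> has linear growth
  and \<open>F\<close> is affine.\<close>

theorem bounded_composition_imp_affine:
  fixes U :: "real set" and f :: "real \<Rightarrow> real"
  assumes U: "open U" "U \<noteq> {}"
    and comp: "\<And>h. h \<in> synthesis_on UNIV ` weight_L2 \<Longrightarrow> zero_outside U (h \<circ> f) \<in> synthesis_on U ` weight_L2"
  shows "\<exists>a b. \<forall>x\<in>U. f x = a * x + b"
proof -
  define K where "K y = (LINT \<xi>|weight_measure. exp (4 * pi * \<bar>y\<bar> * \<bar>\<xi>\<bar>))" for y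
  define D where "D = (LINT x|lborel. exp (- \<bar>x::real\<bar>))"
  have D: "D \<ge> 0" unfolding D_def by (rule Bochner_Integration.integral_nonneg) simp
  obtain B where B: "0 \<le> B" and ex: "\<And>n t. \<exists>S. S holomorphic_on UNIV \<and>
      (\<forall>x\<in>U. S (of_real x) = synthesis (band_atom n t) (of_real (f x))) \<and>
      (\<forall>z. cmod (S z) \<le> (B * fact (nat \<bar>n\<bar>) + K (Im z)) / 2)"
    using pullback_band_atom[OF U comp] unfolding K_def by blast
  define S where "S n t = (SOME S. S holomorphic_on UNIV \<and>
      (\<forall>x\<in>U. S (of_real x) = synthesis (band_atom n t) (of_real (f x))) \<and>
      (\<forall>z. cmod (S z) \<le> (B * fact (nat \<bar>n\<bar>) + K (Im z)) / 2))" for n t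
  have S_hol: "S n t holomorphic_on UNIV"
    and S_eq: "x \<in> U \<Longrightarrow> S n t (of_real x) = synthesis (band_atom n t) (of_real (f x))"
    and S_le: "cmod (S n t z) \<le> (B * fact (nat \<bar>n\<bar>) + K (Im z)) / 2" for n t x z
    using someI_ex[OF ex[of n t]] unfolding S_def[symmetric] by blast+
  obtain F where F: "F holomorphic_on UNIV" "\<And>n t z. S n t z = synthesis (band_atom n t) (F z)"
    using symbol_entire_extension[OF U, of S f] S_hol S_eq by blast
  define L where "L = ln (B + D + 1)"
  have L: "L \<ge> 0" using B D by (simp add: L_def)
  have growth: "2 * pi * \<bar>Im (F z)\<bar> \<le> 4 * pi * \<bar>Im z\<bar> + 4 + L" for z
    unfolding L_def
  proof (rule growth_exponent_le[OF B D])
    fix m :: nat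
    \<comment> \<open>The centre \<open>t\<close> of the atom cancels the real part of \<open>F z\<close>, so that the sinc factor is evaluated
      on the imaginary axis, and the sign of \<open>n\<close> is chosen such that the exponential factor is large.\<close>
    define n where "n = (if Im (F z) \<ge> 0 then - int m else int m)"
    define t where "t = Re (F z)"
    define y where "y = Im (F z)"
    have w: "F z - complex_of_real t = \<i> * complex_of_real y" 
      using complex_eq[of "F z"] unfolding t_def y_def by (simp add: algebra_simps)
    have "complex_of_real (2 * pi) * \<i> * complex_of_int n * (\<i> * complex_of_real y) =
        complex_of_real (real m * (2 * pi * \<bar>y\<bar>))"
    proof -
      have "complex_of_real (2 * pi) * \<i> * complex_of_int n * (\<i> * complex_of_real y) =
          complex_of_real (2 * pi * (- of_int n * y))"
        by (simp add: mult_ac)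
      also have "- of_int n * y = real m * \<bar>y\<bar>" unfolding n_def y_def by (auto simp: abs_if)
      also have "2 * pi * (real m * \<bar>y\<bar>) = real m * (2 * pi * \<bar>y\<bar>)" by simp
      finally show ?thesis .
    qed
    then have "cmod (S n t z) = exp (real m * (2 * pi * \<bar>y\<bar>)) * cmod (normalized_sinc (\<i> * complex_of_real y))"
      unfolding F(2) synthesis_band_atom w norm_mult by (simp only: exp_of_real norm_of_real abs_exp_cancel)
    also have "\<dots> \<ge> exp (real m * (2 * pi * \<bar>y\<bar>)) * (1/2)"
      by (intro mult_left_mono norm_normalized_sinc_imaginary_ge) simp
    finally have "exp (real m * (2 * pi * \<bar>y\<bar>)) \<le> B * fact (nat \<bar>n\<bar>) + K (Im z)"
      using S_le[of n t z] by simp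
    also have "nat \<bar>n\<bar> = m" by (simp add: n_def)
    also have "K (Im z) \<le> exp ((4 * pi * \<bar>Im z\<bar> + 1) / 2 + exp (4 * pi * \<bar>Im z\<bar> + 1)) * D"
      unfolding K_def D_def by (rule integral_exp_weight_measure_le) simp
    finally show "exp (real m * (2 * pi * \<bar>Im (F z)\<bar>)) \<le>
        B * fact m + exp ((4 * pi * \<bar>Im z\<bar> + 1) / 2 + exp (4 * pi * \<bar>Im z\<bar> + 1)) * D" by (simp add: y_def)
  qed simp
  have "\<bar>Im (F z)\<bar> \<le> (4 + L) + 2 * cmod z" for z
  proof -
    have "2 * pi * \<bar>Im (F z)\<bar> \<le> 2 * pi * (2 * \<bar>Im z\<bar>) + (4 + L)" using growth[of z] by simp
    also have "4 + L \<le> 2 * pi * (4 + L)"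
    proof -
      have "1 * (4 + L) \<le> 2 * pi * (4 + L)" using L pi_ge_two by (intro mult_right_mono) auto
      then show ?thesis by simp
    qed
    finally have "2 * pi * \<bar>Im (F z)\<bar> \<le> 2 * pi * (2 * \<bar>Im z\<bar> + (4 + L))" by (simp only: distrib_left)
    then have "\<bar>Im (F z)\<bar> \<le> 2 * \<bar>Im z\<bar> + (4 + L)"
      by (rule mult_left_le_imp_le) simp
    then show ?thesis using abs_Im_le_cmod[of z] by linarith
  qed
  then obtain a b where ab: "\<And>z. F z = a * z + b"
    using entire_Im_linear_bound_imp_affine[OF F(1), of "4 + L" 2] L by auto
  have f_eq: "of_real (f x) = F (of_real x)" if x: "x \<in> U" for x
  proof -
    define w where "w = F (of_real x) - of_real (f x)"
    \<comment> \<open>The atoms centred at \<open>f x\<close> take the value 1 there, and nowhere else do all of them take it.\<close>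
    have one: "exp (2 * pi * \<i> * of_int n * w) * normalized_sinc w = 1" for n
    proof -
      have "synthesis (band_atom n (f x)) (F (of_real x)) = synthesis (band_atom n (f x)) (of_real (f x))"
        using S_eq[OF x, of n "f x"] F(2)[of n "f x" "of_real x"] by simp
      then show ?thesis by (simp add: synthesis_band_atom w_def normalized_sinc_0)
    qed
    have sinc: "normalized_sinc w = 1" using one[of 0] by simp
    then have "exp (2 * pi * \<i> * w) = 1" using one[of 1] by simp
    then obtain k :: int where "2 * pi * \<i> * w = of_int (2 * k) * pi * \<i>"
      unfolding exp_eq_1 by (auto simp: complex_eq_iff)
    then have "w = of_int k" by simp
    moreover from this have "k = 0" using normalized_sinc_of_int[of k] sinc by auto
    ultimately show ?thesis by (simp add: w_def)
  qed
  then have "f x = Re a * x + Re b" if "x \<in> U" for x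
  proof -
    have "complex_of_real (f x) = a * of_real x + b" unfolding f_eq[OF that] by (rule ab)
    then have "Re (complex_of_real (f x)) = Re (a * of_real x + b)" by (rule arg_cong)
    then show ?thesis by simp
  qed
  then show ?thesis by blast
qed

section \<open>An element of infinite order\<close>

text \<open>Only half of the \<open>n\<close>-th band is used. This suffices because \<open>n\<close> is free, and for \<open>n\<close> about \<open>exp r\<close>
  the bound exceeds \<open>exp (exp r)\<close>.\<close>

lemma synthesis_one_ge:
  assumes "0 \<le> r"
  shows "exp (2 * pi * r * real n) / (2 * fact n) \<le> cmod (synthesis (\<lambda>_. 1) (- (\<i> * of_real r)))"
proof -
  let ?J = "{real n ..< real n + 1/2}"
  have int: "integrable weight_measure (\<lambda>\<xi>. exp (2 * pi * \<xi> * r))"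
  proof (rule Bochner_Integration.integrable_bound[OF integrable_exp_weight_measure[of "2 * pi * r"]])
    have "\<xi> * r \<le> r * \<bar>\<xi>\<bar>" for \<xi> using assms mult_left_mono[of \<xi> "\<bar>\<xi>\<bar>" r] by (simp add: mult.commute)
    then show "AE \<xi> in weight_measure. norm (exp (2 * pi * \<xi> * r)) \<le> norm (exp (2 * pi * r * \<bar>\<xi>\<bar>))"
      by (simp add: mult.assoc)
  qed (use assms in auto)
  then have int': "integrable lborel (\<lambda>\<xi>. weight \<xi> * exp (2 * pi * \<xi> * r))"
    by (subst (asm) integrable_weight_measure) simp_all
  have "synthesis (\<lambda>_. 1) (- (\<i> * of_real r)) = (LINT \<xi>|weight_measure. complex_of_real (exp (2 * pi * \<xi> * r)))"
    unfolding synthesis_def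
  proof (intro Bochner_Integration.integral_cong refl)
    fix \<xi> :: real
    have "2 * pi * \<i> * complex_of_real \<xi> * (- (\<i> * of_real r)) = of_real (2 * pi * \<xi> * r)"
      by (simp add: complex_eq_iff)
    then show "1 * exp (2 * pi * \<i> * complex_of_real \<xi> * (- (\<i> * of_real r))) = complex_of_real (exp (2 * pi * \<xi> * r))"
      by (simp only: exp_of_real mult_1)
  qed
  also have "\<dots> = of_real (LINT \<xi>|weight_measure. exp (2 * pi * \<xi> * r))" by (rule integral_complex_of_real)
  also have "(LINT \<xi>|weight_measure. exp (2 * pi * \<xi> * r)) = (LINT \<xi>|lborel. weight \<xi> * exp (2 * pi * \<xi> * r))"
    by (subst integral_weight_measure) simp_all
  finally have eq: "synthesis (\<lambda>_. 1) (- (\<i> * of_real r)) = of_real (LINT \<xi>|lborel. weight \<xi> * exp (2 * pi * \<xi> * r))" .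
  have "exp (2 * pi * r * real n) / (2 * fact n) = (LINT \<xi>|lborel. exp (2 * pi * r * real n) / fact n * indicat_real ?J \<xi>)"
    by simp
  also have "\<dots> \<le> (LINT \<xi>|lborel. weight \<xi> * exp (2 * pi * \<xi> * r))"
  proof (rule integral_mono[OF integrable_mult_right[OF integrable_indicator_Ico] int'])
    fix \<xi>
    show "exp (2 * pi * r * real n) / fact n * indicat_real ?J \<xi> \<le> weight \<xi> * exp (2 * pi * \<xi> * r)"
    proof (cases "\<xi> \<in> ?J")
      case True
      then have "\<lfloor>\<xi> + 1/2\<rfloor> = int n" by (intro floor_unique) auto
      then have "weight \<xi> = 1 / fact n" by (simp add: weight_eq)
      moreover have "real n * r \<le> \<xi> * r" using True assms by (intro mult_right_mono) auto
      ultimately show ?thesis using True by (simp add: mult.assoc mult.commute[of r] divide_right_mono)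
    qed (simp add: weight_pos less_imp_le)
  qed
  also have "\<dots> \<le> cmod (synthesis (\<lambda>_. 1) (- (\<i> * of_real r)))" unfolding eq by simp
  finally show ?thesis .
qed

lemma max_modulus_ge:
  assumes "F holomorphic_on UNIV" "cmod z = r"
  shows "cmod (F z) \<le> max_modulus F r"
  unfolding max_modulus_def
proof (rule cSUP_upper)
  have "compact ((\<lambda>z. cmod (F z)) ` sphere 0 r)"
    by (intro compact_continuous_image continuous_on_norm compact_sphere
        holomorphic_on_imp_continuous_on holomorphic_on_subset[OF assms(1)]) auto
  then show "bdd_above ((\<lambda>z. cmod (F z)) ` sphere 0 r)"
    by (intro bounded_imp_bdd_above compact_imp_bounded)
qed (use assms in simp)

lemma entire_order_synthesis_one: "entire_order (synthesis (\<lambda>_. 1)) = \<infinity>"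
proof -
  let ?M = "max_modulus (synthesis (\<lambda>_. 1))"
  have one_L2: "(\<lambda>_. 1) \<in> weight_L2" by (rule weight_L2_bounded[where B = 1]) auto
  have M_ge: "r \<le> ln (ln (?M r))" if r: "r \<ge> 1" for r
  proof -
    define n where "n = nat \<lceil>exp r\<rceil>"
    have n_ge: "exp r \<le> real n" unfolding n_def by linarith
    have er: "exp r \<ge> 1 + r" by (rule exp_ge_add_one_self)
    have "real n \<le> exp r + 1" unfolding n_def by (simp add: of_nat_nat)
    then have n_le: "real n \<le> exp r * 2" and n1: "real n \<ge> 1" using er n_ge r by linarith+
    have "ln (real n) \<le> ln (exp r * 2)" using n_le n1 by (intro ln_mono) auto
    also have "\<dots> = r + ln 2" by (simp add: ln_mult)
    finally have ln_n: "ln (real n) \<le> r + 1" using ln_2_less_1 by linarith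
    have "2 * fact n \<le> exp 1 * real n ^ n"
      using fact_le_power[of n, where 'a = real] exp_ge_add_one_self[of 1] by (intro mult_mono) auto
    also have "\<dots> = exp (1 + real n * ln (real n))" using n1 by (simp add: exp_of_nat_mult exp_add)
    also have "\<dots> \<le> exp (1 + real n * (r + 1))" using ln_n n1 by (simp add: mult_left_mono)
    finally have fact_n: "2 * fact n \<le> exp (1 + real n * (r + 1))" .
    have "real n * 1 + real n * (r + 1) + 1 \<le> real n * (2 * pi * r)"
    proof -
      have "1 + (r + 1) + 1 \<le> 4 * r" using r by simp
      also have "\<dots> \<le> 2 * pi * r" using pi_ge_two r by (intro mult_right_mono) auto
      finally have "real n * (1 + (r + 1) + 1) \<le> real n * (2 * pi * r)" by (intro mult_left_mono) auto
      then show ?thesis using n1 by (simp add: algebra_simps)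
    qed
    then have "exp (real n) * exp (1 + real n * (r + 1)) \<le> exp (2 * pi * r * real n)"
      unfolding exp_add[symmetric] by (simp add: algebra_simps)
    moreover have "exp (real n) * (2 * fact n) \<le> exp (real n) * exp (1 + real n * (r + 1))"
      by (intro mult_left_mono fact_n) simp
    ultimately have "exp (real n) * (2 * fact n) \<le> exp (2 * pi * r * real n)" by linarith
    then have "exp (real n) \<le> exp (2 * pi * r * real n) / (2 * fact n)" by (simp add: pos_le_divide_eq)
    also have "\<dots> \<le> cmod (synthesis (\<lambda>_. 1) (- (\<i> * of_real r)))" by (rule synthesis_one_ge) (use r in simp)
    also have "\<dots> \<le> ?M r"
      by (rule max_modulus_ge[OF holomorphic_synthesis[OF one_L2]]) (use r in \<open>simp add: norm_mult\<close>)
    finally have "exp (exp r) \<le> ?M r" using n_ge by (meson exp_le_cancel_iff order_trans)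
    then have "exp r \<le> ln (?M r)" by (metis exp_gt_zero ln_exp ln_mono order_less_le_trans)
    then show ?thesis by (metis exp_gt_zero ln_exp ln_mono order_less_le_trans)
  qed
  have "filterlim (\<lambda>r::real. r / ln r) at_top at_top" by real_asymp
  moreover have "\<forall>\<^sub>F r in at_top. r / ln r \<le> ln (ln (?M r)) / ln r"
    using eventually_ge_at_top[of 1] by eventually_elim (auto intro!: divide_right_mono M_ge)
  ultimately have "filterlim (\<lambda>r. ln (ln (?M r)) / ln r) at_top at_top"
    by (rule filterlim_at_top_mono)
  then have "((\<lambda>r. ereal (ln (ln (?M r)) / ln r)) \<longlongrightarrow> \<infinity>) at_top"
    by (simp add: tendsto_PInfty_eq_at_top)
  then show ?thesis unfolding entire_order_def by (intro lim_imp_Limsup) auto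
qed

section \<open>Composition operators defined on the whole space\<close>

text \<open>The representation by transforms needs a nonempty open set; over the empty set the space is
  trivial.\<close>

lemma is_rkhs_empty: "is_rkhs {} k {\<lambda>_. 0} (\<lambda>_ _. 0)"
  by (auto simp: is_rkhs_def function_hilbert_space_def ip_norm_def)

lemma comp_op_bounded_empty: "comp_op_bounded E k {} f"
proof -
  have "is_rkhs {} k {\<lambda>_. 0} (rkhs_inner {} k)" by (rule is_rkhs_rkhs_inner[OF is_rkhs_empty])
  from fhs_norm_zero[OF rkhs_hilbert[OF this]] have "rkhs_norm {} k (comp_op {} f h) = 0" for h
    by (simp add: rkhs_norm_def comp_op_def zero_outside_def)
  then show ?thesis unfolding comp_op_bounded_def by (intro exI[of _ 0]) simp
qed

lemma comp_op_bounded_of_domain: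
  assumes U: "open U" "U \<noteq> {}" and dom: "comp_op_domain UNIV weight_kernel U f = rkhs UNIV weight_kernel"
  shows "comp_op_bounded UNIV weight_kernel U f"
proof -
  have rk: "is_rkhs V weight_kernel (rkhs V weight_kernel) (rkhs_inner V weight_kernel)" if "open V" "V \<noteq> {}" for V
    unfolding rkhs_weight_kernel[OF that] by (rule is_rkhs_rkhs_inner[OF is_rkhs_weight_kernel[OF that]])
  have "zero_outside U (h \<circ> f) \<in> rkhs U weight_kernel" if "h \<in> rkhs UNIV weight_kernel" for h
    using that dom unfolding comp_op_domain_def comp_op_def by blast
  from composition_bounded[OF rk[OF open_UNIV UNIV_not_empty] rk[OF U] UNIV_I this]
  show ?thesis unfolding comp_op_bounded_def dom rkhs_norm_def comp_op_def by blast
qed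

theorem corollary1:
  shows "(\<forall>(U :: real set) (f :: real \<Rightarrow> real).
            open U \<and> comp_op_domain UNIV weight_kernel U f = rkhs UNIV weight_kernel \<longrightarrow>
              comp_op_bounded UNIV weight_kernel U f \<and> (\<exists>a b. \<forall>x\<in>U. f x = a * x + b)) \<and>
         (\<exists>F :: complex \<Rightarrow> complex. F holomorphic_on UNIV \<and> entire_order F = \<infinity> \<and>
            (\<lambda>x :: real. F (of_real x)) \<in> rkhs UNIV weight_kernel)"
proof (intro conjI allI impI)
  fix U :: "real set" and f :: "real \<Rightarrow> real"
  assume *: "open U \<and> comp_op_domain UNIV weight_kernel U f = rkhs UNIV weight_kernel"
  then have U: "open U" and dom: "comp_op_domain UNIV weight_kernel U f = rkhs UNIV weight_kernel" by auto
  show "comp_op_bounded UNIV weight_kernel U f"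
    using comp_op_bounded_empty comp_op_bounded_of_domain[OF U _ dom] by (cases "U = {}") auto
  show "\<exists>a b. \<forall>x\<in>U. f x = a * x + b"
  proof (cases "U = {}")
    case False
    have "zero_outside U (h \<circ> f) \<in> synthesis_on U ` weight_L2" if "h \<in> synthesis_on UNIV ` weight_L2" for h
    proof -
      have "h \<in> comp_op_domain UNIV weight_kernel U f"
        using that by (simp only: dom rkhs_weight_kernel[OF open_UNIV UNIV_not_empty])
      then show ?thesis by (simp add: comp_op_domain_def comp_op_def rkhs_weight_kernel[OF U False])
    qed
    then show ?thesis by (rule bounded_composition_imp_affine[OF U False])
  qed simp
next
  have one_L2: "(\<lambda>_. 1) \<in> weight_L2" by (rule weight_L2_bounded[where B = 1]) auto
  have "(\<lambda>x::real. synthesis (\<lambda>_. 1) (of_real x)) = synthesis_on UNIV (\<lambda>_. 1)"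
    by (simp add: synthesis_on_def zero_outside_def)
  then have "(\<lambda>x::real. synthesis (\<lambda>_. 1) (of_real x)) \<in> rkhs UNIV weight_kernel"
    using one_L2 by (simp add: rkhs_weight_kernel)
  then show "\<exists>F. F holomorphic_on UNIV \<and> entire_order F = \<infinity> \<and> (\<lambda>x::real. F (of_real x)) \<in> rkhs UNIV weight_kernel"
    using holomorphic_synthesis[OF one_L2] entire_order_synthesis_one by blast
qed

end
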